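(* Let $X$ be any one of the five random variables $\mathcal{B}_{\mathrm{ex}},\mathcal{B}_{\mathrm{br}},\mathcal{B}_{\mathrm{bm}},\mathcal{B}_{\mathrm{me}},\mathcal{B}_{\mathrm{dm}}$ (the Brownian excursion area, the integral of the absolute value of a Brownian bridge, the integral of the absolute value of a Brownian motion, the Brownian meander area, and the Brownian double meander area). Then $X$ has negative moments of all orders, i.e. $\mathbb{E}\,X^{-s}<\infty$ for every $s>0$, and $s\mapsto\mathbb{E}\,X^{s}$ is an entire function of $s\in\mathbb{C}$.
   Context: Let $B(t)$ be a standard Brownian motion with $B(0)=0$, considered on $[0,1]$. The Brownian bridge $B_{\mathrm{br}}$ is $B$ on $[0,1]$ conditioned on $B(1)=0$ (equivalently $B_{\mathrm{br}}(t)=B(t)-tB(1)$). The (normalized) Brownian meander $B_{\mathrm{me}}$ is $B$ on $[0,1]$ conditioned on $B(t)\ge0$ for all $t\in[0,1]$. The (normalized) Brownian excursion $B_{\mathrm{ex}}$ is $B$ on $[0,1]$ conditioned on both $B(1)=0$ and $B(t)\ge 0$ for all $t\in[0,1]$ (equivalently, the modulus of a three-dimensional Brownian bridge). The conditionings are understood in the usual limiting sense. The Brownian double meander is $B_{\mathrm{dm}}(t):=B(t)-\min_{0\le u\le1}B(u)$, $t\in[0,1]$. Define $$\mathcal{B}_{\mathrm{ex}}:=\int_0^1B_{\mathrm{ex}}(t)\,dt,\quad \mathcal{B}_{\mathrm{br}}:=\int_0^1|B_{\mathrm{br}}(t)|\,dt,\quad \mathcal{B}_{\mathrm{bm}}:=\int_0^1|B(t)|\,dt,\quad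 \mathcal{B}_{\mathrm{me}}:=\int_0^1 B_{\mathrm{me}}(t)\,dt,\quad \mathcal{B}_{\mathrm{dm}}:=\int_0^1B_{\mathrm{dm}}(t)\,dt.$$ *)

theory Defs
  imports "HOL-Probability.Probability"
begin

text \<open>Processes on the time interval \<open>[0,1]\<close> are functions \<open>X :: real \<Rightarrow> 'a \<Rightarrow> real\<close> of which only
  the values \<open>X t \<omega>\<close> with \<open>t \<in> {0..1}\<close> and \<open>\<omega> \<in> space M\<close> matter.\<close>

definition continuous_process :: "'a measure \<Rightarrow> (real \<Rightarrow> 'a \<Rightarrow> real) \<Rightarrow> bool" where
  "continuous_process M X \<longleftrightarrow>
     prob_space M \<and>
     (\<forall>t\<in>{0..1}. X t \<in> borel_measurable M) \<and>
     (\<forall>\<omega>\<in>space M. continuous_on {0..1} (\<lambda>t. X t \<omega>))"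

definition brownian_motion :: "'a measure \<Rightarrow> (real \<Rightarrow> 'a \<Rightarrow> real) \<Rightarrow> bool" where
  "brownian_motion M B \<longleftrightarrow>
     continuous_process M B \<and>
     (\<forall>\<omega>\<in>space M. B 0 \<omega> = 0) \<and>
     (\<forall>s t. 0 \<le> s \<and> s < t \<and> t \<le> 1 \<longrightarrow>
        distributed M lborel (\<lambda>\<omega>. B t \<omega> - B s \<omega>) (normal_density 0 (sqrt (t - s)))) \<and>
     (\<forall>(n::nat) \<tau>. 0 \<le> \<tau> 0 \<and> (\<forall>i<n. \<tau> i \<le> \<tau> (Suc i)) \<and> \<tau> n \<le> 1 \<longrightarrow>
        prob_space.indep_vars M (\<lambda>_. borel) (\<lambda>i \<omega>. B (\<tau> (Suc i)) \<omega> - B (\<tau> i) \<omega>) {..<n})"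

definition brownian_bridge :: "'a measure \<Rightarrow> (real \<Rightarrow> 'a \<Rightarrow> real) \<Rightarrow> bool" where
  "brownian_bridge M X \<longleftrightarrow>
     (\<exists>B. brownian_motion M B \<and> X = (\<lambda>t \<omega>. B t \<omega> - t * B 1 \<omega>))"

text \<open>Independence of the three coordinate processes is independence of the path-valued random
  variables, for the product sigma-algebra on \<open>[0,1]\<close>-indexed families of reals.\<close>

definition brownian_bridge_3d :: "'a measure \<Rightarrow> (real \<Rightarrow> 'a \<Rightarrow> real ^ 3) \<Rightarrow> bool" where
  "brownian_bridge_3d M X \<longleftrightarrow>
     (\<forall>i. brownian_bridge M (\<lambda>t \<omega>. X t \<omega> $ i)) \<and>
     prob_space.indep_vars M (\<lambda>_. PiM {0..1} (\<lambda>_. borel)) (\<lambda>i \<omega>. \<lambda>t\<in>{0..1}. X t \<omega> $ i) UNIV"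

text \<open>The bridge (Brownian motion conditioned on \<open>B 1 = 0\<close>) and the excursion (conditioned in addition on
  \<open>B \<ge> 0\<close>) are given by their standard explicit constructions: \<open>B t - t * B 1\<close>, and the modulus of a
  three-dimensional bridge. The meander is defined below by the
  conditioning itself.\<close>

definition brownian_excursion :: "'a measure \<Rightarrow> (real \<Rightarrow> 'a \<Rightarrow> real) \<Rightarrow> bool" where
  "brownian_excursion M E \<longleftrightarrow>
     (\<exists>X. brownian_bridge_3d M X \<and> E = (\<lambda>t \<omega>. norm (X t \<omega>)))"

definition brownian_double_meander :: "'a measure \<Rightarrow> (real \<Rightarrow> 'a \<Rightarrow> real) \<Rightarrow> bool" where
  "brownian_double_meander M D \<longleftrightarrow>
     (\<exists>B. brownian_motion M B \<and> D = (\<lambda>t \<omega>. B t \<omega> - (INF u\<in>{0..1}. B u \<omega>)))"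

text \<open>The space \<open>C[0,1]\<close> with the supremum metric; its elements are extensional functions,
  whence the restriction in \<open>sample_path\<close>.\<close>

definition C01 :: "(real \<Rightarrow> real) metric" where
  "C01 = cfunspace (top_of_set {0..1}) euclidean_metric"

definition sample_path :: "(real \<Rightarrow> 'a \<Rightarrow> real) \<Rightarrow> 'a \<Rightarrow> real \<Rightarrow> real" where
  "sample_path X \<omega> = (\<lambda>t\<in>{0..1}. X t \<omega>)"

text \<open>Conditioning on the null event \<open>\<forall>t. B t \<ge> 0\<close>: the law of \<open>Y\<close> on \<open>C[0,1]\<close> is the weak limit, as
  \<open>\<epsilon>\<close> decreases to \<open>0\<close>, of the conditional laws of \<open>B\<close> given the event \<open>\<forall>t. B t \<ge> - \<epsilon>\<close>, which has
  positive probability. The conditional probability measure given an event is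
  \<open>uniform_measure\<close>.\<close>

definition conditioned_nonneg ::
    "'b measure \<Rightarrow> (real \<Rightarrow> 'b \<Rightarrow> real) \<Rightarrow> 'a measure \<Rightarrow> (real \<Rightarrow> 'a \<Rightarrow> real) \<Rightarrow> bool" where
  "conditioned_nonneg N B M Y \<longleftrightarrow>
     (\<forall>F. continuous_map (mtopology_of C01) euclideanreal F \<and> bounded (F ` mspace C01) \<longrightarrow>
        ((\<lambda>\<epsilon>. LINT \<omega>|uniform_measure N {\<omega> \<in> space N. \<forall>t\<in>{0..1}. - \<epsilon> \<le> B t \<omega>}. F (sample_path B \<omega>))
           \<longlongrightarrow> (LINT \<omega>|M. F (sample_path Y \<omega>))) (at_right 0))"

text \<open>The meander need not live on the probability space of the Brownian motion that is being
  conditioned. The latter is taken with sample space of type \<open>real \<Rightarrow> real\<close>, on which Wiener measure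
  exists; since the law of Brownian motion is unique, the choice of this space is irrelevant.\<close>

definition brownian_meander :: "'a measure \<Rightarrow> (real \<Rightarrow> 'a \<Rightarrow> real) \<Rightarrow> bool" where
  "brownian_meander M Y \<longleftrightarrow>
     continuous_process M Y \<and>
     (\<exists>(N :: (real \<Rightarrow> real) measure) B. brownian_motion N B \<and> conditioned_nonneg N B M Y)"

definition path_integral :: "(real \<Rightarrow> 'a \<Rightarrow> real) \<Rightarrow> 'a \<Rightarrow> real" where
  "path_integral X \<omega> = (LBINT t:{0..1}. X t \<omega>)"

end

theory Submission
  imports Defs "HOL-Real_Asymp.Real_Asymp"
begin

text \<open>
  For a positive random variable \<open>X\<close> all of whose real moments are finite, \<open>s \<mapsto> E X powr s\<close> can be
  differentiated under the expectation, so it is entire (\<open>powr_moments_entire\<close>). It remains to bound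
  \<open>E (X + \<delta>)^(-k)\<close> uniformly in \<open>\<delta> > 0\<close>, which also yields \<open>X > 0\<close> almost surely, and to bound the
  positive moments. Odd exponents suffice for the latter.

  Negative moments. In all cases but the meander the integrand dominates \<open>|B t - \<alpha> - \<beta> t|\<close> for a Brownian motion \<open>B\<close>
  and random \<open>\<alpha>\<close>, \<open>\<beta>\<close>: the bridge is \<open>B t - t * B 1\<close>, the double meander is \<open>B t\<close> minus a random
  constant, and the norm of the three-dimensional bridge dominates one coordinate. Second differences of
  the path do not see \<open>\<alpha> + \<beta> t\<close>, and over disjoint blocks they are independent Gaussian variables
  \<open>Z 0, ..., Z (2 k - 1)\<close>. The integral over \<open>[1/2,1]\<close> is an average, over a shift \<open>u\<close>, of sums of \<open>|B t - \<alpha> - \<beta> t|\<close> over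
  \<open>4 k + 1\<close> equidistant points, and each such sum dominates a multiple of every \<open>|Z i|\<close>. Jensen's
  inequality for \<open>x^(-k)\<close> moves the power inside the average, where
  \<open>(S + \<delta>)^(-k) \<le> const * (\<Prod>i<2*k. (|Z i| + \<delta>)^(-1/2))\<close>, and by independence the expectation
  factorises into moments of order \<open>-1/2\<close>, which are finite because the Gaussian density is bounded
  (\<open>negative_moment_bound\<close>).

  Positive moments. Riemann sums, Jensen's inequality and Fatou's lemma reduce them to moments of the
  one-dimensional marginals. Those of the running minimum come from Levy's maximal inequality.

  The meander is the weak limit, as \<open>\<epsilon>\<close> decreases to \<open>0\<close>, of \<open>B\<close> conditioned on \<open>B \<ge> - \<epsilon>\<close>. Both kinds
  of bounds have to be uniform under this conditioning, so each is proved with the factor \<open>\<epsilon>\<close>, which is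
  the order of magnitude of the probability of the conditioning event. That this probability is at least
  of order \<open>\<epsilon>\<close> is Levy's inequality again (\<open>stay_above_prob_ge\<close>). The upper bounds rest on the
  persistence estimate \<open>P(B \<ge> - \<epsilon> on [0,T]) \<le> const * \<epsilon> / sqrt T\<close> (\<open>persistence_prob_le\<close>), which follows
  from a disjointness argument for the position of the minimum of a random walk
  (\<open>positive_walk_prob_le\<close>). For negative moments the persistence event lives on \<open>[0,1/2]\<close> and the second
  differences on \<open>[1/2,1]\<close>, and they are independent. For positive moments, \<open>B t\<close> is split into
  \<open>B (t/16)\<close> and an increment that is independent of persistence up to time \<open>t/16\<close>, which gives a recursion
  in \<open>t\<close> (\<open>moment_on_stay_above\<close>).
\<close>

section \<open>Entire moment functions\<close>

definition entire_moments :: "'a measure \<Rightarrow> ('a \<Rightarrow> real) \<Rightarrow> bool" where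
  "entire_moments M X \<longleftrightarrow>
         (AE w in M. 0 < X w) \<and>
         (\<forall>s::real. s > 0 \<longrightarrow> integrable M (\<lambda>w. X w powr (- s))) \<and>
         (\<forall>s::complex. integrable M (\<lambda>w. complex_of_real (X w) powr s)) \<and>
         (\<lambda>s::complex. LINT w|M. complex_of_real (X w) powr s) holomorphic_on UNIV"

lemma cmod_exp_minus_one_le:
  fixes z h :: complex and l :: real
  assumes "z = h * of_real l" "cmod h \<le> 1" "h \<noteq> 0"
  shows "cmod ((exp z - 1) / h) \<le> exp (2 * \<bar>l\<bar>)"
proof -
  have *: "cmod (exp z - 1) \<le> cmod z * exp \<bar>l\<bar>"
  proof -
    have "cmod (exp z - exp 0) \<le> exp \<bar>l\<bar> * cmod (z - 0)"
    proof (rule field_differentiable_bound[where S = "cball 0 \<bar>l\<bar>" and f' = exp])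
      show "cmod (exp w) \<le> exp \<bar>l\<bar>" if "w \<in> cball 0 \<bar>l\<bar>" for w
        using that norm_exp[of w] by (auto intro: order_trans)
      have "cmod z \<le> 1 * \<bar>l\<bar>"
        unfolding assms(1) norm_mult using assms(2) by (intro mult_mono) auto
      then show "z \<in> cball 0 \<bar>l\<bar>" by simp
    qed (auto intro!: derivative_eq_intros)
    then show ?thesis by (simp add: mult.commute)
  qed
  have "cmod ((exp z - 1) / h) = cmod (exp z - 1) / cmod h"
    by (simp add: norm_divide)
  also have "\<dots> \<le> \<bar>l\<bar> * exp \<bar>l\<bar>"
    using * assms(3) by (simp add: assms(1) norm_mult field_simps)
  also have "\<dots> \<le> exp \<bar>l\<bar> * exp \<bar>l\<bar>"
    using exp_ge_add_one_self[of "\<bar>l\<bar>"] by (intro mult_right_mono) linarith+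
  also have "\<dots> = exp (2 * \<bar>l\<bar>)" by (simp flip: exp_add)
  finally show ?thesis .
qed

text \<open>Writing \<open>X powr s = exp (s * L)\<close> with \<open>L = ln X\<close>, the difference quotients in \<open>s\<close> at steps of modulus at
most \<open>1\<close> are dominated by \<open>X powr Re s * exp (2 * \<bar>L\<bar>)\<close>, hence by
\<open>X powr (Re s + 2) + X powr (Re s - 2)\<close>, which is integrable.\<close>

lemma powr_moments_entire:
  assumes "prob_space M" and X[measurable]: "X \<in> borel_measurable M"
    and pos: "AE w in M. 0 < X w"
    and int: "\<And>s::real. integrable M (\<lambda>w. X w powr s)"
  shows "integrable M (\<lambda>w. complex_of_real (X w) powr s)"
    and "(\<lambda>s::complex. LINT w|M. complex_of_real (X w) powr s) holomorphic_on UNIV"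
proof -
  interpret prob_space M by fact
  define L where "L w = ln (X w)" for w
  have L[measurable]: "L \<in> borel_measurable M" unfolding L_def by simp
  have powr_exp: "complex_of_real (X w) powr s = exp (s * of_real (L w))" if "0 < X w" for w s
    using that by (simp add: powr_def L_def Ln_of_real)
  have meas[measurable]: "(\<lambda>w. complex_of_real (X w) powr s) \<in> borel_measurable M" for s
  proof -
    have "complex_of_real x powr s = (if x = 0 then 0 else
        exp (s * (of_real (ln \<bar>x\<bar>) + (if x < 0 then pi else 0) * \<i>)))" for x :: real
      by (auto simp: powr_def Ln_of_real')
    then show ?thesis by simp
  qed
  have nrm: "cmod (complex_of_real (X w) powr s) = X w powr Re s" if "0 < X w" for w s
    using that by (simp add: norm_powr_real_powr)
  show int_c: "integrable M (\<lambda>w. complex_of_real (X w) powr s)" for s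
  proof (rule Bochner_Integration.integrable_bound[OF int[of "Re s"]])
    show "AE w in M. cmod (complex_of_real (X w) powr s) \<le> norm (X w powr Re s)"
      using pos by eventually_elim (simp add: nrm)
  qed simp
  have "\<exists>D. ((\<lambda>s::complex. LINT w|M. complex_of_real (X w) powr s) has_field_derivative D) (at s)" for s
  proof -
    define g where "g w = complex_of_real (X w) powr s * of_real (L w)" for w
    have g[measurable]: "g \<in> borel_measurable M" unfolding g_def by measurable
    define q where "q h w = (complex_of_real (X w) powr (s + h) - complex_of_real (X w) powr s) / h"
      for h w
    have q[measurable]: "q h \<in> borel_measurable M" for h unfolding q_def by measurable
    have "((\<lambda>h. LINT w|M. q h w) \<longlongrightarrow> (LINT w|M. g w)) (at 0)"
      unfolding tendsto_at_iff_sequentially comp_def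
    proof (intro allI impI)
      fix u :: "nat \<Rightarrow> complex"
      assume u0: "\<forall>i. u i \<in> UNIV - {0}" and u: "u \<longlonglongrightarrow> 0"
      from u have "\<forall>\<^sub>F i in sequentially. cmod (u i) < 1"
        using tendstoD[OF u, of 1] by simp
      then obtain N where N: "\<And>i. i \<ge> N \<Longrightarrow> cmod (u i) < 1"
        by (auto simp: eventually_sequentially)
      have "(\<lambda>i. LINT w|M. q (u (i + N)) w) \<longlonglongrightarrow> (LINT w|M. g w)"
      proof (rule integral_dominated_convergence[where
            w = "\<lambda>w. X w powr (Re s + 2) + X w powr (Re s - 2)"])
        show "integrable M (\<lambda>w. X w powr (Re s + 2) + X w powr (Re s - 2))"
          using int by simp
        have fac: "q h w = complex_of_real (X w) powr s * ((exp (h * of_real (L w)) - 1) / h)"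
          if "0 < X w" for h w
          unfolding q_def powr_exp[OF that] by (simp add: exp_add ring_distribs)
        show "AE w in M. (\<lambda>i. q (u (i + N)) w) \<longlonglongrightarrow> g w"
          using pos
        proof eventually_elim
          case (elim w)
          have "((\<lambda>z. exp (z * of_real (L w))) has_field_derivative of_real (L w)) (at (0::complex))"
            by (auto intro!: derivative_eq_intros)
          then have "((\<lambda>h. (exp (h * of_real (L w)) - 1) / h) \<longlongrightarrow> complex_of_real (L w)) (at 0)"
            by (simp add: has_field_derivative_iff)
          then have "((\<lambda>h. q h w) \<longlongrightarrow> g w) (at 0)"
            unfolding fac[OF elim] g_def by (intro tendsto_mult tendsto_const)
          then have "(\<lambda>i. q (u i) w) \<longlonglongrightarrow> g w"
            using u u0 unfolding tendsto_at_iff_sequentially comp_def by auto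
          then show ?case by (rule LIMSEQ_ignore_initial_segment)
        qed
        show "AE w in M. norm (q (u (i + N)) w) \<le> X w powr (Re s + 2) + X w powr (Re s - 2)" for i
          using pos
        proof eventually_elim
          case (elim w)
          have "norm (q (u (i + N)) w) \<le> X w powr Re s * exp (2 * \<bar>L w\<bar>)"
            unfolding fac[OF elim] norm_mult nrm[OF elim]
            using N[of "i + N"] u0 by (intro mult_left_mono cmod_exp_minus_one_le) auto
          also have "\<dots> = exp (Re s * L w + 2 * \<bar>L w\<bar>)"
            using elim by (simp add: powr_def L_def exp_add)
          also have "\<dots> \<le> exp (Re s * L w + 2 * L w) + exp (Re s * L w - 2 * L w)"
            by (cases "L w \<ge> 0") (auto simp: add_increasing add_increasing2)
          also have "\<dots> = X w powr (Re s + 2) + X w powr (Re s - 2)"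
            using elim by (simp add: powr_def L_def algebra_simps)
          finally show ?case .
        qed
      qed (auto simp: g)
      then show "(\<lambda>i. LINT w|M. q (u i) w) \<longlonglongrightarrow> (LINT w|M. g w)"
        by (rule LIMSEQ_offset)
    qed
    moreover have "(LINT w|M. q h w)
        = ((LINT w|M. complex_of_real (X w) powr (s + h)) - (LINT w|M. complex_of_real (X w) powr s)) / h" for h
      unfolding q_def by (simp add: int_c)
    ultimately have "((\<lambda>s. LINT w|M. complex_of_real (X w) powr s) has_field_derivative (LINT w|M. g w)) (at s)"
      by (simp add: DERIV_def)
    then show ?thesis by blast
  qed
  then show "(\<lambda>s::complex. LINT w|M. complex_of_real (X w) powr s) holomorphic_on UNIV"
    by (auto simp: holomorphic_on_def field_differentiable_def)
qed

text \<open>The shift by \<open>\<delta>\<close> keeps the negative powers finite where \<open>X\<close> might vanish, given the totalised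
\<open>1 / 0 = 0\<close>. Since the bound does not depend on \<open>\<delta>\<close>, the event \<open>X = 0\<close> is null and Fatou's lemma removes the
shift.\<close>

lemma entire_from_moment_bounds:
  assumes "prob_space M" and X[measurable]: "X \<in> borel_measurable M"
    and nonneg: "AE w in M. 0 \<le> X w"
    and neg: "\<And>k::nat. \<exists>K::real. \<forall>\<delta>. 0 < \<delta> \<and> \<delta> < 1 \<longrightarrow> (\<integral>\<^sup>+w. ennreal ((1 / (X w + \<delta>)) ^ k) \<partial>M) \<le> ennreal K"
    and pos: "\<And>r::nat. 1 \<le> r \<Longrightarrow> (\<integral>\<^sup>+w. ennreal (X w ^ (2 * r + 1)) \<partial>M) < \<infinity>"
  shows "entire_moments M X"
proof -
  interpret prob_space M by fact
  define d where "d n = 1 / (real n + 2)" for n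
  have d: "0 < d n" "d n < 1" for n by (auto simp: d_def)
  have d0: "d \<longlonglongrightarrow> 0" unfolding d_def by real_asymp
  have X0: "AE w in M. 0 < X w"
  proof -
    from neg[of 1] obtain K where K: "\<And>\<delta>. 0 < \<delta> \<Longrightarrow> \<delta> < 1 \<Longrightarrow> (\<integral>\<^sup>+w. ennreal (1 / (X w + \<delta>)) \<partial>M) \<le> ennreal K"
      by auto
    have "measure M {w\<in>space M. X w = 0} \<le> max 0 K * d n" for n
    proof -
      have "ennreal (1 / d n) * emeasure M {w\<in>space M. X w = 0}
          = (\<integral>\<^sup>+w. ennreal (1 / d n) * indicator {w\<in>space M. X w = 0} w \<partial>M)"
        by (subst nn_integral_cmult_indicator) auto
      also have "\<dots> \<le> (\<integral>\<^sup>+w. ennreal (1 / (X w + d n)) \<partial>M)"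
        by (rule nn_integral_mono) (simp add: indicator_def)
      also have "\<dots> \<le> ennreal (max 0 K)"
        by (rule order_trans[OF K[OF d] ennreal_leI]) simp
      finally have "ennreal (1 / d n * measure M {w\<in>space M. X w = 0}) \<le> ennreal (max 0 K)"
        using d[of n] by (subst ennreal_mult) (simp_all add: emeasure_eq_measure)
      then have "1 / d n * measure M {w\<in>space M. X w = 0} \<le> max 0 K"
        by (subst (asm) ennreal_le_iff) auto
      then show ?thesis using d[of n] by (simp add: field_simps)
    qed
    moreover have "(\<lambda>n. max 0 K * d n) \<longlonglongrightarrow> max 0 K * 0"
      by (intro tendsto_intros d0)
    ultimately have "measure M {w\<in>space M. X w = 0} \<le> 0"
      by (intro LIMSEQ_le_const[of "\<lambda>n. max 0 K * d n"]) auto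
    then have "measure M {w\<in>space M. X w = 0} = 0" by (simp add: measure_le_0_iff)
    then have "emeasure M {w\<in>space M. X w = 0} = 0" by (simp add: emeasure_eq_measure)
    then have "AE w in M. X w \<noteq> 0"
      by (intro AE_I[where N = "{w\<in>space M. X w = 0}"]) auto
    with nonneg show ?thesis by eventually_elim auto
  qed
  have negk: "(\<integral>\<^sup>+w. ennreal ((1 / X w) ^ k) \<partial>M) < \<infinity>" for k
  proof -
    from neg[of k] obtain K where K: "\<And>\<delta>. 0 < \<delta> \<Longrightarrow> \<delta> < 1 \<Longrightarrow> (\<integral>\<^sup>+w. ennreal ((1 / (X w + \<delta>)) ^ k) \<partial>M) \<le> ennreal K"
      by auto
    have "(\<integral>\<^sup>+w. ennreal ((1 / X w) ^ k) \<partial>M) = (\<integral>\<^sup>+w. liminf (\<lambda>n. ennreal ((1 / (X w + d n)) ^ k)) \<partial>M)"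
    proof (intro nn_integral_cong_AE)
      show "AE w in M. ennreal ((1 / X w) ^ k) = liminf (\<lambda>n. ennreal ((1 / (X w + d n)) ^ k))"
        using X0
      proof eventually_elim
        case (elim w)
        have "(\<lambda>n. (1 / (X w + d n)) ^ k) \<longlonglongrightarrow> (1 / (X w + 0)) ^ k"
          using elim by (intro tendsto_intros d0) auto
        then have "(\<lambda>n. ennreal ((1 / (X w + d n)) ^ k)) \<longlonglongrightarrow> ennreal ((1 / X w) ^ k)"
          by (intro tendsto_ennrealI) auto
        then show ?case by (intro lim_imp_Liminf[symmetric]) auto
      qed
    qed
    also have "\<dots> \<le> liminf (\<lambda>n. \<integral>\<^sup>+w. ennreal ((1 / (X w + d n)) ^ k) \<partial>M)"
      by (intro nn_integral_liminf) auto
    also have "\<dots> \<le> liminf (\<lambda>n. ennreal K)"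
      by (intro Liminf_mono always_eventually allI K d)
    also have "\<dots> = ennreal K" by (intro lim_imp_Liminf) auto
    finally show ?thesis by (auto simp: less_top[symmetric] top_unique)
  qed
  have int: "integrable M (\<lambda>w. X w powr s)" for s
  proof -
    obtain r0 :: nat where r0: "\<bar>s\<bar> \<le> real r0" using real_arch_simple by blast
    define r where "r = Suc r0"
    have r: "\<bar>s\<bar> \<le> real r" "1 \<le> r" using r0 by (auto simp: r_def)
    have le: "X w powr s \<le> 1 + ((1 / X w) ^ r + X w ^ (2 * r + 1))" if "0 < X w" for w
    proof (cases "X w \<ge> 1")
      case True
      then have "X w powr s \<le> X w powr (real (2 * r + 1))" using r by (intro powr_mono) auto
      also have "\<dots> = X w ^ (2 * r + 1)" using that by (subst powr_realpow) auto
      finally show ?thesis using that by (smt (verit) divide_pos_pos zero_less_power)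
    next
      case False
      then have "X w powr s \<le> X w powr (- real r)" using r that by (intro powr_mono') auto
      also have "\<dots> = (1 / X w) ^ r" using that by (simp add: powr_minus powr_realpow power_divide field_simps)
      finally show ?thesis using that by (smt (verit) divide_pos_pos zero_less_power)
    qed
    have "(\<integral>\<^sup>+w. ennreal (X w powr s) \<partial>M) \<le> (\<integral>\<^sup>+w. 1 + (ennreal ((1 / X w) ^ r) + ennreal (X w ^ (2 * r + 1))) \<partial>M)"
    proof (intro nn_integral_mono_AE)
      show "AE w in M. ennreal (X w powr s) \<le> 1 + (ennreal ((1 / X w) ^ r) + ennreal (X w ^ (2 * r + 1)))"
        using X0
      proof eventually_elim
        case (elim w)
        have "ennreal (X w powr s) \<le> ennreal (1 + ((1 / X w) ^ r + X w ^ (2 * r + 1)))"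
          using le[OF elim] by (intro ennreal_leI)
        also have "\<dots> = 1 + (ennreal ((1 / X w) ^ r) + ennreal (X w ^ (2 * r + 1)))"
          using elim by (simp add: ennreal_plus flip: ennreal_1 del: power_Suc)
        finally show ?case .
      qed
    qed
    also have "\<dots> = 1 + ((\<integral>\<^sup>+w. ennreal ((1 / X w) ^ r) \<partial>M) + (\<integral>\<^sup>+w. ennreal (X w ^ (2 * r + 1)) \<partial>M))"
      by (subst nn_integral_add, simp, simp, subst nn_integral_add) (auto simp: emeasure_space_1)
    also have "\<dots> < \<infinity>" using negk[of r] pos[OF r(2)] by (auto simp: less_top)
    finally show ?thesis by (intro integrableI_bounded) auto
  qed
  show ?thesis unfolding entire_moments_def
    using X0 int powr_moments_entire[OF assms(1) X X0 int] by blast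
qed

section \<open>Averages and Riemann sums\<close>

lemma average_inverse_power_le:
  fixes x :: "nat \<Rightarrow> real"
  assumes "m > 0" "\<And>j. j < m \<Longrightarrow> 0 < x j"
  shows "(1 / ((\<Sum>j<m. x j) / m)) ^ k \<le> (\<Sum>j<m. (1 / x j) ^ k) / m"
proof -
  have c: "convex_on {0::real<..} (\<lambda>x. (1 / x) ^ k)"
  proof (intro f''_ge0_imp_convex)
    have D: "((\<lambda>x. (1 / x) ^ n) has_real_derivative - real n * (1 / x) ^ (n + 1)) (at x)"
      if "x \<in> {0<..}" for x :: real and n
    proof -
      have "((\<lambda>x. 1 / x) has_real_derivative - ((1 / x) ^ 2)) (at x)"
        using that by (auto intro!: derivative_eq_intros simp: power2_eq_square)
      moreover have "real n * (- (y ^ 2) * y ^ (n - Suc 0)) = - real n * y ^ (n + 1)" for y :: real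
        by (cases n) (simp_all add: power2_eq_square algebra_simps)
      ultimately show ?thesis
        using DERIV_power[of "\<lambda>x. 1 / x" "- ((1 / x) ^ 2)" x UNIV n] by metis
    qed
    show "((\<lambda>x. (1 / x) ^ k) has_real_derivative - real k * (1 / x) ^ (k + 1)) (at x)" if "x \<in> {0<..}" for x :: real
      using D[OF that] .
    show "((\<lambda>x. - real k * (1 / x) ^ (k + 1)) has_real_derivative - real k * (- real (k + 1) * (1 / x) ^ (k + 1 + 1))) (at x)"
      if "x \<in> {0<..}" for x :: real
      by (intro DERIV_cmult D that)
    show "0 \<le> - real k * (- real (k + 1) * (1 / x) ^ (k + 1 + 1))" if "x \<in> {0<..}" for x :: real
    proof -
      have "0 \<le> real k * (real (k + 1) * (1 / x) ^ (k + 1 + 1))"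
        using that by (intro mult_nonneg_nonneg zero_le_power) auto
      then show ?thesis by (simp only: minus_mult_left[symmetric] minus_mult_right[symmetric] minus_minus)
    qed
  qed auto
  have "(\<lambda>x. (1 / x) ^ k) (\<Sum>j\<in>{..<m}. (1 / real m) *\<^sub>R x j) \<le> (\<Sum>j\<in>{..<m}. (1 / real m) * (\<lambda>x. (1 / x) ^ k) (x j))"
    using assms by (intro convex_on_sum[OF _ _ c]) (auto simp: lessThan_empty_iff)
  then show ?thesis by (simp add: sum_divide_distrib)
qed

lemma average_power_le:
  fixes x :: "nat \<Rightarrow> real"
  assumes "m > 0" "\<And>j. j < m \<Longrightarrow> 0 \<le> x j" "odd k"
  shows "((\<Sum>j<m. x j) / m) ^ k \<le> (\<Sum>j<m. x j ^ k) / m"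
proof -
  have "(\<lambda>x. x ^ k) (\<Sum>j\<in>{..<m}. (1 / real m) *\<^sub>R x j) \<le> (\<Sum>j\<in>{..<m}. (1 / real m) * (\<lambda>x. x ^ k) (x j))"
    using assms by (intro convex_on_sum[OF _ _ convex_power_odd]) (auto simp: lessThan_empty_iff)
  then show ?thesis by (simp add: sum_divide_distrib)
qed

lemma nn_integral_average_le:
  assumes S[measurable]: "S \<in> sets M" and P[measurable]: "\<And>j. j < Suc m \<Longrightarrow> P j \<in> borel_measurable M"
    and P0: "\<And>j w. j < Suc m \<Longrightarrow> w \<in> space M \<Longrightarrow> 0 \<le> P j w"
    and C: "\<And>j. j < Suc m \<Longrightarrow> (\<integral>\<^sup>+w. indicator S w * ennreal (P j w) \<partial>M) \<le> C"
  shows "(\<integral>\<^sup>+w. indicator S w * ennreal ((\<Sum>j<Suc m. P j w) / real (Suc m)) \<partial>M) \<le> C"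
proof -
  have "(\<integral>\<^sup>+w. indicator S w * ennreal ((\<Sum>j<Suc m. P j w) / real (Suc m)) \<partial>M)
      = (\<integral>\<^sup>+w. (\<Sum>j<Suc m. ennreal (1 / real (Suc m)) * (indicator S w * ennreal (P j w))) \<partial>M)"
  proof (intro nn_integral_cong)
    fix w assume w: "w \<in> space M"
    have "ennreal ((\<Sum>j<Suc m. P j w) / real (Suc m)) = (\<Sum>j<Suc m. ennreal (1 / real (Suc m) * P j w))"
      using P0[OF _ w] by (subst sum_ennreal) (auto simp: sum_divide_distrib simp del: sum.lessThan_Suc)
    also have "\<dots> = (\<Sum>j<Suc m. ennreal (1 / real (Suc m)) * ennreal (P j w))"
      using P0[OF _ w] by (intro sum.cong ennreal_mult) auto
    finally show "indicator S w * ennreal ((\<Sum>j<Suc m. P j w) / real (Suc m))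
        = (\<Sum>j<Suc m. ennreal (1 / real (Suc m)) * (indicator S w * ennreal (P j w)))"
      by (simp only: sum_distrib_left mult.left_commute)
  qed
  also have "\<dots> = (\<Sum>j<Suc m. ennreal (1 / real (Suc m)) * (\<integral>\<^sup>+w. indicator S w * ennreal (P j w) \<partial>M))"
    by (subst nn_integral_sum) (auto simp: nn_integral_cmult simp del: sum.lessThan_Suc)
  also have "\<dots> \<le> (\<Sum>j<Suc m. ennreal (1 / real (Suc m)) * C)"
    by (intro sum_mono mult_left_mono C) auto
  also have "\<dots> = (of_nat (Suc m) * ennreal (1 / real (Suc m))) * C"
    by (simp only: sum_constant card_lessThan mult.assoc)
  also have "of_nat (Suc m) * ennreal (1 / real (Suc m)) = 1"
    unfolding ennreal_of_nat_eq_real_of_nat by (subst ennreal_mult[symmetric]) (auto simp del: of_nat_Suc)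
  finally show ?thesis by simp
qed

lemma set_integrable_unit_interval:
  "continuous_on {0..1::real} f \<Longrightarrow> set_integrable lborel {0..1} (f :: real \<Rightarrow> real)"
  by (rule borel_integrable_atLeastAtMost')

text \<open>The Riemann sum is the integral of the step function \<open>t \<mapsto> f (\<lfloor>(m+1) t\<rfloor> / (m+1))\<close>, which is bounded
and converges pointwise on \<open>[0,1)\<close>, so dominated convergence applies.\<close>

lemma riemann_sum_tendsto:
  fixes f :: "real \<Rightarrow> real"
  assumes f: "continuous_on {0..1} f"
  shows "(\<lambda>m. (\<Sum>j<Suc m. f (real j / real (Suc m))) / real (Suc m)) \<longlonglongrightarrow> (LBINT t:{0..1}. f t)"
proof -
  define I where "I m j = {real j / real (Suc m)..<real (Suc j) / real (Suc m)}" for m j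
  define g where "g m t = (\<Sum>j<Suc m. indicator (I m j) t * f (real j / real (Suc m)))" for m and t :: real
  have bd: "bounded (f ` {0..1})"
    using f by (intro compact_imp_bounded compact_continuous_image) auto
  then obtain C where C: "\<And>t. t \<in> {0..1} \<Longrightarrow> \<bar>f t\<bar> \<le> C"
    unfolding bounded_iff by (metis image_eqI real_norm_def)
  have gval: "g m t = f (of_int \<lfloor>real (Suc m) * t\<rfloor> / real (Suc m))" if "0 \<le> t" "t < 1" for m t
  proof -
    define j where "j = nat \<lfloor>real (Suc m) * t\<rfloor>"
    have j: "real j = of_int \<lfloor>real (Suc m) * t\<rfloor>" using that by (simp add: j_def)
    have eq: "t \<in> I m i \<longleftrightarrow> i = j" for i
    proof -
      have "t \<in> I m i \<longleftrightarrow> real i \<le> real (Suc m) * t \<and> real (Suc m) * t < real i + 1"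
        by (auto simp: I_def field_simps)
      also have "\<dots> \<longleftrightarrow> \<lfloor>real (Suc m) * t\<rfloor> = int i" by (auto simp: floor_eq_iff)
      also have "\<dots> \<longleftrightarrow> i = j" using that by (auto simp: j_def)
      finally show ?thesis .
    qed
    have "real (Suc m) * t < real (Suc m)" using that by simp
    then have "real j < real (Suc m)" unfolding j by linarith
    then have jm: "j < Suc m" by linarith
    have "g m t = (\<Sum>i<Suc m. if i = j then f (real i / real (Suc m)) else 0)"
      unfolding g_def by (intro sum.cong) (auto simp: eq indicator_def)
    also have "\<dots> = f (real j / real (Suc m))" using jm by simp
    finally show ?thesis by (simp add: j)
  qed
  have g0: "g m t = 0" if "t < 0 \<or> 1 \<le> t" for m t
  proof -
    have "t \<notin> I m j" if "j < Suc m" for j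
    proof -
      have "real (Suc j) / real (Suc m) \<le> 1" "0 \<le> real j / real (Suc m)" using that by auto
      then show ?thesis using \<open>t < 0 \<or> 1 \<le> t\<close> unfolding I_def atLeastLessThan_iff by linarith
    qed
    then show ?thesis unfolding g_def by (intro sum.neutral) auto
  qed
  have fl: "of_int \<lfloor>real (Suc m) * t\<rfloor> / real (Suc m) \<in> {0..1}" if "0 \<le> t" "t < 1" for m t
  proof -
    have "of_int \<lfloor>real (Suc m) * t\<rfloor> \<le> real (Suc m) * t" by (rule of_int_floor_le)
    also have "\<dots> \<le> real (Suc m)" using that by simp
    finally show ?thesis using that by (simp add: field_simps)
  qed
  have "(\<lambda>m. LBINT t. g m t) \<longlonglongrightarrow> (LBINT t. indicator {0..1} t *\<^sub>R f t)"
  proof (rule integral_dominated_convergence[where w = "\<lambda>t. indicator {0..1} t *\<^sub>R C"])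
    show "(\<lambda>t. indicator {0..1} t *\<^sub>R f t) \<in> borel_measurable lborel"
      using set_integrable_unit_interval[OF f] by (simp add: set_integrable_def borel_measurable_integrable)
    show "g m \<in> borel_measurable lborel" for m
      unfolding g_def I_def by measurable
    show "integrable lborel (\<lambda>t. indicator {0..1::real} t *\<^sub>R C)" by simp
    show "AE t in lborel. (\<lambda>m. g m t) \<longlonglongrightarrow> indicator {0..1} t *\<^sub>R f t"
      using AE_lborel_singleton[of 1]
    proof eventually_elim
      case (elim t)
      show ?case
      proof (cases "0 \<le> t \<and> t < 1")
        case True
        have "(\<lambda>m. of_int \<lfloor>real (Suc m) * t\<rfloor> / real (Suc m)) \<longlonglongrightarrow> t"
        proof (rule real_tendsto_sandwich[where f = "\<lambda>m. t - 1 / real (Suc m)" and h = "\<lambda>m. t"])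
          show "\<forall>\<^sub>F m in sequentially. t - 1 / real (Suc m) \<le> of_int \<lfloor>real (Suc m) * t\<rfloor> / real (Suc m)"
          proof (intro always_eventually allI)
            fix m
            have "real (Suc m) * t - 1 \<le> of_int \<lfloor>real (Suc m) * t\<rfloor>" by linarith
            then have "(real (Suc m) * t - 1) / real (Suc m) \<le> of_int \<lfloor>real (Suc m) * t\<rfloor> / real (Suc m)"
              by (rule divide_right_mono) simp
            moreover have "(real (Suc m) * t - 1) / real (Suc m) = t - 1 / real (Suc m)"
              by (simp add: diff_divide_distrib)
            ultimately show "t - 1 / real (Suc m) \<le> of_int \<lfloor>real (Suc m) * t\<rfloor> / real (Suc m)" by simp
          qed
          show "\<forall>\<^sub>F m in sequentially. of_int \<lfloor>real (Suc m) * t\<rfloor> / real (Suc m) \<le> t"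
          proof (intro always_eventually allI)
            fix m
            have "of_int \<lfloor>real (Suc m) * t\<rfloor> \<le> real (Suc m) * t" by linarith
            then show "of_int \<lfloor>real (Suc m) * t\<rfloor> / real (Suc m) \<le> t"
              by (simp add: field_simps)
          qed
          show "(\<lambda>m. t - 1 / real (Suc m)) \<longlonglongrightarrow> t" by real_asymp
        qed simp
        then have "(\<lambda>m. f (of_int \<lfloor>real (Suc m) * t\<rfloor> / real (Suc m))) \<longlonglongrightarrow> f t"
          using fl True by (intro continuous_on_tendsto_compose[OF f]) auto
        then show ?thesis using True by (simp add: gval)
      next
        case False
        then show ?thesis using elim by (auto simp: g0)
      qed
    qed
    show "AE t in lborel. norm (g m t) \<le> indicator {0..1} t *\<^sub>R C" for m
    proof (intro AE_I2)
      fix t :: real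
      have "0 \<le> C" using C[of 0] by auto
      show "norm (g m t) \<le> indicator {0..1} t *\<^sub>R C"
      proof (cases "0 \<le> t \<and> t < 1")
        case True
        then show ?thesis using C[OF fl[of t m]] by (simp add: gval)
      qed (use \<open>0 \<le> C\<close> in \<open>auto simp: g0\<close>)
    qed
  qed
  moreover have "(LBINT t. g m t) = (\<Sum>j<Suc m. f (real j / real (Suc m))) / real (Suc m)" for m
  proof -
    have "(LBINT t. indicator (I m j) t * f (real j / real (Suc m))) = f (real j / real (Suc m)) / real (Suc m)" for j
      by (simp add: I_def field_simps)
    moreover have "integrable lborel (\<lambda>t. indicator (I m j) t * f (real j / real (Suc m)))" for j
      by (simp add: I_def integrable_real_indicator divide_right_mono)
    ultimately show ?thesis
      unfolding g_def sum_divide_distrib by (subst Bochner_Integration.integral_sum) (auto simp del: sum.lessThan_Suc)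
  qed
  ultimately show ?thesis by (simp add: set_lebesgue_integral_def)
qed

section \<open>Gaussian estimates\<close>

context prob_space begin

lemma normal_abs_odd_moment:
  assumes Z: "distributed M lborel Z (normal_density 0 \<sigma>)" and s: "0 < \<sigma>"
  shows "(\<integral>\<^sup>+w. ennreal (\<bar>Z w\<bar> ^ (2 * r + 1)) \<partial>M) = ennreal (\<sigma> ^ (2 * r + 1) * (2 ^ r * fact r * sqrt (2 / pi)))"
proof -
  have "(\<integral>\<^sup>+w. ennreal (\<bar>Z w\<bar> ^ (2 * r + 1)) \<partial>M)
      = (\<integral>\<^sup>+z. ennreal (normal_density 0 \<sigma> z) * ennreal (\<bar>z\<bar> ^ (2 * r + 1)) \<partial>lborel)"
    by (subst distributed_nn_integral[OF Z]) auto
  also have "\<dots> = (\<integral>\<^sup>+z. ennreal (normal_density 0 \<sigma> z * \<bar>z - 0\<bar> ^ (2 * r + 1)) \<partial>lborel)"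
    by (intro nn_integral_cong) (simp add: ennreal_mult)
  also have "\<dots> = ennreal (2 ^ r * \<sigma> ^ (2 * r + 1) * fact r * sqrt (2 / pi))"
    using normal_moment_abs_odd[OF s, of 0 r]
    by (subst nn_integral_eq_integral) (auto simp: has_bochner_integral_iff)
  finally show ?thesis by (simp add: ac_simps)
qed

text \<open>The density is at most \<open>1 / \<sigma>\<close>, so the part with \<open>\<bar>Z\<bar> \<le> 1\<close> is bounded by an elementary integral, and
elsewhere the integrand is at most \<open>1\<close>.\<close>

lemma normal_inverse_sqrt_moment:
  assumes Z: "distributed M lborel Z (normal_density 0 \<sigma>)" and s: "0 < \<sigma>"
    and d: "0 < \<delta>" "\<delta> < 1"
  shows "(\<integral>\<^sup>+w. ennreal (1 / sqrt (\<bar>Z w\<bar> + \<delta>)) \<partial>M) \<le> ennreal (1 + 6 / \<sigma>)"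
proof -
  define g where "g z = 1 / sqrt (\<bar>z\<bar> + \<delta>)" for z
  have g0: "0 \<le> g z" for z unfolding g_def using d by simp
  have gm[measurable]: "g \<in> borel_measurable borel" unfolding g_def by measurable
  have dens: "normal_density 0 \<sigma> z \<le> 1 / \<sigma>" for z
  proof -
    have "sqrt (2 * pi * \<sigma>\<^sup>2) \<ge> \<sigma>"
      using pi_ge_two s by (intro real_le_rsqrt) (simp add: mult_le_cancel_right1)
    then have "normal_density 0 \<sigma> z \<le> 1 / \<sigma> * 1"
      unfolding normal_density_def using s by (intro mult_mono) (auto simp: frac_le)
    then show ?thesis by simp
  qed
  have i1: "(\<integral>\<^sup>+z. ennreal (1 / sqrt (z + \<delta>)) * indicator {0..1} z \<partial>lborel) = ennreal (2 * sqrt (1 + \<delta>) - 2 * sqrt (0 + \<delta>))"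
  proof (rule nn_integral_FTC_Icc)
    show "((\<lambda>z. 2 * sqrt (z + \<delta>)) has_real_derivative 1 / sqrt (x + \<delta>)) (at x)" if "x \<in> {0..1}" for x
      using that d
      by (auto intro!: derivative_eq_intros simp: field_simps)
  qed (use d in auto)
  have i2: "(\<integral>\<^sup>+z. ennreal (1 / sqrt (- z + \<delta>)) * indicator {-1..0} z \<partial>lborel) = ennreal (- 2 * sqrt (- 0 + \<delta>) - (- 2 * sqrt (- (-1) + \<delta>)))"
  proof (rule nn_integral_FTC_Icc)
    show "((\<lambda>z. - 2 * sqrt (- z + \<delta>)) has_real_derivative 1 / sqrt (- x + \<delta>)) (at x)" if "x \<in> {-1..0}" for x
      using that d
      by (auto intro!: derivative_eq_intros simp: field_simps)
  qed (use d in auto)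
  have s3: "2 * sqrt (1 + \<delta>) \<le> 3"
  proof -
    have "sqrt (1 + \<delta>) \<le> 3 / 2" using d by (intro real_le_lsqrt) (auto simp: power2_eq_square)
    then show ?thesis by simp
  qed
  have "(\<integral>\<^sup>+w. ennreal (g (Z w)) \<partial>M) = (\<integral>\<^sup>+z. ennreal (normal_density 0 \<sigma> z) * ennreal (g z) \<partial>lborel)"
    by (subst distributed_nn_integral[OF Z]) auto
  also have "\<dots> \<le> (\<integral>\<^sup>+z. ennreal (normal_density 0 \<sigma> z) +
      (ennreal (1 / \<sigma>) * (ennreal (1 / sqrt (z + \<delta>)) * indicator {0..1} z)
       + ennreal (1 / \<sigma>) * (ennreal (1 / sqrt (- z + \<delta>)) * indicator {-1..0} z)) \<partial>lborel)"
  proof (rule nn_integral_mono)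
    fix z :: real
    show "ennreal (normal_density 0 \<sigma> z) * ennreal (g z) \<le> ennreal (normal_density 0 \<sigma> z) +
      (ennreal (1 / \<sigma>) * (ennreal (1 / sqrt (z + \<delta>)) * indicator {0..1} z)
       + ennreal (1 / \<sigma>) * (ennreal (1 / sqrt (- z + \<delta>)) * indicator {-1..0} z))"
    proof (cases "\<bar>z\<bar> \<le> 1")
      case True
      have "ennreal (normal_density 0 \<sigma> z) * ennreal (g z) \<le> ennreal (1 / \<sigma>) * ennreal (g z)"
        by (intro mult_right_mono ennreal_leI dens) auto
      also have "\<dots> \<le> ennreal (1 / \<sigma>) * (ennreal (1 / sqrt (z + \<delta>)) * indicator {0..1} z)
       + ennreal (1 / \<sigma>) * (ennreal (1 / sqrt (- z + \<delta>)) * indicator {-1..0} z)"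
        using True by (cases "0 \<le> z") (auto simp: g_def indicator_def)
      finally show ?thesis by (simp add: add_increasing)
    next
      case False
      then have "g z \<le> 1" using d unfolding g_def by (simp add: real_le_rsqrt)
      then have "ennreal (normal_density 0 \<sigma> z) * ennreal (g z) \<le> ennreal (normal_density 0 \<sigma> z) * 1"
        by (intro mult_left_mono) auto
      then show ?thesis by (simp add: add_increasing2)
    qed
  qed
  also have "\<dots> = 1 + (ennreal (1 / \<sigma>) * ennreal (2 * sqrt (1 + \<delta>) - 2 * sqrt (0 + \<delta>))
      + ennreal (1 / \<sigma>) * ennreal (- 2 * sqrt (- 0 + \<delta>) - (- 2 * sqrt (- (-1) + \<delta>))))"
  proof -
    have "(\<integral>\<^sup>+z. ennreal (normal_density 0 \<sigma> z) \<partial>lborel) = 1"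
      using s by (subst nn_integral_eq_integral) auto
    then show ?thesis
      by (simp add: nn_integral_add nn_integral_cmult i1[simplified] i2[simplified])
  qed
  also have "\<dots> \<le> 1 + (ennreal (1 / \<sigma>) * ennreal 3 + ennreal (1 / \<sigma>) * ennreal 3)"
    using s3 d real_sqrt_ge_zero[of \<delta>]
    by (intro add_mono mult_left_mono ennreal_leI order_refl) (simp_all del: real_sqrt_ge_zero real_sqrt_ge_0_iff)
  also have "\<dots> = ennreal (1 + 6 / \<sigma>)"
    using s by (simp add: ennreal_plus[symmetric] ennreal_mult[symmetric] del: ennreal_plus flip: ennreal_1 ennreal_numeral)
  finally show ?thesis by (simp add: g_def)
qed

lemma normal_interval_prob_ge:
  assumes Z: "distributed M lborel Z (normal_density 0 \<sigma>)"
    and ab: "a \<le> b" and c: "0 \<le> c" "\<And>z. z \<in> {a..b} \<Longrightarrow> c \<le> normal_density 0 \<sigma> z"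
  shows "c * (b - a) \<le> prob {w\<in>space M. Z w \<in> {a..b}}"
proof -
  have [measurable]: "Z \<in> borel_measurable M" using distributed_measurable[OF Z] by simp
  have "ennreal (c * (b - a)) = (\<integral>\<^sup>+z. ennreal c * indicator {a..b} z \<partial>lborel)"
    using ab c by (subst nn_integral_cmult_indicator) (auto simp: ennreal_mult)
  also have "\<dots> \<le> (\<integral>\<^sup>+z. ennreal (normal_density 0 \<sigma> z) * indicator {a..b} z \<partial>lborel)"
    using c by (intro nn_integral_mono) (auto split: split_indicator)
  also have "\<dots> = (\<integral>\<^sup>+w. indicator {a..b} (Z w) \<partial>M)"
    by (subst distributed_nn_integral[OF Z]) auto
  also have "\<dots> = (\<integral>\<^sup>+w. indicator {w\<in>space M. Z w \<in> {a..b}} w \<partial>M)"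
    by (intro nn_integral_cong) (auto split: split_indicator)
  also have "\<dots> = ennreal (prob {w\<in>space M. Z w \<in> {a..b}})"
    by (simp add: emeasure_eq_measure)
  finally show ?thesis by simp
qed

lemma sqrt_2pi_le_3: "sqrt (2 * pi) \<le> 3"
  using pi_less_4 by (intro real_le_lsqrt) auto

text \<open>The bound is the length of \<open>[3/2 \<sigma>, 2 \<sigma>]\<close> times a lower bound for the density at its right end.\<close>

lemma normal_tail_prob_ge:
  assumes Z: "distributed M lborel Z (normal_density 0 \<sigma>)" and "0 < \<sigma>" "\<epsilon> \<le> \<sigma>"
  shows "exp (- 2) / 6 \<le> prob {w\<in>space M. \<epsilon> < Z w}"
proof -
  have [measurable]: "Z \<in> borel_measurable M" using distributed_measurable[OF Z] by simp
  have "exp (- 2) / (3 * \<sigma>) * (2 * \<sigma> - 3 / 2 * \<sigma>) \<le> prob {w\<in>space M. Z w \<in> {3 / 2 * \<sigma>..2 * \<sigma>}}"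
  proof (rule normal_interval_prob_ge[OF Z])
    fix z assume z: "z \<in> {3 / 2 * \<sigma>..2 * \<sigma>}"
    have "z\<^sup>2 \<le> (2 * \<sigma>)\<^sup>2" using z assms by (intro power_mono) auto
    then have "z\<^sup>2 / (2 * \<sigma>\<^sup>2) \<le> 2" using assms by (simp add: divide_simps power2_eq_square)
    moreover have "sqrt (2 * pi * \<sigma>\<^sup>2) = sqrt (2 * pi) * \<sigma>" using assms by (simp add: real_sqrt_mult)
    moreover have "1 / (3 * \<sigma>) \<le> 1 / (sqrt (2 * pi) * \<sigma>)"
      using sqrt_2pi_le_3 assms by (intro divide_left_mono mult_right_mono) auto
    ultimately have "1 / (3 * \<sigma>) * exp (-2) \<le> normal_density 0 \<sigma> z"
      unfolding normal_density_def using assms by (intro mult_mono) auto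
    then show "exp (- 2) / (3 * \<sigma>) \<le> normal_density 0 \<sigma> z" by simp
  qed (use assms in auto)
  also have "\<dots> \<le> prob {w\<in>space M. \<epsilon> < Z w}"
    using assms by (intro finite_measure_mono) auto
  finally show ?thesis using assms by simp
qed

lemma std_normal_central_prob_ge:
  assumes Z: "distributed M lborel Z (normal_density 0 1)" and "0 < \<epsilon>" "\<epsilon> \<le> 1"
  shows "exp (- 1) / 3 * \<epsilon> \<le> prob {w\<in>space M. \<bar>Z w\<bar> \<le> \<epsilon>}"
proof -
  have [measurable]: "Z \<in> borel_measurable M" using distributed_measurable[OF Z] by simp
  have "exp (- 1) / 3 * (\<epsilon> - 0) \<le> prob {w\<in>space M. Z w \<in> {0..\<epsilon>}}"
  proof (rule normal_interval_prob_ge[OF Z])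
    fix z assume z: "z \<in> {0..\<epsilon>}"
    have "z\<^sup>2 \<le> 1\<^sup>2" using z assms by (intro power_mono) auto
    moreover have "1 / 3 \<le> 1 / sqrt (2 * pi)"
      using sqrt_2pi_le_3 by (intro divide_left_mono) auto
    ultimately have "1 / 3 * exp (-1) \<le> normal_density 0 1 z"
      unfolding normal_density_def by (intro mult_mono) auto
    then show "exp (- 1) / 3 \<le> normal_density 0 1 z" by simp
  qed (use assms in auto)
  also have "\<dots> \<le> prob {w\<in>space M. \<bar>Z w\<bar> \<le> \<epsilon>}"
    using assms by (intro finite_measure_mono) auto
  finally show ?thesis by simp
qed

lemma normal_uminus:
  assumes Z: "distributed M lborel Z (normal_density 0 \<sigma>)" and "0 < \<sigma>"
  shows "distributed M lborel (\<lambda>w. - Z w) (normal_density 0 \<sigma>)"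
  using normal_density_affine[OF Z assms(2), of "-1" 0] by simp

lemma normal_nonpos_prob_ge:
  assumes Z: "distributed M lborel Z (normal_density 0 \<sigma>)" and s: "0 < \<sigma>"
  shows "1 / 2 \<le> prob {w\<in>space M. Z w \<le> 0}"
proof -
  have [measurable]: "Z \<in> borel_measurable M" using distributed_measurable[OF Z] by simp
  have "distr M lborel Z = distr M lborel (\<lambda>w. - Z w)"
    using Z normal_uminus[OF Z s] by (simp add: distributed_def)
  then have "measure (distr M lborel Z) {..0} = measure (distr M lborel (\<lambda>w. - Z w)) {..0}" by simp
  then have "prob {w\<in>space M. Z w \<le> 0} = prob {w\<in>space M. 0 \<le> Z w}"
    by (simp add: measure_distr vimage_def Int_def conj_commute)
  moreover have "1 = prob ({w\<in>space M. Z w \<le> 0} \<union> {w\<in>space M. 0 \<le> Z w})"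
    by (subst prob_space[symmetric], rule arg_cong[where f = prob]) auto
  then have "1 \<le> prob {w\<in>space M. Z w \<le> 0} + prob {w\<in>space M. 0 \<le> Z w}"
    using measure_Un_le[of "{w\<in>space M. Z w \<le> 0}" M "{w\<in>space M. 0 \<le> Z w}"] by simp
  ultimately show ?thesis by simp
qed

end

section \<open>Independent blocks and Brownian increments\<close>

abbreviation borel_power :: "'i set \<Rightarrow> ('i \<Rightarrow> real) measure" where
  "borel_power A \<equiv> PiM A (\<lambda>_. borel)"

context prob_space begin

lemma indep_vars_reindex_inj:
  assumes X: "indep_vars (\<lambda>_. borel) X I" and r: "inj_on r J" "r ` J \<subseteq> I"
  shows "indep_vars (\<lambda>_. borel) (\<lambda>j. X (r j)) J"
proof -
  have "indep_vars (\<lambda>j. PiM {r j} (\<lambda>_. borel)) (\<lambda>j w. restrict (\<lambda>i. X i w) {r j}) J"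
    using r by (intro indep_vars_restrict[OF X]) (auto simp: disjoint_family_on_def inj_on_def)
  then have "indep_vars (\<lambda>_. borel) (\<lambda>j w. (\<lambda>x. x (r j)) (restrict (\<lambda>i. X i w) {r j})) J"
    by (rule indep_vars_compose2) auto
  then show ?thesis by simp
qed

lemma indep_var_of_indep_vars:
  fixes X :: "'i \<Rightarrow> 'a \<Rightarrow> real"
  assumes X: "indep_vars (\<lambda>_. borel) X I" and "a \<in> I" "b \<in> I" "a \<noteq> b"
  shows "indep_var borel (X a) borel (X b)"
proof -
  have "indep_vars (\<lambda>_. borel) (\<lambda>j. X (case_bool a b j)) UNIV"
    using assms by (intro indep_vars_reindex_inj[OF X]) (auto simp: inj_on_def split: bool.splits)
  moreover have "(\<lambda>j. X (case_bool a b j)) = case_bool (X a) (X b)" "case_bool borel borel = (\<lambda>_. borel :: real measure)"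
    by (auto simp: fun_eq_iff split: bool.splits)
  ultimately show ?thesis by (simp only: indep_var_def)
qed

lemma indep_blocks_nn_integral:
  assumes X: "indep_vars (\<lambda>_. borel :: real measure) X I" and L: "finite L" "disjoint_family_on K L" "\<And>j. j \<in> L \<Longrightarrow> K j \<subseteq> I"
    and f: "\<And>j. j \<in> L \<Longrightarrow> f j \<in> borel_measurable (borel_power (K j))"
  shows "(\<integral>\<^sup>+w. (\<Prod>j\<in>L. f j (restrict (\<lambda>i. X i w) (K j))) \<partial>M) = (\<Prod>j\<in>L. \<integral>\<^sup>+w. f j (restrict (\<lambda>i. X i w) (K j)) \<partial>M)"
    (is "?l = (?r :: ennreal)")
proof -
  have "indep_vars (\<lambda>j. borel_power (K j)) (\<lambda>j w. restrict (\<lambda>i. X i w) (K j)) L"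
    using L by (intro indep_vars_restrict[OF X]) auto
  then have "indep_vars (\<lambda>_. borel) (\<lambda>j w. f j (restrict (\<lambda>i. X i w) (K j))) L"
    by (rule indep_vars_compose2) (use f in auto)
  then show ?thesis by (intro indep_vars_nn_integral L) auto
qed

end

lemma brownian_motionD:
  assumes "brownian_motion M B"
  shows "prob_space M" "\<And>t. t \<in> {0..1} \<Longrightarrow> B t \<in> borel_measurable M"
    "\<And>w. w \<in> space M \<Longrightarrow> continuous_on {0..1} (\<lambda>t. B t w)"
    "\<And>w. w \<in> space M \<Longrightarrow> B 0 w = 0"
    "\<And>s t. 0 \<le> s \<Longrightarrow> s < t \<Longrightarrow> t \<le> 1 \<Longrightarrow> distributed M lborel (\<lambda>w. B t w - B s w) (normal_density 0 (sqrt (t - s)))"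
    "\<And>(n::nat) \<tau>. 0 \<le> \<tau> 0 \<Longrightarrow> (\<And>i. i < n \<Longrightarrow> \<tau> i \<le> \<tau> (Suc i)) \<Longrightarrow> \<tau> n \<le> 1 \<Longrightarrow>
      prob_space.indep_vars M (\<lambda>_. borel) (\<lambda>i w. B (\<tau> (Suc i)) w - B (\<tau> i) w) {..<n}"
  using assms unfolding brownian_motion_def continuous_process_def by auto

text \<open>For \<open>q = 0\<close> the only grid point is \<open>0\<close>, because \<open>0 / 0 = 0\<close>. Then the event is the whole space whenever
\<open>\<epsilon> \<ge> 0\<close>, so that statements about grid events include unconditional ones.\<close>

definition grid_event :: "'a measure \<Rightarrow> (real \<Rightarrow> 'a \<Rightarrow> real) \<Rightarrow> real \<Rightarrow> nat \<Rightarrow> real \<Rightarrow> 'a set" where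
  "grid_event M B T q \<epsilon> = {w\<in>space M. \<forall>i\<le>q. - \<epsilon> \<le> B (T * (real i / real q)) w}"

lemma grid_point_in_unit:
  assumes "0 \<le> T" "T \<le> 1" "i \<le> q"
  shows "T * (real i / real q) \<in> {0..1}"
proof -
  have "real i / real q \<le> 1" using assms by (cases "q = 0") (simp_all add: divide_le_eq_1)
  then show ?thesis using assms mult_mono[of T 1 "real i / real q" 1] by simp
qed

lemma grid_event_measurable:
  assumes "brownian_motion M B" "0 \<le> T" "T \<le> 1"
  shows "grid_event M B T q \<epsilon> \<in> sets M"
proof -
  have [measurable]: "B (T * (real i / real q)) \<in> borel_measurable M" if "i \<le> q" for i
    using brownian_motionD(2)[OF assms(1)] grid_point_in_unit[OF assms(2,3) that] .
  have "grid_event M B T q \<epsilon> = (\<Inter>i\<in>{..q}. {w\<in>space M. - \<epsilon> \<le> B (T * (real i / real q)) w})"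
    by (auto simp: grid_event_def)
  also have "\<dots> \<in> sets M" by (intro sets.finite_INT) (auto simp del: times_divide_eq_right)
  finally show ?thesis .
qed

lemma telescope: "B (\<tau> i) = B (\<tau> 0) + (\<Sum>j<i. B (\<tau> (Suc j)) - B (\<tau> j :: 'b))" for B :: "'b \<Rightarrow> real"
  by (induction i) auto

lemma partial_sum_measurable:
  fixes r :: "nat \<Rightarrow> nat"
  assumes "r ` {..<i} \<subseteq> A"
  shows "(\<lambda>x. \<Sum>l<i. x (r l)) \<in> borel_measurable (borel_power A)"
  using assms by (intro borel_measurable_sum measurable_component_singleton) auto

lemma positive_walk_sets:
  fixes r :: "nat \<Rightarrow> nat"
  assumes "r ` {..<n} \<subseteq> A"
  shows "{x \<in> space (borel_power A). \<forall>i\<in>{1..n}. 0 < s * (\<Sum>l<i. x (r l))} \<in> sets (borel_power A)"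
proof (rule sets.sets_Collect_finite_All)
  fix i assume i: "i \<in> {1..n}"
  have [measurable]: "(\<lambda>x. \<Sum>l<i. x (r l)) \<in> borel_measurable (borel_power A)"
    using assms i by (intro partial_sum_measurable) auto
  show "{x \<in> space (borel_power A). 0 < s * (\<Sum>l<i. x (r l))} \<in> sets (borel_power A)"
    by measurable
qed simp

lemma barrier_walk_sets:
  fixes r :: "nat \<Rightarrow> nat"
  assumes "r ` {..<n} \<subseteq> A"
  shows "{x \<in> space (borel_power A). \<forall>i\<in>{..n}. - a \<le> (\<Sum>l<i. x (r l))} \<in> sets (borel_power A)"
proof (rule sets.sets_Collect_finite_All)
  fix i assume i: "i \<in> {..n}"
  have [measurable]: "(\<lambda>x. \<Sum>l<i. x (r l)) \<in> borel_measurable (borel_power A)"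
    using assms i by (intro partial_sum_measurable) auto
  show "{x \<in> space (borel_power A). - a \<le> (\<Sum>l<i. x (r l))} \<in> sets (borel_power A)"
    by measurable
qed simp

lemma barrier_indicator_measurable:
  fixes q :: nat
  shows "(\<lambda>x. if \<forall>i\<in>{..q}. - a \<le> (\<Sum>l<i. x l) then 1 else (0::ennreal)) \<in> borel_measurable (borel_power {..<q})"
proof -
  have "{x \<in> space (borel_power {..<q}). \<forall>i\<in>{..q}. - a \<le> (\<Sum>l<i. x l)} \<in> sets (borel_power {..<q})"
    by (rule barrier_walk_sets[where r = "\<lambda>l. l"]) auto
  then show ?thesis by (intro measurable_If) auto
qed

lemma grid_event_barrier_indicator:
  assumes B: "brownian_motion M B" and w: "w \<in> space M" and \<tau>: "\<And>i. i \<le> q \<Longrightarrow> \<tau> i = T * (real i / real q)"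
  shows "(if \<forall>i\<in>{..q}. - \<epsilon> \<le> (\<Sum>l<i. restrict (\<lambda>i. B (\<tau> (Suc i)) w - B (\<tau> i) w) {..<q} l) then 1 else (0::ennreal))
    = indicator (grid_event M B T q \<epsilon>) w"
proof -
  have "(\<Sum>l<i. restrict (\<lambda>i. B (\<tau> (Suc i)) w - B (\<tau> i) w) {..<q} l) = B (T * (real i / real q)) w" if i: "i \<le> q" for i
  proof -
    have "(\<Sum>l<i. restrict (\<lambda>i. B (\<tau> (Suc i)) w - B (\<tau> i) w) {..<q} l) = (\<Sum>l<i. B (\<tau> (Suc l)) w - B (\<tau> l) w)"
      using i by (intro sum.cong) auto
    then show ?thesis
      using telescope[of "\<lambda>t. B t w" \<tau> i] i brownian_motionD(4)[OF B w] by (simp add: \<tau>)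
  qed
  then show ?thesis using w by (auto simp: grid_event_def indicator_def)
qed

section \<open>Negative moments through second differences\<close>

text \<open>Each of the \<open>2 k\<close> factors \<open>(S + \<delta>)^(-1/2)\<close> of \<open>(S + \<delta>)^(-k)\<close> is estimated by means of a different \<open>z i\<close>.
With exponent \<open>-1/2\<close> per factor the singularity at \<open>z i = 0\<close> is integrable.\<close>

lemma one_over_power_le_prod:
  fixes S :: real and z :: "nat \<Rightarrow> real"
  assumes h: "0 < h" "h \<le> 2" and d: "0 < \<delta>" and S: "\<And>i. i < 2 * k \<Longrightarrow> h / 2 * \<bar>z i\<bar> \<le> S" and S0: "0 \<le> S"
  shows "(1 / (S + \<delta>)) ^ k \<le> (2 / h) ^ k * (\<Prod>i<2 * k. 1 / sqrt (\<bar>z i\<bar> + \<delta>))"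
proof -
  have "(1 / (S + \<delta>)) ^ k = (\<Prod>i<2 * k. 1 / sqrt (S + \<delta>))"
    using S0 d by (simp add: power_mult power_divide)
  also have "\<dots> \<le> (\<Prod>i<2 * k. sqrt (2 / h) * (1 / sqrt (\<bar>z i\<bar> + \<delta>)))"
  proof (intro prod_mono conjI)
    fix i assume i: "i \<in> {..<2 * k}"
    have "h / 2 * \<delta> \<le> 1 * \<delta>" using h d by (intro mult_right_mono) auto
    then have "h / 2 * (\<bar>z i\<bar> + \<delta>) \<le> S + \<delta>"
      using S[of i] i by (simp add: distrib_left)
    then have "sqrt (h / 2 * (\<bar>z i\<bar> + \<delta>)) \<le> sqrt (S + \<delta>)" by simp
    then have "1 / sqrt (S + \<delta>) \<le> 1 / sqrt (h / 2 * (\<bar>z i\<bar> + \<delta>))"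
      using h d S0 by (intro divide_left_mono mult_pos_pos) (auto simp: add_nonneg_pos)
    also have "\<dots> = sqrt (2 / h) * (1 / sqrt (\<bar>z i\<bar> + \<delta>))"
      by (simp add: real_sqrt_mult real_sqrt_divide)
    finally show "1 / sqrt (S + \<delta>) \<le> sqrt (2 / h) * (1 / sqrt (\<bar>z i\<bar> + \<delta>))" .
  qed (use S0 d in auto)
  also have "\<dots> = sqrt (2 / h) ^ (2 * k) * (\<Prod>i<2 * k. 1 / sqrt (\<bar>z i\<bar> + \<delta>))"
    by (subst prod.distrib) simp
  also have "sqrt (2 / h) ^ (2 * k) = (2 / h) ^ k" using h by (simp add: power_mult)
  finally show ?thesis .
qed

text \<open>The nodes \<open>node k u i\<close> for \<open>i \<le> 4 * k\<close> and \<open>0 \<le> u \<le> mesh k\<close> lie in \<open>[1/2, 1]\<close>. The first half of the time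
interval is left free for an event that is independent of the increments between the nodes.\<close>

definition mesh :: "nat \<Rightarrow> real" where "mesh k = 1 / (2 * (4 * real k + 1))"

definition node :: "nat \<Rightarrow> real \<Rightarrow> nat \<Rightarrow> real" where "node k u i = 1 / 2 + u + real i * mesh k"

definition second_difference :: "nat \<Rightarrow> (real \<Rightarrow> real) \<Rightarrow> real \<Rightarrow> nat \<Rightarrow> real" where
  "second_difference k f u i = (f (node k u (2 * i + 2)) - f (node k u (2 * i + 1)))
     - (f (node k u (2 * i + 1)) - f (node k u (2 * i)))"

lemma mesh_pos: "0 < mesh k" "mesh k \<le> 1" by (auto simp: mesh_def divide_simps)

lemma node_in: "i \<le> 4 * k \<Longrightarrow> 0 \<le> u \<Longrightarrow> u \<le> mesh k \<Longrightarrow> node k u i \<in> {1/2..1}"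
proof -
  assume a: "i \<le> 4 * k" "0 \<le> u" "u \<le> mesh k"
  have "real i * mesh k \<le> 4 * real k * mesh k"
    using a mesh_pos[of k] by (intro mult_right_mono) auto
  then have "u + real i * mesh k \<le> (4 * real k + 1) * mesh k" using a by (simp add: distrib_right)
  also have "\<dots> = 1 / 2" by (simp add: mesh_def divide_simps)
  finally show ?thesis using a mesh_pos[of k] by (auto simp: node_def)
qed

text \<open>A Riemann sum over \<open>2 * (4 * k + 1) * (m + 1)\<close> points, restricted to the points in \<open>[1/2, 1]\<close>, is the average
over the \<open>m + 1\<close> shifts \<open>u\<close> of \<open>mesh k\<close> times the sums over the nodes. Restricting to \<open>[1/2, 1]\<close> only
decreases a sum of absolute values. Jensen's inequality then takes the negative power inside the average.\<close>

lemma inverse_power_integral_le_liminf: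
  fixes f :: "real \<Rightarrow> real"
  assumes f: "continuous_on {0..1} f" and d: "0 < \<delta>"
  shows "ennreal ((1 / ((LBINT t:{0..1}. \<bar>f t\<bar>) + \<delta>)) ^ k) \<le> liminf (\<lambda>m. ennreal ((\<Sum>j<Suc m. (2 / mesh k) ^ k *
      (\<Prod>i<2 * k. 1 / sqrt (\<bar>second_difference k f (real j / real (Suc m) * mesh k) i\<bar> + \<delta>))) / real (Suc m)))"
    (is "?L \<le> liminf (\<lambda>m. ennreal (?A m))")
proof -
  define n where "n = 4 * k + 1"
  have n: "n > 0" by (simp add: n_def)
  define I where "I = (LBINT t:{0..1}. \<bar>f t\<bar>)"
  define N where "N m = 2 * n * Suc m - 1" for m
  have N: "Suc (N m) = 2 * n * Suc m" for m using n by (simp add: N_def)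
  define R where "R m = (\<Sum>l<2 * n * Suc m. \<bar>f (real l / real (2 * n * Suc m))\<bar>) / real (2 * n * Suc m)" for m
  have I0: "0 \<le> I" unfolding I_def by (auto intro!: integral_nonneg_AE simp: set_lebesgue_integral_def)
  have "strict_mono N" unfolding strict_mono_Suc_iff N_def using n by auto
  have cf: "continuous_on {0..1} (\<lambda>t. \<bar>f t\<bar>)" by (intro continuous_intros f)
  have "R \<longlonglongrightarrow> I"
    using LIMSEQ_subseq_LIMSEQ[OF riemann_sum_tendsto[OF cf] \<open>strict_mono N\<close>]
    unfolding comp_def N I_def R_def .
  then have "(\<lambda>m. (1 / (R m + \<delta>)) ^ k) \<longlonglongrightarrow> (1 / (I + \<delta>)) ^ k"
    using I0 d by (intro tendsto_intros) auto
  then have lim: "(\<lambda>m. ennreal ((1 / (R m + \<delta>)) ^ k)) \<longlonglongrightarrow> ennreal ((1 / (I + \<delta>)) ^ k)"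
    by (intro tendsto_ennrealI)
  have "(1 / (R m + \<delta>)) ^ k \<le> ?A m" for m
  proof -
    define u where "u j = real j / real (Suc m) * mesh k" for j
    define S where "S j = mesh k * (\<Sum>i<n. \<bar>f (node k (u j) i)\<bar>)" for j
    have S0: "0 \<le> S j" for j unfolding S_def using mesh_pos[of k] by (auto intro!: sum_nonneg mult_nonneg_nonneg)
    \<comment> \<open>the point with index \<open>(n + i) (m + 1) + j\<close> of the Riemann sum is the \<open>i\<close>-th node for the \<open>j\<close>-th shift\<close>
    have pt: "real ((n + i) * Suc m + j) / real (2 * n * Suc m) = node k (u j) i" for i j
    proof -
      have "mesh k = 1 / real (2 * n)" by (simp add: mesh_def n_def)
      then have "node k (u j) i = 1 / 2 + real j / (real (Suc m) * real (2 * n)) + real i / real (2 * n)"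
        by (simp add: node_def u_def)
      also have "\<dots> = real ((n + i) * Suc m + j) / real (2 * n * Suc m)"
      proof -
        have "0 < real (n * Suc m)" "real (2 * n * Suc m) = 2 * real (n * Suc m)"
          using n by (simp_all only: of_nat_0_less_iff nat_0_less_mult_iff) simp_all
        then have "1 / 2 = real (n * Suc m) / real (2 * n * Suc m)"
          by (simp only: divide_simps) auto
        moreover have "real (i * Suc m) / real (2 * n * Suc m) = (real i * real (Suc m)) / (real (2 * n) * real (Suc m))"
          by (simp only: of_nat_mult)
        then have "real i / real (2 * n) = real (i * Suc m) / real (2 * n * Suc m)"
          by (simp only: nonzero_mult_divide_mult_cancel_right[of "real (Suc m)"] of_nat_eq_0_iff nat.distinct not_False_eq_True)
        moreover have "real j / (real (Suc m) * real (2 * n)) = real j / real (2 * n * Suc m)"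
          by (simp only: of_nat_mult mult.commute mult.left_commute)
        ultimately have "1 / 2 + real j / (real (Suc m) * real (2 * n)) + real i / real (2 * n)
            = (real (n * Suc m) + real j + real (i * Suc m)) / real (2 * n * Suc m)"
          by (simp only: add_divide_distrib)
        moreover have "real (n * Suc m) + real j + real (i * Suc m) = real ((n + i) * Suc m + j)"
          by (simp add: algebra_simps)
        ultimately show ?thesis by simp
      qed
      finally show ?thesis ..
    qed
    have c0: "0 < real (2 * n * Suc m)" using n by (simp only: of_nat_0_less_iff) simp
    have "(\<Sum>j<Suc m. \<Sum>i<n. \<bar>f (node k (u j) i)\<bar>) = (\<Sum>i<n. \<Sum>j<Suc m. \<bar>f (real ((n + i) * Suc m + j) / real (2 * n * Suc m))\<bar>)"
      unfolding pt by (rule sum.swap)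
    also have "\<dots> = (\<Sum>(i, j)\<in>{..<n} \<times> {..<Suc m}. \<bar>f (real ((n + i) * Suc m + j) / real (2 * n * Suc m))\<bar>)"
      by (simp only: sum.cartesian_product)
    also have "\<dots> = (\<Sum>l\<in>(\<lambda>(i, j). (n + i) * Suc m + j) ` ({..<n} \<times> {..<Suc m}). \<bar>f (real l / real (2 * n * Suc m))\<bar>)"
    proof (subst sum.reindex)
      show "inj_on (\<lambda>(i, j). (n + i) * Suc m + j) ({..<n} \<times> {..<Suc m})"
      proof (rule inj_onI, clarify)
        fix i j i' j' assume j: "j < Suc m" "j' < Suc m" and eq: "(n + i) * Suc m + j = (n + i') * Suc m + j'"
        have "((n + i) * Suc m + j) div Suc m = n + i" "((n + i') * Suc m + j') div Suc m = n + i'"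
          using j by (subst div_mult_self3; simp)+
        then have "n + i = n + i'" using eq by metis
        then have "i = i'" by simp
        with eq show "i = i' \<and> j = j'" by simp
      qed
    qed (auto intro!: sum.cong)
    also have "\<dots> \<le> (\<Sum>l<2 * n * Suc m. \<bar>f (real l / real (2 * n * Suc m))\<bar>)"
    proof (intro sum_mono2)
      show "(\<lambda>(i, j). (n + i) * Suc m + j) ` ({..<n} \<times> {..<Suc m}) \<subseteq> {..<2 * n * Suc m}"
      proof clarify
        fix i j assume "i < n" "j < Suc m"
        then have "(n + i) * Suc m + j < (n + i + 1) * Suc m" by simp
        also have "\<dots> \<le> 2 * n * Suc m" using \<open>i < n\<close> by (intro mult_right_mono) auto
        finally show "(n + i) * Suc m + j < 2 * n * Suc m" .
      qed
    qed auto
    also have "\<dots> = R m * real (2 * n * Suc m)"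
      using nonzero_eq_divide_eq[THEN iffD1, OF _ R_def] c0 by (metis less_irrefl)
    finally have le: "(\<Sum>j<Suc m. \<Sum>i<n. \<bar>f (node k (u j) i)\<bar>) \<le> R m * real (2 * n * Suc m)" .
    have "(\<Sum>j<Suc m. S j) / real (Suc m) = (\<Sum>j<Suc m. \<Sum>i<n. \<bar>f (node k (u j) i)\<bar>) / real (2 * n * Suc m)"
      unfolding S_def sum_distrib_left[symmetric] by (simp add: mesh_def n_def field_simps del: sum.lessThan_Suc)
    also have "\<dots> \<le> R m" using le by (simp only: pos_divide_le_eq[OF c0])
    finally have SR: "(\<Sum>j<Suc m. S j) / real (Suc m) \<le> R m" .
    have avg: "(\<Sum>j<Suc m. S j + \<delta>) / real (Suc m) = (\<Sum>j<Suc m. S j) / real (Suc m) + \<delta>"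
      by (simp add: sum.distrib add_divide_distrib del: sum.lessThan_Suc of_nat_Suc)
    have pos: "0 < (\<Sum>j<Suc m. S j + \<delta>) / real (Suc m)"
      unfolding avg using S0 d by (intro add_nonneg_pos divide_nonneg_pos sum_nonneg) auto
    have "(1 / (R m + \<delta>)) ^ k \<le> (1 / ((\<Sum>j<Suc m. S j + \<delta>) / real (Suc m))) ^ k"
      using SR pos unfolding avg by (intro power_mono divide_left_mono mult_pos_pos) auto
    also have "\<dots> \<le> (\<Sum>j<Suc m. (1 / (S j + \<delta>)) ^ k) / real (Suc m)"
      using S0 d by (intro average_inverse_power_le) (auto simp: add_nonneg_pos)
    also have "\<dots> \<le> (\<Sum>j<Suc m. (2 / mesh k) ^ k * (\<Prod>i<2 * k. 1 / sqrt (\<bar>second_difference k f (u j) i\<bar> + \<delta>))) / real (Suc m)"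
    proof (intro divide_right_mono sum_mono one_over_power_le_prod S0 d mesh_pos)
      show "mesh k \<le> 2" using mesh_pos[of k] by simp
      fix i j assume i: "i < 2 * k"
      let ?g = "\<lambda>i. \<bar>f (node k (u j) i)\<bar>"
      have "\<bar>second_difference k f (u j) i\<bar> \<le> 2 * (?g (2 * i) + ?g (2 * i + 1) + ?g (2 * i + 2))"
      proof -
        have "\<bar>(a - b) - (b - c)\<bar> \<le> 2 * (\<bar>c\<bar> + \<bar>b\<bar> + \<bar>a\<bar>)" for a b c :: real
          by (auto simp: abs_if)
        then show ?thesis unfolding second_difference_def .
      qed
      also have "?g (2 * i) + ?g (2 * i + 1) + ?g (2 * i + 2) = (\<Sum>l\<in>{2 * i, 2 * i + 1, 2 * i + 2}. ?g l)"
        by simp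
      also have "\<dots> \<le> (\<Sum>l<n. ?g l)" using i by (intro sum_mono2) (auto simp: n_def)
      finally have "\<bar>second_difference k f (u j) i\<bar> \<le> 2 * (\<Sum>l<n. ?g l)" by simp
      then have "mesh k / 2 * \<bar>second_difference k f (u j) i\<bar> \<le> mesh k / 2 * (2 * (\<Sum>l<n. ?g l))"
        using mesh_pos[of k] by (intro mult_left_mono) auto
      then show "mesh k / 2 * \<bar>second_difference k f (u j) i\<bar> \<le> S j" by (simp add: S_def)
    qed auto
    finally show ?thesis unfolding u_def .
  qed
  then have "liminf (\<lambda>m. ennreal ((1 / (R m + \<delta>)) ^ k)) \<le> liminf (\<lambda>m. ennreal (?A m))"
    by (intro Liminf_mono always_eventually allI ennreal_leI)
  moreover have "liminf (\<lambda>m. ennreal ((1 / (R m + \<delta>)) ^ k)) = ?L"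
    using lim unfolding I_def[symmetric] by (intro lim_imp_Liminf) auto
  ultimately show ?thesis by simp
qed

definition negative_moment_const :: "nat \<Rightarrow> real" where
  "negative_moment_const k = (2 / mesh k) ^ k * (1 + 6 / sqrt (2 * mesh k)) ^ (2 * k)"

text \<open>The grid event depends on the increments before time \<open>1/2\<close>, and the \<open>i\<close>-th second difference on its own two
increments between consecutive nodes, so the expectation of the product factorises.\<close>

lemma second_difference_product_moment:
  assumes B: "brownian_motion M B" and u: "0 \<le> u" "u \<le> mesh k" and d: "0 < \<delta>" "\<delta> < 1"
  shows "(\<integral>\<^sup>+w. indicator (grid_event M B (1/2) q \<epsilon>) w *
      ennreal (\<Prod>i<2 * k. 1 / sqrt (\<bar>second_difference k (\<lambda>t. B t w) u i\<bar> + \<delta>)) \<partial>M)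
    \<le> emeasure M (grid_event M B (1/2) q \<epsilon>) * ennreal ((1 + 6 / sqrt (2 * mesh k)) ^ (2 * k))"
proof -
  interpret prob_space M using brownian_motionD(1)[OF B] .
  \<comment> \<open>grid points up to time \<open>1/2\<close>, then the nodes; increment number \<open>q\<close> leads from the last grid point to the first node\<close>
  define \<tau> where "\<tau> i = (if i \<le> q then 1/2 * (real i / real q) else node k u (i - Suc q))" for i
  define D where "D i w = B (\<tau> (Suc i)) w - B (\<tau> i) w" for i w
  have D_indep: "indep_vars (\<lambda>_. borel) D {..<Suc q + 4 * k}"
    unfolding D_def
  proof (rule brownian_motionD(6)[OF B])
    show "0 \<le> \<tau> 0" by (simp add: \<tau>_def)
    show "\<tau> (Suc q + 4 * k) \<le> 1" using node_in[OF _ u, of "4 * k"] by (simp add: \<tau>_def)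
    fix i assume i: "i < Suc q + 4 * k"
    consider "Suc i \<le> q" | "i = q" | "i > q" by linarith
    then show "\<tau> i \<le> \<tau> (Suc i)"
    proof cases
      case 1 then show ?thesis by (simp add: \<tau>_def divide_right_mono)
    next
      case 2
      have "1/2 * (real q / real q) \<le> 1/2" by simp
      also have "\<dots> \<le> node k u 0" using node_in[OF _ u, of 0] by simp
      finally show ?thesis using 2 by (simp add: \<tau>_def)
    next
      case 3
      then have "Suc i - Suc q = Suc (i - Suc q)" by simp
      then show ?thesis using 3 mesh_pos[of k] by (simp add: \<tau>_def node_def distrib_right)
    qed
  qed
  have D_node: "D (Suc q + i) w = B (node k u (Suc i)) w - B (node k u i) w" for i w
    by (simp add: D_def \<tau>_def Suc_diff_le)
  have D_normal: "distributed M lborel (D (Suc q + i)) (normal_density 0 (sqrt (mesh k)))" if "i < 4 * k" for i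
  proof -
    have "distributed M lborel (\<lambda>w. B (node k u (Suc i)) w - B (node k u i) w)
        (normal_density 0 (sqrt (node k u (Suc i) - node k u i)))"
      using that node_in[OF _ u, of i] node_in[OF _ u, of "Suc i"] mesh_pos[of k]
      by (intro brownian_motionD(5)[OF B]) (auto simp: node_def)
    moreover have "D (Suc q + i) = (\<lambda>w. B (node k u (Suc i)) w - B (node k u i) w)"
      using D_node by (intro ext)
    moreover have "node k u (Suc i) - node k u i = mesh k" by (simp add: node_def distrib_right)
    ultimately show ?thesis by simp
  qed
  define Z where "Z i w = D (Suc q + (2 * i + 1)) w - D (Suc q + 2 * i) w" for i w
  have Z_eq: "second_difference k (\<lambda>t. B t w) u i = Z i w" for i w
    unfolding second_difference_def Z_def D_node by simp
  have Z_normal: "distributed M lborel (Z i) (normal_density 0 (sqrt (2 * mesh k)))" if "i < 2 * k" for i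
  proof -
    have "indep_var borel (D (Suc q + (2 * i + 1))) borel (D (Suc q + 2 * i))"
      using that by (intro indep_var_of_indep_vars[OF D_indep]) auto
    from diff_indep_normal[OF this _ _ D_normal D_normal] that mesh_pos[of k]
    have "distributed M lborel (\<lambda>w. D (Suc q + (2 * i + 1)) w - D (Suc q + 2 * i) w)
        (normal_density (0 - 0) (sqrt ((sqrt (mesh k))\<^sup>2 + (sqrt (mesh k))\<^sup>2)))" by auto
    moreover have "(sqrt (mesh k))\<^sup>2 + (sqrt (mesh k))\<^sup>2 = 2 * mesh k" using mesh_pos[of k] by simp
    ultimately show ?thesis by (simp add: Z_def[abs_def])
  qed
  define K where "K j = (case j of 0 \<Rightarrow> {..<q} | Suc i \<Rightarrow> {Suc q + 2 * i, Suc q + (2 * i + 1)})" for j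
  define F where "F j x = (case j of
      0 \<Rightarrow> (if \<forall>i\<in>{..q}. - \<epsilon> \<le> (\<Sum>l<i. x l) then 1 else (0::ennreal))
    | Suc i \<Rightarrow> ennreal (1 / sqrt (\<bar>x (Suc q + (2 * i + 1)) - x (Suc q + 2 * i)\<bar> + \<delta>)))"
    for j and x :: "nat \<Rightarrow> real"
  have F0: "F 0 (restrict (\<lambda>i. D i w) (K 0)) = indicator (grid_event M B (1/2) q \<epsilon>) w" if "w \<in> space M" for w
    using grid_event_barrier_indicator[OF B that, of q \<tau> "1/2" \<epsilon>] by (simp add: F_def K_def D_def \<tau>_def)
  have FS: "F (Suc i) (restrict (\<lambda>i. D i w) (K (Suc i))) = ennreal (1 / sqrt (\<bar>Z i w\<bar> + \<delta>))" for i w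
    by (simp add: F_def K_def Z_def)
  have split: "(\<Prod>j<Suc n. g j) = g 0 * (\<Prod>i<n. g (Suc i))" for g :: "nat \<Rightarrow> ennreal" and n
    by (rule prod.lessThan_Suc_shift)
  have "(\<integral>\<^sup>+w. indicator (grid_event M B (1/2) q \<epsilon>) w *
      ennreal (\<Prod>i<2 * k. 1 / sqrt (\<bar>second_difference k (\<lambda>t. B t w) u i\<bar> + \<delta>)) \<partial>M)
     = (\<integral>\<^sup>+w. (\<Prod>j<Suc (2 * k). F j (restrict (\<lambda>i. D i w) (K j))) \<partial>M)"
    unfolding split FS Z_eq using d
    by (intro nn_integral_cong) (simp add: F0 prod_ennreal)
  also have "\<dots> = (\<Prod>j<Suc (2 * k). \<integral>\<^sup>+w. F j (restrict (\<lambda>i. D i w) (K j)) \<partial>M)"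
  proof (rule indep_blocks_nn_integral[OF D_indep])
    show "disjoint_family_on K {..<Suc (2 * k)}"
      by (auto simp: disjoint_family_on_def K_def split: nat.splits)
    show "K j \<subseteq> {..<Suc q + 4 * k}" if "j \<in> {..<Suc (2 * k)}" for j
      using that by (auto simp: K_def split: nat.splits)
    show "F j \<in> borel_measurable (borel_power (K j))" if "j \<in> {..<Suc (2 * k)}" for j
    proof (cases j)
      case 0
      have "F 0 = (\<lambda>x. if \<forall>i\<in>{..q}. - \<epsilon> \<le> (\<Sum>l<i. x l) then 1 else 0)"
        by (auto simp: F_def fun_eq_iff)
      then show ?thesis using 0 barrier_indicator_measurable[of q \<epsilon>] by (simp only: K_def nat.case)
    next
      case (Suc i)
      have [measurable]: "(\<lambda>x. x (Suc q + 2 * i)) \<in> borel_measurable (borel_power (K j))"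
        "(\<lambda>x. x (Suc q + (2 * i + 1))) \<in> borel_measurable (borel_power (K j))"
        by (intro measurable_component_singleton; simp add: K_def Suc)+
      have "(\<lambda>x. ennreal (1 / sqrt (\<bar>x (Suc q + (2 * i + 1)) - x (Suc q + 2 * i)\<bar> + \<delta>))) \<in> borel_measurable (borel_power (K j))"
        by measurable
      then show ?thesis by (simp add: F_def[abs_def] Suc)
    qed
  qed simp
  also have "\<dots> = emeasure M (grid_event M B (1/2) q \<epsilon>) * (\<Prod>i<2 * k. \<integral>\<^sup>+w. ennreal (1 / sqrt (\<bar>Z i w\<bar> + \<delta>)) \<partial>M)"
    unfolding split FS
    using nn_integral_cong[of M, OF F0] grid_event_measurable[OF B, of "1/2" q \<epsilon>] by simp
  also have "\<dots> \<le> emeasure M (grid_event M B (1/2) q \<epsilon>) * (\<Prod>i<2 * k. ennreal (1 + 6 / sqrt (2 * mesh k)))"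
    using mesh_pos[of k] d by (intro mult_left_mono prod_mono_ennreal normal_inverse_sqrt_moment Z_normal) auto
  also have "(\<Prod>i<2 * k. ennreal (1 + 6 / sqrt (2 * mesh k))) = ennreal ((1 + 6 / sqrt (2 * mesh k)) ^ (2 * k))"
    using mesh_pos[of k] by (subst prod_constant, subst ennreal_power) auto
  finally show ?thesis .
qed

lemma negative_moment_bound:
  assumes B: "brownian_motion M B" and d: "0 < \<delta>" "\<delta> < 1"
  shows "(\<integral>\<^sup>+w. indicator (grid_event M B (1/2) q \<epsilon>) w *
       ennreal ((1 / ((LBINT t:{0..1}. \<bar>B t w - \<alpha> w - \<beta> w * t\<bar>) + \<delta>)) ^ k) \<partial>M)
     \<le> emeasure M (grid_event M B (1/2) q \<epsilon>) * ennreal (negative_moment_const k)"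
proof -
  interpret prob_space M using brownian_motionD(1)[OF B] .
  let ?G = "grid_event M B (1/2) q \<epsilon>"
  define u where "u m j = real j / real (Suc m) * mesh k" for m j
  have u: "0 \<le> u m j" "u m j \<le> mesh k" if "j < Suc m" for m j
  proof -
    show "0 \<le> u m j" using mesh_pos[of k] by (simp add: u_def)
    have "u m j \<le> 1 * mesh k"
      unfolding u_def using that mesh_pos[of k] by (intro mult_right_mono) (auto simp: divide_le_eq)
    then show "u m j \<le> mesh k" by simp
  qed
  define P where "P m j w = (\<Prod>i<2 * k. 1 / sqrt (\<bar>second_difference k (\<lambda>t. B t w) (u m j) i\<bar> + \<delta>))" for m j w
  have [measurable]: "?G \<in> sets M" using grid_event_measurable[OF B] by simp
  have P_meas[measurable]: "P m j \<in> borel_measurable M" if "j < Suc m" for m j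
  proof -
    have [measurable]: "B (node k (u m j) i) \<in> borel_measurable M" if "i \<le> 4 * k" for i
      using node_in[OF that u[OF \<open>j < Suc m\<close>]] by (intro brownian_motionD(2)[OF B]) auto
    show ?thesis unfolding P_def second_difference_def
      by (intro borel_measurable_prod) auto
  qed
  have P0: "0 \<le> P m j w" for m j w unfolding P_def using d by (intro prod_nonneg) auto
  define c where "c = (2 / mesh k) ^ k"
  have c0: "0 \<le> c" using mesh_pos[of k] by (simp add: c_def)
  have "(\<integral>\<^sup>+w. indicator ?G w * ennreal ((1 / ((LBINT t:{0..1}. \<bar>B t w - \<alpha> w - \<beta> w * t\<bar>) + \<delta>)) ^ k) \<partial>M)
     \<le> (\<integral>\<^sup>+w. liminf (\<lambda>m. indicator ?G w * ennreal ((\<Sum>j<Suc m. c * P m j w) / real (Suc m))) \<partial>M)"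
  proof (rule nn_integral_mono)
    fix w assume w: "w \<in> space M"
    have "second_difference k (\<lambda>t. B t w - \<alpha> w - \<beta> w * t) v i = second_difference k (\<lambda>t. B t w) v i" for v i
      by (simp add: second_difference_def node_def algebra_simps)
    moreover have "continuous_on {0..1} (\<lambda>t. B t w - \<alpha> w - \<beta> w * t)"
      using brownian_motionD(3)[OF B w] by (intro continuous_intros)
    ultimately have "ennreal ((1 / ((LBINT t:{0..1}. \<bar>B t w - \<alpha> w - \<beta> w * t\<bar>) + \<delta>)) ^ k)
        \<le> liminf (\<lambda>m. ennreal ((\<Sum>j<Suc m. c * P m j w) / real (Suc m)))"
      using inverse_power_integral_le_liminf[of "\<lambda>t. B t w - \<alpha> w - \<beta> w * t" \<delta> k] d
      unfolding P_def c_def u_def by simp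
    then show "indicator ?G w * ennreal ((1 / ((LBINT t:{0..1}. \<bar>B t w - \<alpha> w - \<beta> w * t\<bar>) + \<delta>)) ^ k)
        \<le> liminf (\<lambda>m. indicator ?G w * ennreal ((\<Sum>j<Suc m. c * P m j w) / real (Suc m)))"
      by (cases "w \<in> ?G") simp_all
  qed
  also have "\<dots> \<le> liminf (\<lambda>m. \<integral>\<^sup>+w. indicator ?G w * ennreal ((\<Sum>j<Suc m. c * P m j w) / real (Suc m)) \<partial>M)"
    by (intro nn_integral_liminf) (auto intro!: borel_measurable_times_ennreal measurable_compose[OF _ measurable_ennreal] borel_measurable_divide borel_measurable_sum simp del: sum.lessThan_Suc)
  also have "\<dots> \<le> liminf (\<lambda>m. emeasure M ?G * ennreal (negative_moment_const k))"
  proof (intro Liminf_mono always_eventually allI)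
    fix m
    show "(\<integral>\<^sup>+w. indicator ?G w * ennreal ((\<Sum>j<Suc m. c * P m j w) / real (Suc m)) \<partial>M)
        \<le> emeasure M ?G * ennreal (negative_moment_const k)"
    proof (rule nn_integral_average_le)
      fix j assume j: "j < Suc m"
      then show "(\<lambda>w. c * P m j w) \<in> borel_measurable M" by measurable
      have "(\<integral>\<^sup>+w. indicator ?G w * ennreal (c * P m j w) \<partial>M)
          = ennreal c * (\<integral>\<^sup>+w. indicator ?G w * ennreal (P m j w) \<partial>M)"
        using P_meas[OF j] c0 P0 by (subst nn_integral_cmult[symmetric]) (auto simp: ennreal_mult mult_ac)
      also have "\<dots> \<le> ennreal c * (emeasure M ?G * ennreal ((1 + 6 / sqrt (2 * mesh k)) ^ (2 * k)))"
        unfolding P_def using u[OF j] d by (intro mult_left_mono second_difference_product_moment[OF B]) auto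
      also have "\<dots> = emeasure M ?G * (ennreal c * ennreal ((1 + 6 / sqrt (2 * mesh k)) ^ (2 * k)))"
        by (simp only: mult.left_commute)
      also have "ennreal c * ennreal ((1 + 6 / sqrt (2 * mesh k)) ^ (2 * k)) = ennreal (negative_moment_const k)"
        using c0 by (simp add: negative_moment_const_def c_def ennreal_mult')
      finally show "(\<integral>\<^sup>+w. indicator ?G w * ennreal (c * P m j w) \<partial>M) \<le> emeasure M ?G * ennreal (negative_moment_const k)" .
    qed (use c0 P0 in auto)
  qed
  also have "\<dots> = emeasure M ?G * ennreal (negative_moment_const k)" by (intro lim_imp_Liminf) auto
  finally show ?thesis .
qed

section \<open>Persistence above a barrier\<close>

context prob_space begin

lemma indep_blocks_prob:
  assumes X: "indep_vars (\<lambda>_. borel :: real measure) X I" and A: "A \<inter> C = {}" "A \<subseteq> I" "C \<subseteq> I"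
    and P: "{x \<in> space (borel_power A). P x} \<in> sets (borel_power A)" "\<And>x. P (restrict x A) \<longleftrightarrow> P x"
    and Q: "{x \<in> space (borel_power C). Q x} \<in> sets (borel_power C)" "\<And>x. Q (restrict x C) \<longleftrightarrow> Q x"
  shows "prob {w\<in>space M. P (\<lambda>i. X i w) \<and> Q (\<lambda>i. X i w)}
    = prob {w\<in>space M. P (\<lambda>i. X i w)} * prob {w\<in>space M. Q (\<lambda>i. X i w)}"
proof -
  have "prob ((\<lambda>w. (restrict (\<lambda>i. X i w) A, restrict (\<lambda>i. X i w) C)) -`
      ({x \<in> space (borel_power A). P x} \<times> {x \<in> space (borel_power C). Q x}) \<inter> space M)
    = prob ((\<lambda>w. restrict (\<lambda>i. X i w) A) -` {x \<in> space (borel_power A). P x} \<inter> space M)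
    * prob ((\<lambda>w. restrict (\<lambda>i. X i w) C) -` {x \<in> space (borel_power C). Q x} \<inter> space M)"
    using A by (intro indep_varD[OF indep_var_restrict[OF X]] P Q)
  moreover have "(\<lambda>w. (restrict (\<lambda>i. X i w) A, restrict (\<lambda>i. X i w) C)) -`
      ({x \<in> space (borel_power A). P x} \<times> {x \<in> space (borel_power C). Q x}) \<inter> space M
     = {w\<in>space M. P (\<lambda>i. X i w) \<and> Q (\<lambda>i. X i w)}"
    using P(2) Q(2) by (auto simp: space_PiM)
  moreover have "(\<lambda>w. restrict (\<lambda>i. X i w) A) -` {x \<in> space (borel_power A). P x} \<inter> space M = {w\<in>space M. P (\<lambda>i. X i w)}"
    "(\<lambda>w. restrict (\<lambda>i. X i w) C) -` {x \<in> space (borel_power C). Q x} \<inter> space M = {w\<in>space M. Q (\<lambda>i. X i w)}"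
    using P(2) Q(2) by (auto simp: space_PiM)
  ultimately show ?thesis by simp
qed

lemma iid_prob_cong:
  fixes n :: nat
  assumes X: "indep_vars (\<lambda>_. borel :: real measure) X {..<n}" "\<And>i. i < n \<Longrightarrow> distr M borel (X i) = D"
    and Y: "indep_vars (\<lambda>_. borel :: real measure) Y {..<n}" "\<And>i. i < n \<Longrightarrow> distr M borel (Y i) = D"
    and P: "{x \<in> space (borel_power {..<n}). P x} \<in> sets (borel_power {..<n})" "\<And>x. P (restrict x {..<n}) \<longleftrightarrow> P x"
  shows "prob {w\<in>space M. P (\<lambda>i. X i w)} = prob {w\<in>space M. P (\<lambda>i. Y i w)}"
proof -
  let ?S = "borel_power {..<n}"
  have *: "prob {w\<in>space M. P (\<lambda>i. Z i w)} = measure (PiM {..<n} (\<lambda>_. D)) {x \<in> space ?S. P x}"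
    if Z: "indep_vars (\<lambda>_. borel :: real measure) Z {..<n}" "\<And>i. i < n \<Longrightarrow> distr M borel (Z i) = D" and n: "n \<noteq> 0" for Z
  proof -
    have rv: "i < n \<Longrightarrow> Z i \<in> borel_measurable M" for i using Z(1) by (auto simp: indep_vars_def)
    have "distr M ?S (\<lambda>w. restrict (\<lambda>i. Z i w) {..<n}) = PiM {..<n} (\<lambda>i. distr M borel (Z i))"
      using Z(1) rv n by (subst (asm) indep_vars_iff_distr_eq_PiM') (auto simp: lessThan_empty_iff)
    also have "\<dots> = PiM {..<n} (\<lambda>_. D)" using Z(2) by (intro PiM_cong) auto
    finally have "measure (PiM {..<n} (\<lambda>_. D)) {x \<in> space ?S. P x}
        = measure (distr M ?S (\<lambda>w. restrict (\<lambda>i. Z i w) {..<n})) {x \<in> space ?S. P x}" by simp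
    also have "\<dots> = prob ((\<lambda>w. restrict (\<lambda>i. Z i w) {..<n}) -` {x \<in> space ?S. P x} \<inter> space M)"
      using P(1) rv by (intro measure_distr measurable_restrict) auto
    also have "(\<lambda>w. restrict (\<lambda>i. Z i w) {..<n}) -` {x \<in> space ?S. P x} \<inter> space M = {w\<in>space M. P (\<lambda>i. Z i w)}"
      using P(2) by (auto simp: space_PiM)
    finally show ?thesis ..
  qed
  show ?thesis
  proof (cases "n = 0")
    case True
    have "P x \<longleftrightarrow> P y" for x y
      using P(2)[of x] P(2)[of y] True by (simp add: restrict_def)
    then have "P (\<lambda>i. X i w) \<longleftrightarrow> P (\<lambda>i. Y i w)" for w .
    then show ?thesis by simp
  next
    case False
    then show ?thesis using *[OF X] *[OF Y] by simp
  qed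
qed

lemma distributed_borel_measurable: "distributed M lborel Z f \<Longrightarrow> Z \<in> borel_measurable M"
  using distributed_measurable[of M lborel Z f] by simp

lemma distr_eq_density:
  "distributed M lborel Z f \<Longrightarrow> distr M borel Z = density lborel f"
  by (simp add: distributed_def cong: distr_cong)

text \<open>Let \<open>p n\<close> be the probability that the first \<open>n\<close> partial sums are positive. The events \<open>E k\<close> that the walk
has its strict minimum at time \<open>k\<close> are disjoint. Seen from time \<open>k\<close>, both the future and the reversed past,
with its sign changed, are walks with the same law, so \<open>E k\<close> has probability \<open>p k * p (m - k) \<ge> (p m)^2\<close>.
Hence \<open>(m + 1) * (p m)^2 \<le> 1\<close>.\<close>

lemma positive_walk_prob_le:
  assumes X: "indep_vars (\<lambda>_. borel) X {..<m}"
    and XD: "\<And>i. i < m \<Longrightarrow> distributed M lborel (X i) (normal_density 0 \<sigma>)" and s: "0 < \<sigma>"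
  shows "prob {w\<in>space M. \<forall>i\<in>{1..m}. 0 < (\<Sum>l<i. X l w)} \<le> 1 / sqrt (real m + 1)"
proof -
  define p where "p n = prob {w\<in>space M. \<forall>i\<in>{1..n}. 0 < (\<Sum>l<i. X l w)}" for n
  have Xm: "i < m \<Longrightarrow> X i \<in> borel_measurable M" for i using XD by (auto intro: distributed_borel_measurable)
  have walk: "prob {w\<in>space M. \<forall>i\<in>{1..n}. 0 < c * (\<Sum>l<i. X (r l) w)} = p n"
    if r: "inj_on r {..<n}" "r ` {..<n} \<subseteq> {..<m}" and n: "n \<le> m" and c: "c = 1 \<or> c = - 1" for r n c
  proof -
    have "prob {w\<in>space M. \<forall>i\<in>{1..n}. 0 < 1 * (\<Sum>l<i. c * X (r l) w)} = prob {w\<in>space M. \<forall>i\<in>{1..n}. 0 < 1 * (\<Sum>l<i. X l w)}"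
    proof (rule iid_prob_cong[where P = "\<lambda>x. \<forall>i\<in>{1..n}. 0 < 1 * (\<Sum>l<i. x l)" and D = "density lborel (normal_density 0 \<sigma>)"])
      show "indep_vars (\<lambda>_. borel) (\<lambda>l w. c * X (r l) w) {..<n}"
        by (rule indep_vars_compose2[OF indep_vars_reindex_inj[OF X r]]) auto
      show "indep_vars (\<lambda>_. borel) X {..<n}"
        using n by (intro indep_vars_subset[OF X]) auto
      show "distr M borel (X i) = density lborel (normal_density 0 \<sigma>)" if "i < n" for i
        using that n by (intro distr_eq_density XD) auto
      show "distr M borel (\<lambda>w. c * X (r i) w) = density lborel (normal_density 0 \<sigma>)" if "i < n" for i
      proof -
        have "r i < m" using r that by auto
        then have "distributed M lborel (\<lambda>w. c * X (r i) w) (normal_density 0 \<sigma>)"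
          using c XD[of "r i"] normal_uminus[OF XD[of "r i"] s] by auto
        then show ?thesis by (rule distr_eq_density)
      qed
      show "{x \<in> space (borel_power {..<n}). \<forall>i\<in>{1..n}. 0 < 1 * (\<Sum>l<i. x l)} \<in> sets (borel_power {..<n})"
        by (rule positive_walk_sets[where r = "\<lambda>l. l"]) auto
      have "(\<Sum>l<i. restrict x {..<n} l) = (\<Sum>l<i. x l)" if "i \<in> {1..n}" for i and x :: "nat \<Rightarrow> real"
        using that by (intro sum.cong) auto
      then show "(\<forall>i\<in>{1..n}. 0 < 1 * (\<Sum>l<i. restrict x {..<n} l)) \<longleftrightarrow> (\<forall>i\<in>{1..n}. 0 < 1 * (\<Sum>l<i. x l))" for x :: "nat \<Rightarrow> real"
        by simp
    qed
    then show ?thesis by (simp add: p_def sum_distrib_left)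
  qed
  define Q1 where "Q1 k x \<longleftrightarrow> (\<forall>i\<in>{1..k}. 0 < - 1 * (\<Sum>l<i. x (k - 1 - l)))" for k and x :: "nat \<Rightarrow> real"
  define Q2 where "Q2 k x \<longleftrightarrow> (\<forall>i\<in>{1..m - k}. 0 < 1 * (\<Sum>l<i. x (k + l)))" for k and x :: "nat \<Rightarrow> real"
  define E where "E k = {w\<in>space M. Q1 k (\<lambda>i. X i w) \<and> Q2 k (\<lambda>i. X i w)}" for k
  have sX: "(\<lambda>w. \<Sum>l<i. X (r l) w) \<in> borel_measurable M" if "\<And>l. l < i \<Longrightarrow> r l < m" for r :: "nat \<Rightarrow> nat" and i
    using that Xm by (intro borel_measurable_sum) auto
  have E_sets: "E k \<in> sets M" if "k \<le> m" for k
  proof -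
    have "{w\<in>space M. Q1 k (\<lambda>i. X i w)} \<in> sets M" unfolding Q1_def
    proof (rule sets.sets_Collect_finite_All)
      fix i assume "i \<in> {1..k}"
      then have [measurable]: "(\<lambda>w. \<Sum>l<i. X (k - 1 - l) w) \<in> borel_measurable M"
        using that by (intro sX) auto
      show "{w\<in>space M. 0 < - 1 * (\<Sum>l<i. X (k - 1 - l) w)} \<in> sets M" by measurable
    qed simp
    moreover have "{w\<in>space M. Q2 k (\<lambda>i. X i w)} \<in> sets M" unfolding Q2_def
    proof (rule sets.sets_Collect_finite_All)
      fix i assume "i \<in> {1..m - k}"
      then have [measurable]: "(\<lambda>w. \<Sum>l<i. X (k + l) w) \<in> borel_measurable M"
        using that by (intro sX) auto
      show "{w\<in>space M. 0 < 1 * (\<Sum>l<i. X (k + l) w)} \<in> sets M" by measurable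
    qed simp
    moreover have "E k = {w\<in>space M. Q1 k (\<lambda>i. X i w)} \<inter> {w\<in>space M. Q2 k (\<lambda>i. X i w)}"
      by (auto simp: E_def)
    ultimately show ?thesis by simp
  qed
  have PE: "prob (E k) = p k * p (m - k)" if k: "k \<le> m" for k
  proof -
    have "prob (E k) = prob {w\<in>space M. Q1 k (\<lambda>i. X i w)} * prob {w\<in>space M. Q2 k (\<lambda>i. X i w)}"
      unfolding E_def
    proof (rule indep_blocks_prob[OF X, of "{..<k}" "{k..<m}"])
      show "{x \<in> space (borel_power {..<k}). Q1 k x} \<in> sets (borel_power {..<k})"
        unfolding Q1_def by (rule positive_walk_sets) auto
      show "{x \<in> space (borel_power {k..<m}). Q2 k x} \<in> sets (borel_power {k..<m})"
        unfolding Q2_def by (rule positive_walk_sets) auto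
      have "(\<Sum>l<i. restrict x {..<k} (k - 1 - l)) = (\<Sum>l<i. x (k - 1 - l))" if "i \<in> {1..k}" for i and x :: "nat \<Rightarrow> real"
        using that by (intro sum.cong) auto
      then show "Q1 k (restrict x {..<k}) = Q1 k x" for x unfolding Q1_def by simp
      have "(\<Sum>l<i. restrict x {k..<m} (k + l)) = (\<Sum>l<i. x (k + l))" if "i \<in> {1..m - k}" for i and x :: "nat \<Rightarrow> real"
        using that by (intro sum.cong) auto
      then show "Q2 k (restrict x {k..<m}) = Q2 k x" for x unfolding Q2_def by simp
    qed (use k in auto)
    also have "prob {w\<in>space M. Q1 k (\<lambda>i. X i w)} = p k"
      unfolding Q1_def using k by (intro walk) (auto simp: inj_on_def)
    also have "prob {w\<in>space M. Q2 k (\<lambda>i. X i w)} = p (m - k)"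
      unfolding Q2_def using k by (intro walk) (auto simp: inj_on_def)
    finally show ?thesis .
  qed
  have disj: "w \<notin> E k'" if "k < k'" "k' \<le> m" "w \<in> E k" for w k k'
  proof
    assume "w \<in> E k'"
    then have "Q1 k' (\<lambda>i. X i w)" by (simp add: E_def)
    then have neg: "0 < - 1 * (\<Sum>l<k' - k. X (k' - 1 - l) w)" using that(1) unfolding Q1_def by auto
    have "(\<Sum>l<k' - k. X (k' - 1 - l) w) = (\<Sum>l<k' - k. X (k + (k' - k - Suc l)) w)"
      using that(1) by (intro sum.cong refl arg_cong[where f = "\<lambda>i. X i w"]) auto
    also have "\<dots> = (\<Sum>l<k' - k. X (k + l) w)"
      by (rule sum.nat_diff_reindex)
    finally have eq: "(\<Sum>l<k' - k. X (k' - 1 - l) w) = (\<Sum>l<k' - k. X (k + l) w)" .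
    have "Q2 k (\<lambda>i. X i w)" using that by (simp add: E_def)
    moreover have "k' - k \<in> {1..m - k}" using that(1,2) by auto
    ultimately have "0 < 1 * (\<Sum>l<k' - k. X (k + l) w)" unfolding Q2_def by blast
    then show False using neg eq by simp
  qed
  have p_mono: "p m \<le> p k" if "k \<le> m" for k
    unfolding p_def
  proof (rule finite_measure_mono)
    show "{w\<in>space M. \<forall>i\<in>{1..k}. 0 < (\<Sum>l<i. X l w)} \<in> sets M"
    proof (rule sets.sets_Collect_finite_All)
      fix i assume "i \<in> {1..k}"
      then have [measurable]: "(\<lambda>w. \<Sum>l<i. X l w) \<in> borel_measurable M"
        using that by (intro sX) auto
      show "{w\<in>space M. 0 < (\<Sum>l<i. X l w)} \<in> sets M" by measurable
    qed simp
  qed (use that in auto)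
  have p0: "0 \<le> p n" for n by (simp add: p_def)
  have "(real m + 1) * (p m)\<^sup>2 = (\<Sum>k\<le>m. p m * p m)" by (simp add: power2_eq_square)
  also have "\<dots> \<le> (\<Sum>k\<le>m. prob (E k))"
    using p_mono p0 by (intro sum_mono) (auto simp: PE intro!: mult_mono)
  also have "\<dots> = prob (\<Union>k\<in>{..m}. E k)"
  proof (rule finite_measure_finite_Union[symmetric])
    show "disjoint_family_on E {..m}"
      unfolding disjoint_family_on_def using disj by (metis (no_types, lifting) atMost_iff disjoint_iff nat_neq_iff)
  qed (use E_sets in auto)
  also have "\<dots> \<le> 1" by (rule prob_le_1)
  finally have "(p m)\<^sup>2 \<le> 1 / (real m + 1)" by (simp add: field_simps)
  then have "p m \<le> sqrt (1 / (real m + 1))" by (rule real_le_rsqrt)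
  then show ?thesis by (simp add: p_def real_sqrt_divide)
qed

end

lemma brownian_grid_increments:
  assumes B: "brownian_motion M B" and T: "0 < T" "T \<le> 1" and q: "0 < q"
    and X_def: "X = (\<lambda>i w. B (T * (real (Suc i) / real q)) w - B (T * (real i / real q)) w)"
  shows "prob_space.indep_vars M (\<lambda>_. borel) X {..<q}"
    and "\<And>i. i < q \<Longrightarrow> distributed M lborel (X i) (normal_density 0 (sqrt (T / real q)))"
    and "\<And>i w. w \<in> space M \<Longrightarrow> (\<Sum>l<i. X l w) = B (T * (real i / real q)) w"
proof -
  show "prob_space.indep_vars M (\<lambda>_. borel) X {..<q}"
    unfolding X_def using T q
    by (intro brownian_motionD(6)[OF B, where \<tau> = "\<lambda>i. T * (real i / real q)"]; auto intro!: mult_left_mono divide_right_mono)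
  show "distributed M lborel (X i) (normal_density 0 (sqrt (T / real q)))" if "i < q" for i
  proof -
    have "T * (real (Suc i) / real q) - T * (real i / real q) = T / real q"
      using q by (simp add: field_simps)
    moreover have "T * (real (Suc i) / real q) \<le> 1"
      using grid_point_in_unit[of T "Suc i" q] T that by auto
    ultimately show ?thesis
      using brownian_motionD(5)[OF B, of "T * (real i / real q)" "T * (real (Suc i) / real q)"] T q
      unfolding X_def by (simp add: mult_strict_left_mono divide_strict_right_mono)
  qed
  show "(\<Sum>l<i. X l w) = B (T * (real i / real q)) w" if "w \<in> space M" for i w
    using telescope[of "\<lambda>t. B t w" "\<lambda>i. T * (real i / real q)" i] brownian_motionD(4)[OF B that]
    unfolding X_def by simp
qed

text \<open>The grid is chosen with mesh about \<open>\<epsilon>^2\<close>, so that a single step has standard deviation at least \<open>\<epsilon>\<close>. A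
walk that stays above \<open>- \<epsilon>\<close> becomes a positive one when a step larger than \<open>\<epsilon>\<close> is put in front of it, and
such a step has probability bounded below. This gives the order \<open>1 / sqrt q\<close>, that is \<open>\<epsilon> / sqrt T\<close>.\<close>

lemma persistence_prob_le:
  assumes B: "brownian_motion M B" and T: "0 < T" "T \<le> 1" and e: "0 < \<epsilon>"
  shows "\<exists>q. measure M (grid_event M B T q \<epsilon>) \<le> 6 * exp 2 * \<epsilon> / sqrt T"
proof -
  interpret prob_space M using brownian_motionD(1)[OF B] .
  define q where "q = nat \<lfloor>T / \<epsilon>\<^sup>2\<rfloor>"
  show ?thesis
  proof (cases "q = 0")
    case True
    have "T / \<epsilon>\<^sup>2 < 1" using True T e unfolding q_def by (simp add: floor_less_iff)
    then have "T \<le> \<epsilon>\<^sup>2" using e by (simp add: divide_less_eq)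
    then have "sqrt T \<le> \<epsilon>" using e by (intro real_le_lsqrt) auto
    then have "1 \<le> \<epsilon> / sqrt T" using T by simp
    moreover have "1 \<le> 6 * exp (2::real)" using exp_ge_add_one_self[of "2::real"] by simp
    ultimately have "1 * 1 \<le> (6 * exp 2) * (\<epsilon> / sqrt T)" by (intro mult_mono) auto
    then have "prob (grid_event M B T 0 \<epsilon>) \<le> 6 * exp 2 * \<epsilon> / sqrt T"
      by (intro order_trans[OF prob_le_1]) simp
    then show ?thesis by blast
  next
    case False
    then have q: "0 < q" by simp
    define X where "X = (\<lambda>i w. B (T * (real (Suc i) / real q)) w - B (T * (real i / real q)) w)"
    define \<sigma> where "\<sigma> = sqrt (T / real q)"
    note X = brownian_grid_increments[OF B T q X_def, folded \<sigma>_def]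
    have s: "0 < \<sigma>" using T q by (simp add: \<sigma>_def)
    have "real q \<le> T / \<epsilon>\<^sup>2" using T unfolding q_def by simp
    then have "\<epsilon>\<^sup>2 \<le> T / real q" using q e by (simp add: field_simps)
    then have es: "\<epsilon> \<le> \<sigma>" unfolding \<sigma>_def by (rule real_le_rsqrt)
    have Xm[measurable]: "X i \<in> borel_measurable M" if "i < q" for i
      by (rule distributed_borel_measurable[OF X(2)[OF that]])
    define c where "c = exp (-2 :: real) / 6"
    have c: "0 < c" by (simp add: c_def)
    define W where "W x \<longleftrightarrow> (\<forall>i\<in>{..q - 1}. - \<epsilon> \<le> (\<Sum>l<i. x l))" for x :: "nat \<Rightarrow> real"
    define W' where "W' x \<longleftrightarrow> (\<forall>i\<in>{..q - 1}. - \<epsilon> \<le> (\<Sum>l<i. x (Suc l)))" for x :: "nat \<Rightarrow> real"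
    have G: "prob (grid_event M B T q \<epsilon>) \<le> prob {w\<in>space M. W (\<lambda>i. X i w)}"
    proof (rule finite_measure_mono)
      show "grid_event M B T q \<epsilon> \<subseteq> {w\<in>space M. W (\<lambda>i. X i w)}"
        by (auto simp: grid_event_def W_def X(3))
      show "{w\<in>space M. W (\<lambda>i. X i w)} \<in> sets M" unfolding W_def
      proof (rule sets.sets_Collect_finite_All)
        fix i assume "i \<in> {..q - 1}"
        then have [measurable]: "(\<lambda>w. \<Sum>l<i. X l w) \<in> borel_measurable M"
          using q by (intro borel_measurable_sum) auto
        show "{w\<in>space M. - \<epsilon> \<le> (\<Sum>l<i. X l w)} \<in> sets M" by measurable
      qed simp
    qed
    also have "\<dots> = prob {w\<in>space M. W (\<lambda>i. X (Suc i) w)}"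
    proof (rule iid_prob_cong[where D = "density lborel (normal_density 0 \<sigma>)" and n = "q - 1"])
      show "indep_vars (\<lambda>_. borel) X {..<q - 1}" by (intro indep_vars_subset[OF X(1)]) auto
      show "indep_vars (\<lambda>_. borel) (\<lambda>i. X (Suc i)) {..<q - 1}"
        by (intro indep_vars_reindex_inj[OF X(1)]) auto
      show "{x \<in> space (borel_power {..<q - 1}). W x} \<in> sets (borel_power {..<q - 1})"
        unfolding W_def by (rule barrier_walk_sets[where r = "\<lambda>l. l"]) auto
      have "(\<Sum>l<i. restrict x {..<q - 1} l) = (\<Sum>l<i. x l)" if "i \<in> {..q - 1}" for i and x :: "nat \<Rightarrow> real"
        using that by (intro sum.cong) auto
      then show "W (restrict x {..<q - 1}) \<longleftrightarrow> W x" for x unfolding W_def by simp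
    qed (auto intro!: distr_eq_density X(2))
    finally have G': "prob (grid_event M B T q \<epsilon>) \<le> prob {w\<in>space M. W' (\<lambda>i. X i w)}"
      by (simp add: W_def W'_def)
    have "c * prob {w\<in>space M. W' (\<lambda>i. X i w)} \<le> prob {w\<in>space M. \<epsilon> < X 0 w} * prob {w\<in>space M. W' (\<lambda>i. X i w)}"
      unfolding c_def using normal_tail_prob_ge[OF X(2)[OF q] s es] by (intro mult_right_mono) auto
    also have "\<dots> = prob {w\<in>space M. \<epsilon> < X 0 w \<and> W' (\<lambda>i. X i w)}"
    proof (rule indep_blocks_prob[OF X(1), where A = "{0}" and C = "{1..<q}" and P = "\<lambda>x. \<epsilon> < x 0", symmetric])
      show "{x \<in> space (borel_power {0::nat}). \<epsilon> < x 0} \<in> sets (borel_power {0})"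
      proof -
        have [measurable]: "(\<lambda>x. x 0) \<in> borel_measurable (borel_power {0::nat})"
          by (intro measurable_component_singleton) simp
        show ?thesis by measurable
      qed
      show "{x \<in> space (borel_power {1..<q}). W' x} \<in> sets (borel_power {1..<q})"
        unfolding W'_def by (rule barrier_walk_sets) auto
      have "(\<Sum>l<i. restrict x {1..<q} (Suc l)) = (\<Sum>l<i. x (Suc l))" if "i \<in> {..q - 1}" for i and x :: "nat \<Rightarrow> real"
        using that by (intro sum.cong) auto
      then show "W' (restrict x {1..<q}) \<longleftrightarrow> W' x" for x unfolding W'_def by simp
    qed (use q in auto)
    also have "\<dots> \<le> prob {w\<in>space M. \<forall>i\<in>{1..q}. 0 < (\<Sum>l<i. X l w)}"
    proof (rule finite_measure_mono)
      show "{w\<in>space M. \<epsilon> < X 0 w \<and> W' (\<lambda>i. X i w)} \<subseteq> {w\<in>space M. \<forall>i\<in>{1..q}. 0 < (\<Sum>l<i. X l w)}"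
      proof clarify
        fix w i assume x: "\<epsilon> < X 0 w" "W' (\<lambda>i. X i w)" and i: "i \<in> {1..q}"
        obtain i' where i': "i = Suc i'" using i by (cases i) auto
        then have "- \<epsilon> \<le> (\<Sum>l<i'. X (Suc l) w)" using x(2) i unfolding W'_def by auto
        then show "0 < (\<Sum>l<i. X l w)" using x(1) unfolding i' sum.lessThan_Suc_shift by simp
      qed
      show "{w\<in>space M. \<forall>i\<in>{1..q}. 0 < (\<Sum>l<i. X l w)} \<in> sets M"
      proof (rule sets.sets_Collect_finite_All)
        fix i assume "i \<in> {1..q}"
        then have [measurable]: "(\<lambda>w. \<Sum>l<i. X l w) \<in> borel_measurable M"
          by (intro borel_measurable_sum) auto
        show "{w\<in>space M. 0 < (\<Sum>l<i. X l w)} \<in> sets M" by measurable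
      qed simp
    qed
    also have "\<dots> \<le> 1 / sqrt (real q + 1)"
      by (rule positive_walk_prob_le[OF X(1,2) s])
    also have "\<dots> \<le> \<epsilon> / sqrt T"
    proof -
      have "T / \<epsilon>\<^sup>2 \<le> real q + 1" unfolding q_def by linarith
      then have "sqrt (T / \<epsilon>\<^sup>2) \<le> sqrt (real q + 1)" by simp
      then have "sqrt T / \<epsilon> \<le> sqrt (real q + 1)" using e by (simp add: real_sqrt_divide)
      then show ?thesis using T e by (simp add: field_simps)
    qed
    finally have "c * prob (grid_event M B T q \<epsilon>) \<le> \<epsilon> / sqrt T"
      using G' c by (meson mult_left_mono less_imp_le order_trans)
    then have "prob (grid_event M B T q \<epsilon>) \<le> (\<epsilon> / sqrt T) / c" by (simp only: pos_le_divide_eq[OF c] mult.commute)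
    also have "\<dots> = 6 * exp 2 * \<epsilon> / sqrt T" by (simp add: c_def exp_minus field_simps)
    finally show ?thesis by blast
  qed
qed

section \<open>The running minimum\<close>

definition stay_above :: "'a measure \<Rightarrow> (real \<Rightarrow> 'a \<Rightarrow> real) \<Rightarrow> real \<Rightarrow> 'a set" where
  "stay_above M B \<epsilon> = {w\<in>space M. \<forall>t\<in>{0..1}. - \<epsilon> \<le> B t w}"

lemma stay_above_subset_grid_event:
  assumes "0 \<le> T" "T \<le> 1"
  shows "stay_above M B \<epsilon> \<subseteq> grid_event M B T q \<epsilon>"
  unfolding stay_above_def grid_event_def using grid_point_in_unit[OF assms] by blast

text \<open>By continuity of the paths, the dyadic points decide whether the path stays above the level.\<close>

lemma stay_above_eq_Inter:
  assumes B: "brownian_motion M B"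
  shows "stay_above M B \<epsilon> = (\<Inter>n. grid_event M B 1 (2 ^ n) \<epsilon>)"
proof
  show "stay_above M B \<epsilon> \<subseteq> (\<Inter>n. grid_event M B 1 (2 ^ n) \<epsilon>)"
    using stay_above_subset_grid_event[of 1 M B \<epsilon>] by auto
  show "(\<Inter>n. grid_event M B 1 (2 ^ n) \<epsilon>) \<subseteq> stay_above M B \<epsilon>"
  proof
    fix w assume w: "w \<in> (\<Inter>n. grid_event M B 1 (2 ^ n) \<epsilon>)"
    then have sp: "w \<in> space M" by (auto simp: grid_event_def)
    have "- \<epsilon> \<le> B t w" if t: "t \<in> {0..1}" for t
    proof -
      define i where "i n = nat \<lfloor>2 ^ n * t\<rfloor>" for n
      define u where "u n = real (i n) / real (2 ^ n)" for n
      have i: "real (i n) \<le> 2 ^ n * t" "2 ^ n * t - 1 \<le> real (i n)" for n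
        using t unfolding i_def by auto
      have i2: "i n \<le> 2 ^ n" for n
      proof -
        have "2 ^ n * t \<le> 2 ^ n * 1" using t by (intro mult_left_mono) auto
        then have "real (i n) \<le> 2 ^ n" using i(1)[of n] by linarith
        then show ?thesis by simp
      qed
      have u1: "u n \<in> {0..1}" for n
        using grid_point_in_unit[of 1 "i n" "2 ^ n"] i2 by (simp add: u_def)
      have "u \<longlonglongrightarrow> t"
      proof (rule real_tendsto_sandwich[where f = "\<lambda>n. t - 1 / 2 ^ n" and h = "\<lambda>_. t"])
        show "\<forall>\<^sub>F n in sequentially. t - 1 / 2 ^ n \<le> u n"
        proof (intro always_eventually allI)
          fix n
          have "(2 ^ n * t - 1) / 2 ^ n \<le> real (i n) / 2 ^ n"
            by (intro divide_right_mono i(2)) simp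
          moreover have "(2 ^ n * t - 1) / 2 ^ n = t - 1 / 2 ^ n"
            by (simp add: diff_divide_distrib)
          ultimately show "t - 1 / 2 ^ n \<le> u n" by (simp add: u_def)
        qed
        show "\<forall>\<^sub>F n in sequentially. u n \<le> t"
          using i(1) by (auto simp: u_def field_simps intro!: always_eventually)
        show "(\<lambda>n. t - 1 / 2 ^ n) \<longlonglongrightarrow> t" by real_asymp
      qed simp
      then have "(\<lambda>n. B (u n) w) \<longlonglongrightarrow> B t w"
        using u1 t by (intro continuous_on_tendsto_compose[OF brownian_motionD(3)[OF B sp]]) auto
      moreover have "- \<epsilon> \<le> B (u n) w" for n
        using w i2[of n] by (auto simp: grid_event_def u_def)
      ultimately show ?thesis by (intro LIMSEQ_le_const[of "\<lambda>n. B (u n) w"]) auto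
    qed
    then show "w \<in> stay_above M B \<epsilon>" using sp by (simp add: stay_above_def)
  qed
qed

lemma stay_above_measurable:
  assumes B: "brownian_motion M B"
  shows "stay_above M B \<epsilon> \<in> sets M"
  unfolding stay_above_eq_Inter[OF B] using grid_event_measurable[OF B, of 1]
  by (intro sets.countable_INT) auto

lemma brownian_marginal_normal:
  assumes B: "brownian_motion M B" and t: "0 < t" "t \<le> 1"
  shows "distributed M lborel (B t) (normal_density 0 (sqrt t))"
proof -
  have "distributed M lborel (\<lambda>w. B t w - B 0 w) (normal_density 0 (sqrt (t - 0)))"
    using t by (intro brownian_motionD(5)[OF B]) auto
  moreover have "distr M lborel (\<lambda>w. B t w - B 0 w) = distr M lborel (B t)"
    using brownian_motionD(4)[OF B] by (intro distr_cong) auto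
  ultimately show ?thesis
    using brownian_motionD(2)[OF B, of t] t by (auto simp: distributed_def)
qed

text \<open>Decompose according to the first grid time \<open>k\<close> at which the path is below \<open>- x\<close>. The increment from that
time to time \<open>1\<close> is independent of the past and symmetric, hence nonpositive with probability at least
\<open>1/2\<close>, and then \<open>B 1\<close> is below \<open>- x\<close> as well.\<close>

lemma levy_grid_inequality:
  assumes B: "brownian_motion M B" and m: "0 < m"
  shows "measure M (space M - grid_event M B 1 m x) \<le> 2 * measure M {w\<in>space M. B 1 w < - x}"
proof -
  interpret prob_space M using brownian_motionD(1)[OF B] .
  define X where "X = (\<lambda>i w. B (1 * (real (Suc i) / real m)) w - B (1 * (real i / real m)) w)"
  note X = brownian_grid_increments[OF B zero_less_one order_refl m X_def]
  have Bm[measurable]: "B (real k / real m) \<in> borel_measurable M" if "k \<le> m" for k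
    using brownian_motionD(2)[OF B] grid_point_in_unit[OF _ _ that, of 1] by auto
  have B1[measurable]: "B 1 \<in> borel_measurable M" using brownian_motionD(2)[OF B] by simp
  define A where "A k = {w\<in>space M. (\<forall>j\<in>{..<k}. - x \<le> B (real j / real m) w) \<and> B (real k / real m) w < - x}" for k
  define P where "P k y \<longleftrightarrow> (\<forall>j\<in>{..<k}. - x \<le> (\<Sum>l<j. y l)) \<and> (\<Sum>l<k. y l) < - x" for k and y :: "nat \<Rightarrow> real"
  define Q where "Q k y \<longleftrightarrow> (\<Sum>l\<in>{k..<m}. y l) \<le> 0" for k and y :: "nat \<Rightarrow> real"
  have X3: "(\<Sum>l<i. X l w) = B (real i / real m) w" if "w \<in> space M" for i w
    using X(3)[OF that, of i] by simp
  have A_eq: "A k = {w\<in>space M. P k (\<lambda>i. X i w)}" for k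
    unfolding A_def P_def using X3 by auto
  have A_sets[measurable]: "A k \<in> sets M" if "k \<le> m" for k
  proof -
    have "{w\<in>space M. \<forall>j\<in>{..<k}. - x \<le> B (real j / real m) w} \<in> sets M"
      using that by (intro sets.sets_Collect_finite_All) auto
    moreover have "{w\<in>space M. B (real k / real m) w < - x} \<in> sets M" using that by measurable
    moreover have "A k = {w\<in>space M. \<forall>j\<in>{..<k}. - x \<le> B (real j / real m) w} \<inter> {w\<in>space M. B (real k / real m) w < - x}"
      by (auto simp: A_def)
    ultimately show ?thesis by simp
  qed
  have cover: "space M - grid_event M B 1 m x = (\<Union>k\<in>{..m}. A k)"
  proof (intro equalityI subsetI)
    fix w assume "w \<in> space M - grid_event M B 1 m x"
    then have sp: "w \<in> space M" and ex: "\<exists>k. k \<le> m \<and> B (real k / real m) w < - x" by (auto simp: grid_event_def not_le)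
    define k where "k = (LEAST k. k \<le> m \<and> B (real k / real m) w < - x)"
    have k: "k \<le> m" "B (real k / real m) w < - x" using LeastI_ex[OF ex] by (auto simp: k_def)
    moreover have "- x \<le> B (real j / real m) w" if "j < k" for j
      using not_less_Least[OF that[unfolded k_def]] that k(1) by auto
    ultimately show "w \<in> (\<Union>k\<in>{..m}. A k)" using sp by (auto simp: A_def)
  qed (auto simp: A_def grid_event_def not_le)
  have disj: "disjoint_family_on A {..m}"
    unfolding disjoint_family_on_def
  proof (intro ballI impI)
    have *: "A k \<inter> A k' = {}" if "k < k'" for k k' :: nat
      using that by (force simp: A_def)
    fix k k' :: nat assume "k \<noteq> k'"
    then show "A k \<inter> A k' = {}" using *[of k k'] *[of k' k] by (cases "k < k'") auto
  qed
  have half: "prob (A k) \<le> 2 * prob (A k \<inter> {w\<in>space M. B 1 w < - x})" if k: "k \<le> m" for k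
  proof (cases "k = m")
    case True
    then have "A k \<inter> {w\<in>space M. B 1 w < - x} = A k" using m by (auto simp: A_def)
    then show ?thesis by simp
  next
    case False
    then have km: "k < m" using k by simp
    have QX: "{w\<in>space M. Q k (\<lambda>i. X i w)} = {w\<in>space M. B 1 w - B (real k / real m) w \<le> 0}"
    proof -
      have "(\<Sum>l\<in>{k..<m}. X l w) = B 1 w - B (real k / real m) w" if "w \<in> space M" for w
      proof -
        have "(\<Sum>l<k. X l w) + (\<Sum>l\<in>{k..<m}. X l w) = (\<Sum>l<m. X l w)"
          using km sum.atLeastLessThan_concat[of 0 k m "\<lambda>l. X l w"] by (simp add: atLeast0LessThan)
        then show ?thesis using X3[OF that, of k] X3[OF that, of m] m by simp
      qed
      then show ?thesis by (auto simp: Q_def)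
    qed
    have "1 / 2 \<le> prob {w\<in>space M. B 1 w - B (real k / real m) w \<le> 0}"
      using km m by (intro normal_nonpos_prob_ge[OF brownian_motionD(5)[OF B]]) (auto simp: divide_less_eq)
    then have "prob (A k) * (1 / 2) \<le> prob {w\<in>space M. P k (\<lambda>i. X i w)} * prob {w\<in>space M. Q k (\<lambda>i. X i w)}"
      unfolding QX A_eq by (intro mult_left_mono) auto
    also have "\<dots> = prob {w\<in>space M. P k (\<lambda>i. X i w) \<and> Q k (\<lambda>i. X i w)}"
    proof (rule indep_blocks_prob[OF X(1), of "{..<k}" "{k..<m}", symmetric])
      have s: "(\<lambda>y. \<Sum>l<j. y l) \<in> borel_measurable (borel_power {..<k})" if "j \<le> k" for j
        using that by (intro partial_sum_measurable[where r = "\<lambda>l. l"]) auto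
      have "{y \<in> space (borel_power {..<k}). \<forall>j\<in>{..<k}. - x \<le> (\<Sum>l<j. y l)} \<in> sets (borel_power {..<k})"
        using s by (intro sets.sets_Collect_finite_All borel_measurable_le) auto
      moreover have "{y \<in> space (borel_power {..<k}). (\<Sum>l<k. y l) < - x} \<in> sets (borel_power {..<k})"
        using s by (intro borel_measurable_less) auto
      moreover have "{y \<in> space (borel_power {..<k}). P k y} =
          {y \<in> space (borel_power {..<k}). \<forall>j\<in>{..<k}. - x \<le> (\<Sum>l<j. y l)}
          \<inter> {y \<in> space (borel_power {..<k}). (\<Sum>l<k. y l) < - x}"
        by (auto simp: P_def)
      ultimately show "{y \<in> space (borel_power {..<k}). P k y} \<in> sets (borel_power {..<k})"
        by simp
      have "(\<Sum>l<j. restrict y {..<k} l) = (\<Sum>l<j. y l)" if "j \<le> k" for j and y :: "nat \<Rightarrow> real"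
        using that by (intro sum.cong) auto
      then show "P k (restrict y {..<k}) \<longleftrightarrow> P k y" for y unfolding P_def by simp
      have "(\<lambda>y. \<Sum>l\<in>{k..<m}. y l) \<in> borel_measurable (borel_power {k..<m})"
        by (intro borel_measurable_sum measurable_component_singleton)
      then show "{y \<in> space (borel_power {k..<m}). Q k y} \<in> sets (borel_power {k..<m})"
        unfolding Q_def by (intro borel_measurable_le) auto
      show "Q k (restrict y {k..<m}) \<longleftrightarrow> Q k y" for y unfolding Q_def by simp
    qed (use km in auto)
    also have "\<dots> = prob ({w\<in>space M. P k (\<lambda>i. X i w)} \<inter> {w\<in>space M. Q k (\<lambda>i. X i w)})"
      by (intro arg_cong[where f = prob]) auto
    also have "\<dots> \<le> prob (A k \<inter> {w\<in>space M. B 1 w < - x})"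
    proof (rule finite_measure_mono)
      show "{w\<in>space M. P k (\<lambda>i. X i w)} \<inter> {w\<in>space M. Q k (\<lambda>i. X i w)} \<subseteq> A k \<inter> {w\<in>space M. B 1 w < - x}"
        unfolding QX A_eq[symmetric] by (auto simp: A_def)
      show "A k \<inter> {w\<in>space M. B 1 w < - x} \<in> sets M" using k by measurable
    qed
    finally show ?thesis by simp
  qed
  have "prob (space M - grid_event M B 1 m x) = (\<Sum>k\<in>{..m}. prob (A k))"
    unfolding cover by (rule finite_measure_finite_Union) (use disj in auto)
  also have "\<dots> \<le> (\<Sum>k\<in>{..m}. 2 * prob (A k \<inter> {w\<in>space M. B 1 w < - x}))"
    by (intro sum_mono half) simp
  also have "\<dots> = 2 * prob (\<Union>k\<in>{..m}. A k \<inter> {w\<in>space M. B 1 w < - x})"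
    unfolding sum_distrib_left[symmetric]
    by (subst finite_measure_finite_Union) (use disj in \<open>auto simp: disjoint_family_on_def\<close>)
  also have "\<dots> \<le> 2 * prob {w\<in>space M. B 1 w < - x}"
    by (intro mult_left_mono finite_measure_mono) auto
  finally show ?thesis .
qed

lemma levy_inequality:
  assumes B: "brownian_motion M B"
  shows "measure M (space M - stay_above M B x) \<le> 2 * measure M {w\<in>space M. B 1 w < - x}"
proof -
  interpret prob_space M using brownian_motionD(1)[OF B] .
  have G: "grid_event M B 1 q x \<in> sets M" for q by (rule grid_event_measurable[OF B]) auto
  have "decseq (\<lambda>n. grid_event M B 1 (2 ^ n) x)"
  proof (rule decseq_SucI, rule subsetI)
    fix n w assume "w \<in> grid_event M B 1 (2 ^ Suc n) x"
    then have sp: "w \<in> space M" and *: "\<And>i. i \<le> 2 ^ Suc n \<Longrightarrow> - x \<le> B (real i / 2 ^ Suc n) w"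
      by (auto simp: grid_event_def)
    have "- x \<le> B (real i / 2 ^ n) w" if "i \<le> 2 ^ n" for i
      using *[of "2 * i"] that by simp
    then show "w \<in> grid_event M B 1 (2 ^ n) x" using sp by (auto simp: grid_event_def)
  qed
  then have "(\<lambda>n. prob (grid_event M B 1 (2 ^ n) x)) \<longlonglongrightarrow> prob (stay_above M B x)"
    unfolding stay_above_eq_Inter[OF B] using G by (intro finite_Lim_measure_decseq) auto
  moreover have "1 - 2 * prob {w\<in>space M. B 1 w < - x} \<le> prob (grid_event M B 1 (2 ^ n) x)" for n
    using levy_grid_inequality[OF B, of "2 ^ n" x] prob_compl[OF G[of "2 ^ n"]] by simp
  ultimately have "1 - 2 * prob {w\<in>space M. B 1 w < - x} \<le> prob (stay_above M B x)"
    by (intro LIMSEQ_le_const[of "\<lambda>n. prob (grid_event M B 1 (2 ^ n) x)"]) auto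
  then show ?thesis using prob_compl[OF stay_above_measurable[OF B, of x]] by simp
qed

text \<open>Levy's inequality bounds the probability of leaving by \<open>2 * P(B 1 < - \<epsilon>)\<close>, which by symmetry is
\<open>P(\<bar>B 1\<bar> > \<epsilon>)\<close>. What remains is at least \<open>P(\<bar>B 1\<bar> \<le> \<epsilon>)\<close>, and this is of order \<open>\<epsilon>\<close>.\<close>

lemma stay_above_prob_ge:
  assumes B: "brownian_motion M B" and e: "0 < \<epsilon>" "\<epsilon> \<le> 1"
  shows "exp (- 1) / 3 * \<epsilon> \<le> measure M (stay_above M B \<epsilon>)"
proof -
  interpret prob_space M using brownian_motionD(1)[OF B] .
  have B1[measurable]: "B 1 \<in> borel_measurable M" using brownian_motionD(2)[OF B] by simp
  have N: "distributed M lborel (B 1) (normal_density 0 1)"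
    using brownian_marginal_normal[OF B, of 1] by simp
  have "distr M lborel (B 1) = distr M lborel (\<lambda>w. - B 1 w)"
    using N normal_uminus[OF N] by (simp add: distributed_def)
  then have "measure (distr M lborel (B 1)) {..< - \<epsilon>} = measure (distr M lborel (\<lambda>w. - B 1 w)) {..< - \<epsilon>}" by simp
  then have sym: "prob {w\<in>space M. B 1 w < - \<epsilon>} = prob {w\<in>space M. \<epsilon> < B 1 w}"
    by (simp add: measure_distr vimage_def Int_def conj_commute)
  have "space M = ({w\<in>space M. B 1 w < - \<epsilon>} \<union> {w\<in>space M. \<epsilon> < B 1 w}) \<union> {w\<in>space M. \<bar>B 1 w\<bar> \<le> \<epsilon>}"
    by auto
  then have "1 = prob (({w\<in>space M. B 1 w < - \<epsilon>} \<union> {w\<in>space M. \<epsilon> < B 1 w}) \<union> {w\<in>space M. \<bar>B 1 w\<bar> \<le> \<epsilon>})"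
    using prob_space by simp
  also have "\<dots> = prob {w\<in>space M. B 1 w < - \<epsilon>} + prob {w\<in>space M. \<epsilon> < B 1 w} + prob {w\<in>space M. \<bar>B 1 w\<bar> \<le> \<epsilon>}"
    using e by (subst finite_measure_Union; (subst finite_measure_Union)?) auto
  finally have "prob {w\<in>space M. \<bar>B 1 w\<bar> \<le> \<epsilon>} \<le> prob (stay_above M B \<epsilon>)"
    using sym levy_inequality[OF B, of \<epsilon>] prob_compl[OF stay_above_measurable[OF B, of \<epsilon>]] by simp
  then show ?thesis using std_normal_central_prob_ge[OF N e] by linarith
qed

section \<open>Moments on the event of staying above a level\<close>

text \<open>The absolute moment of order \<open>2 * r + 1\<close> of a standard normal variable.\<close>

definition abs_moment :: "nat \<Rightarrow> real" where "abs_moment r = 2 ^ r * fact r * sqrt (2 / pi)"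

lemma abs_moment_nonneg: "0 \<le> abs_moment r" by (simp add: abs_moment_def)

lemma brownian_abs_odd_moment:
  assumes B: "brownian_motion M B" and t: "0 \<le> t" "t \<le> 1"
  shows "(\<integral>\<^sup>+w. ennreal (\<bar>B t w\<bar> ^ (2 * r + 1)) \<partial>M) = ennreal (sqrt t ^ (2 * r + 1) * abs_moment r)"
proof -
  interpret prob_space M using brownian_motionD(1)[OF B] .
  show ?thesis
  proof (cases "t = 0")
    case True
    have "(\<integral>\<^sup>+w. ennreal (\<bar>B t w\<bar> ^ (2 * r + 1)) \<partial>M) = (\<integral>\<^sup>+w. 0 \<partial>M)"
      using brownian_motionD(4)[OF B] True by (intro nn_integral_cong) simp
    then show ?thesis using True by simp
  next
    case False
    then show ?thesis
      using normal_abs_odd_moment[OF brownian_marginal_normal[OF B], of t r] t by (simp add: abs_moment_def)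
  qed
qed

lemma increment_moment_on_grid_event:
  assumes B: "brownian_motion M B" and T: "0 < T" "T < t" "t \<le> 1"
  shows "(\<integral>\<^sup>+w. indicator (grid_event M B T q \<epsilon>) w * ennreal (\<bar>B t w - B T w\<bar> ^ (2 * r + 1)) \<partial>M)
     = emeasure M (grid_event M B T q \<epsilon>) * ennreal (sqrt (t - T) ^ (2 * r + 1) * abs_moment r)"
proof -
  interpret prob_space M using brownian_motionD(1)[OF B] .
  define \<tau> where "\<tau> i = (if i \<le> q then T * (real i / real q) else if i = Suc q then T else t)" for i
  define D where "D i w = B (\<tau> (Suc i)) w - B (\<tau> i) w" for i w
  have D_indep: "indep_vars (\<lambda>_. borel) D {..<Suc (Suc q)}"
    unfolding D_def
  proof (rule brownian_motionD(6)[OF B])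
    show "0 \<le> \<tau> 0" by (simp add: \<tau>_def)
    show "\<tau> (Suc (Suc q)) \<le> 1" using T by (simp add: \<tau>_def)
    fix i assume i: "i < Suc (Suc q)"
    consider "Suc i \<le> q" | "i = q" | "i = Suc q" using i by linarith
    then show "\<tau> i \<le> \<tau> (Suc i)"
    proof cases
      case 1 then show ?thesis using T by (simp add: \<tau>_def divide_right_mono mult_left_mono)
    next
      case 2 then show ?thesis using T by (simp add: \<tau>_def)
    next
      case 3 then show ?thesis using T by (simp add: \<tau>_def)
    qed
  qed
  define K where "K b = (if b then {..<q} else {Suc q})" for b
  define F where "F b x = (if b then (if \<forall>i\<in>{..q}. - \<epsilon> \<le> (\<Sum>l<i. x l) then 1 else (0::ennreal))
     else ennreal (\<bar>x (Suc q)\<bar> ^ (2 * r + 1)))" for b and x :: "nat \<Rightarrow> real"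
  have FT: "F True (restrict (\<lambda>i. D i w) (K True)) = indicator (grid_event M B T q \<epsilon>) w" if "w \<in> space M" for w
    using grid_event_barrier_indicator[OF B that, of q \<tau> T \<epsilon>] by (simp add: F_def K_def D_def \<tau>_def)
  have FF: "F False (restrict (\<lambda>i. D i w) (K False)) = ennreal (\<bar>B t w - B T w\<bar> ^ (2 * r + 1))" for w
    by (simp add: F_def K_def D_def \<tau>_def)
  have "(\<integral>\<^sup>+w. indicator (grid_event M B T q \<epsilon>) w * ennreal (\<bar>B t w - B T w\<bar> ^ (2 * r + 1)) \<partial>M)
     = (\<integral>\<^sup>+w. (\<Prod>b\<in>UNIV. F b (restrict (\<lambda>i. D i w) (K b))) \<partial>M)"
    by (intro nn_integral_cong) (simp add: UNIV_bool FF FT mult.commute del: power_Suc)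
  also have "\<dots> = (\<Prod>b\<in>UNIV. \<integral>\<^sup>+w. F b (restrict (\<lambda>i. D i w) (K b)) \<partial>M)"
  proof (rule indep_blocks_nn_integral[OF D_indep])
    show "disjoint_family_on K UNIV" by (auto simp: disjoint_family_on_def K_def)
    show "K b \<subseteq> {..<Suc (Suc q)}" for b by (auto simp: K_def)
    show "F b \<in> borel_measurable (borel_power (K b))" for b
    proof (cases b)
      case True
      then show ?thesis using barrier_indicator_measurable[of q \<epsilon>] by (simp add: K_def F_def[abs_def])
    next
      case False
      have [measurable]: "(\<lambda>x. x (Suc q)) \<in> borel_measurable (borel_power (K b))"
        using False by (intro measurable_component_singleton) (simp add: K_def)
      have "(\<lambda>x. ennreal (\<bar>x (Suc q)\<bar> ^ (2 * r + 1))) \<in> borel_measurable (borel_power (K b))" by measurable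
      then show ?thesis using False by (simp add: F_def[abs_def])
    qed
  qed simp
  also have "\<dots> = (\<integral>\<^sup>+w. indicator (grid_event M B T q \<epsilon>) w \<partial>M) * (\<integral>\<^sup>+w. ennreal (\<bar>B t w - B T w\<bar> ^ (2 * r + 1)) \<partial>M)"
    unfolding UNIV_bool using nn_integral_cong[of M, OF FT] by (simp add: FF mult.commute del: power_Suc)
  also have "(\<integral>\<^sup>+w. indicator (grid_event M B T q \<epsilon>) w \<partial>M) = emeasure M (grid_event M B T q \<epsilon>)"
    using grid_event_measurable[OF B, of T] T by simp
  also have "(\<integral>\<^sup>+w. ennreal (\<bar>B t w - B T w\<bar> ^ (2 * r + 1)) \<partial>M) = ennreal (sqrt (t - T) ^ (2 * r + 1) * abs_moment r)"
    using T by (subst normal_abs_odd_moment[OF brownian_motionD(5)[OF B]]) (auto simp: abs_moment_def)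
  finally show ?thesis .
qed

text \<open>Here \<open>6 * exp 2\<close> is the persistence constant, \<open>4 = sqrt 16\<close> comes from the persistence up to time \<open>t / 16\<close>
and \<open>4 ^ r\<close> from \<open>(x + y) ^ (2 * r + 1) \<le> 4 ^ r * (x ^ (2 * r + 1) + y ^ (2 * r + 1))\<close>. The factor \<open>2\<close> makes
the recursion in \<open>moment_on_stay_above\<close> close, where the recursive term takes up at most half of the bound.\<close>

definition meander_const :: "nat \<Rightarrow> real" where
  "meander_const r = 2 * 4 ^ r * (4 * (6 * exp 2)) * abs_moment r"

lemma two_term_power_le:
  fixes x y :: real
  assumes "0 \<le> x" "0 \<le> y"
  shows "(x + y) ^ (2 * r + 1) \<le> 4 ^ r * (x ^ (2 * r + 1) + y ^ (2 * r + 1))"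
proof -
  have "((\<Sum>j<2. if j = (0::nat) then x else y) / real 2) ^ (2 * r + 1)
      \<le> (\<Sum>j<2. (if j = (0::nat) then x else y) ^ (2 * r + 1)) / real 2"
    using assms by (intro average_power_le) auto
  then have "((x + y) / 2) ^ (2 * r + 1) \<le> (x ^ (2 * r + 1) + y ^ (2 * r + 1)) / 2"
    by (simp add: numeral_2_eq_2)
  moreover have "(2::real) ^ (2 * r + 1) = 2 * 4 ^ r" by (simp add: power_mult)
  ultimately show ?thesis by (simp only: power_divide) (simp add: field_simps)
qed

text \<open>Split \<open>B t\<close> into \<open>B (t/16)\<close> and an increment. On the grid event up to time \<open>t/16\<close>, of probability of order
\<open>\<epsilon> / sqrt t\<close>, the increment contributes order \<open>\<epsilon> * t ^ r\<close>. The contribution of \<open>B (t/16)\<close> is a recursive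
instance with total factor \<open>4 ^ r / 16 ^ r = 1 / 4 ^ r\<close>, which is a contraction because \<open>r \<ge> 1\<close>. The recursion
starts from \<open>t \<le> \<epsilon>^2\<close>, where the unconditional moment \<open>t ^ r * sqrt t\<close>, up to its constant, is already at
most \<open>\<epsilon> * t ^ r\<close>.\<close>

lemma moment_on_stay_above:
  assumes B: "brownian_motion M B" and e: "0 < \<epsilon>" and r: "1 \<le> r" and t: "0 \<le> t" "t \<le> 1"
  shows "(\<integral>\<^sup>+w. indicator (stay_above M B \<epsilon>) w * ennreal (\<bar>B t w\<bar> ^ (2 * r + 1)) \<partial>M)
     \<le> ennreal (meander_const r * \<epsilon> * t ^ r)"
proof -
  interpret prob_space M using brownian_motionD(1)[OF B] .
  let ?S = "stay_above M B \<epsilon>"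
  have [measurable]: "?S \<in> sets M" by (rule stay_above_measurable[OF B])
  have Bm: "B t \<in> borel_measurable M" if "t \<in> {0..1}" for t using brownian_motionD(2)[OF B that] .
  have e2: "1 \<le> exp (2::real)" by simp
  have mc: "abs_moment r \<le> meander_const r"
  proof -
    have "1 * abs_moment r \<le> (2 * 4 ^ r * (4 * (6 * exp 2))) * abs_moment r"
    proof (intro mult_right_mono abs_moment_nonneg)
      have "1 * 1 \<le> (2 * 4 ^ r) * (4 * (6 * exp (2::real)))"
        using e2 one_le_power[of "4::real" r] by (intro mult_mono) linarith+
      then show "1 \<le> 2 * 4 ^ r * (4 * (6 * exp (2::real)))" by simp
    qed
    then show ?thesis by (simp add: meander_const_def)
  qed
  have mc0: "0 \<le> meander_const r" using mc abs_moment_nonneg[of r] by linarith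
  have "\<forall>t. 0 < t \<and> t \<le> 1 \<and> t \<le> 16 ^ n * \<epsilon>\<^sup>2 \<longrightarrow>
      (\<integral>\<^sup>+w. indicator ?S w * ennreal (\<bar>B t w\<bar> ^ (2 * r + 1)) \<partial>M) \<le> ennreal (meander_const r * \<epsilon> * t ^ r)" for n
  proof (induction n)
    case 0
    show ?case
    proof (intro allI impI)
      fix t assume t: "0 < t \<and> t \<le> 1 \<and> t \<le> 16 ^ 0 * \<epsilon>\<^sup>2"
      have "(\<integral>\<^sup>+w. indicator ?S w * ennreal (\<bar>B t w\<bar> ^ (2 * r + 1)) \<partial>M) \<le> (\<integral>\<^sup>+w. ennreal (\<bar>B t w\<bar> ^ (2 * r + 1)) \<partial>M)"
        by (intro nn_integral_mono) (auto simp: indicator_def)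
      also have "\<dots> = ennreal (sqrt t ^ (2 * r + 1) * abs_moment r)"
        using t by (intro brownian_abs_odd_moment[OF B]) auto
      also have "sqrt t ^ (2 * r + 1) * abs_moment r = abs_moment r * sqrt t * t ^ r"
      proof -
        have "sqrt t ^ (2 * r) = t ^ r" using t by (subst power_mult) simp
        then show ?thesis by simp
      qed
      also have "\<dots> \<le> meander_const r * \<epsilon> * t ^ r"
        using t e mc abs_moment_nonneg[of r] mc0 by (intro mult_right_mono mult_mono real_le_lsqrt) auto
      finally show "(\<integral>\<^sup>+w. indicator ?S w * ennreal (\<bar>B t w\<bar> ^ (2 * r + 1)) \<partial>M) \<le> ennreal (meander_const r * \<epsilon> * t ^ r)"
        by (simp add: ennreal_leI)
    qed
  next
    case (Suc n)
    show ?case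
    proof (intro allI impI)
      fix t assume t: "0 < t \<and> t \<le> 1 \<and> t \<le> 16 ^ Suc n * \<epsilon>\<^sup>2"
      define T where "T = t / 16"
      have T: "0 < T" "T < t" "t \<le> 1" "T \<le> 1" "T \<le> 16 ^ n * \<epsilon>\<^sup>2" using t by (auto simp: T_def)
      have [measurable]: "B t \<in> borel_measurable M" "B T \<in> borel_measurable M" using T by (auto intro: Bm)
      obtain q where q: "prob (grid_event M B T q \<epsilon>) \<le> 6 * exp 2 * \<epsilon> / sqrt T"
        using persistence_prob_le[OF B T(1,4) e] by blast
      let ?G = "grid_event M B T q \<epsilon>"
      have [measurable]: "?G \<in> sets M" using grid_event_measurable[OF B, of T] T by simp
      have SG: "?S \<subseteq> ?G" using T by (intro stay_above_subset_grid_event) auto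
      have IH: "(\<integral>\<^sup>+w. indicator ?S w * ennreal (\<bar>B T w\<bar> ^ (2 * r + 1)) \<partial>M) \<le> ennreal (meander_const r * \<epsilon> * T ^ r)"
        using Suc.IH T by auto
      have "(\<integral>\<^sup>+w. indicator ?G w * ennreal (\<bar>B t w - B T w\<bar> ^ (2 * r + 1)) \<partial>M)
          = ennreal (prob ?G * (sqrt (t - T) ^ (2 * r + 1) * abs_moment r))"
        using T abs_moment_nonneg[of r]
        by (subst increment_moment_on_grid_event[OF B T(1-3)]) (simp add: emeasure_eq_measure ennreal_mult')
      also have "prob ?G * (sqrt (t - T) ^ (2 * r + 1) * abs_moment r)
          \<le> (6 * exp 2 * \<epsilon> / sqrt T) * (sqrt t ^ (2 * r + 1) * abs_moment r)"
        using T e q abs_moment_nonneg[of r] by (intro mult_mono power_mono) auto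
      also have "sqrt t = 4 * sqrt T" by (simp add: T_def real_sqrt_divide)
      then have "(6 * exp 2 * \<epsilon> / sqrt T) * (sqrt t ^ (2 * r + 1) * abs_moment r)
          = 4 * (6 * exp 2) * \<epsilon> * abs_moment r * t ^ r"
      proof -
        have "sqrt t ^ (2 * r) = t ^ r" using t by (subst power_mult) simp
        then have "sqrt t ^ (2 * r + 1) = t ^ r * (4 * sqrt T)" using \<open>sqrt t = 4 * sqrt T\<close> by simp
        then show ?thesis using T by simp
      qed
      finally have D: "(\<integral>\<^sup>+w. indicator ?G w * ennreal (\<bar>B t w - B T w\<bar> ^ (2 * r + 1)) \<partial>M)
          \<le> ennreal (4 * (6 * exp 2) * \<epsilon> * abs_moment r * t ^ r)" by (simp add: ennreal_leI)
      have "(\<integral>\<^sup>+w. indicator ?S w * ennreal (\<bar>B t w\<bar> ^ (2 * r + 1)) \<partial>M)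
          \<le> (\<integral>\<^sup>+w. ennreal (4 ^ r) * (indicator ?S w * ennreal (\<bar>B T w\<bar> ^ (2 * r + 1))
              + indicator ?G w * ennreal (\<bar>B t w - B T w\<bar> ^ (2 * r + 1))) \<partial>M)"
      proof (rule nn_integral_mono)
        fix w
        have "\<bar>B t w\<bar> ^ (2 * r + 1) \<le> (\<bar>B T w\<bar> + \<bar>B t w - B T w\<bar>) ^ (2 * r + 1)"
          by (intro power_mono) auto
        also have "\<dots> \<le> 4 ^ r * (\<bar>B T w\<bar> ^ (2 * r + 1) + \<bar>B t w - B T w\<bar> ^ (2 * r + 1))"
          by (intro two_term_power_le) auto
        finally have "ennreal (\<bar>B t w\<bar> ^ (2 * r + 1)) \<le> ennreal (4 ^ r * (\<bar>B T w\<bar> ^ (2 * r + 1) + \<bar>B t w - B T w\<bar> ^ (2 * r + 1)))"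
          by (rule ennreal_leI)
        also have "\<dots> = ennreal (4 ^ r) * (ennreal (\<bar>B T w\<bar> ^ (2 * r + 1)) + ennreal (\<bar>B t w - B T w\<bar> ^ (2 * r + 1)))"
          by (subst ennreal_mult) (auto simp del: power_Suc)
        finally show "indicator ?S w * ennreal (\<bar>B t w\<bar> ^ (2 * r + 1))
          \<le> ennreal (4 ^ r) * (indicator ?S w * ennreal (\<bar>B T w\<bar> ^ (2 * r + 1))
              + indicator ?G w * ennreal (\<bar>B t w - B T w\<bar> ^ (2 * r + 1)))"
          using SG by (cases "w \<in> ?S") (auto simp del: power_Suc)
      qed
      also have "\<dots> = ennreal (4 ^ r) * ((\<integral>\<^sup>+w. indicator ?S w * ennreal (\<bar>B T w\<bar> ^ (2 * r + 1)) \<partial>M)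
          + (\<integral>\<^sup>+w. indicator ?G w * ennreal (\<bar>B t w - B T w\<bar> ^ (2 * r + 1)) \<partial>M))"
        by (subst nn_integral_cmult, simp, subst nn_integral_add) auto
      also have "\<dots> \<le> ennreal (4 ^ r) * (ennreal (meander_const r * \<epsilon> * T ^ r) + ennreal (4 * (6 * exp 2) * \<epsilon> * abs_moment r * t ^ r))"
        by (intro mult_left_mono add_mono IH D) auto
      also have "\<dots> = ennreal (4 ^ r * (meander_const r * \<epsilon> * T ^ r + 4 * (6 * exp 2) * \<epsilon> * abs_moment r * t ^ r))"
        using mc0 e T t abs_moment_nonneg[of r] by (subst ennreal_mult) auto
      also have "4 ^ r * (meander_const r * \<epsilon> * T ^ r + 4 * (6 * exp 2) * \<epsilon> * abs_moment r * t ^ r)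
          \<le> meander_const r * \<epsilon> * t ^ r"
      proof -
        have "T ^ r = t ^ r / (4 ^ r * 4 ^ r)" by (simp add: T_def power_divide flip: power_mult_distrib)
        then have "4 ^ r * (meander_const r * \<epsilon> * T ^ r) = meander_const r * \<epsilon> * t ^ r * (1 / 4 ^ r)" by simp
        also have "\<dots> \<le> meander_const r * \<epsilon> * t ^ r * (1 / 2)"
        proof (intro mult_left_mono)
          have "(4::real) ^ 1 \<le> 4 ^ r" using r by (intro power_increasing) auto
          then have "2 \<le> (4::real) ^ r" by simp
          then show "1 / 4 ^ r \<le> 1 / (2::real)" by (intro divide_left_mono) auto
        qed (use mc0 e t in auto)
        finally have "4 ^ r * (meander_const r * \<epsilon> * T ^ r) \<le> meander_const r * \<epsilon> * t ^ r / 2" by simp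
        moreover have "4 ^ r * (4 * (6 * exp 2) * \<epsilon> * abs_moment r * t ^ r) = meander_const r * \<epsilon> * t ^ r / 2"
          by (simp add: meander_const_def)
        ultimately show ?thesis by (simp only: distrib_left)
      qed
      finally show "(\<integral>\<^sup>+w. indicator ?S w * ennreal (\<bar>B t w\<bar> ^ (2 * r + 1)) \<partial>M) \<le> ennreal (meander_const r * \<epsilon> * t ^ r)"
        by (simp add: ennreal_leI)
    qed
  qed
  note * = this
  show ?thesis
  proof (cases "t = 0")
    case True
    have "(\<integral>\<^sup>+w. indicator ?S w * ennreal (\<bar>B t w\<bar> ^ (2 * r + 1)) \<partial>M) = (\<integral>\<^sup>+w. 0 \<partial>M)"
      using brownian_motionD(4)[OF B] True by (intro nn_integral_cong) simp
    then show ?thesis by simp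
  next
    case False
    obtain n where n: "1 / \<epsilon>\<^sup>2 < 16 ^ n" using real_arch_pow[of 16 "1 / \<epsilon>\<^sup>2"] by auto
    then have "1 \<le> 16 ^ n * \<epsilon>\<^sup>2" using e by (simp add: divide_less_eq)
    then show ?thesis using *[of n] False t by auto
  qed
qed

section \<open>Moments of path integrals\<close>

lemma path_integral_riemann:
  assumes Y: "continuous_process M Y" and w: "w \<in> space M"
  shows "(\<lambda>m. (\<Sum>j<Suc m. Y (real j / real (Suc m)) w) / real (Suc m)) \<longlonglongrightarrow> path_integral Y w"
  using Y w unfolding path_integral_def continuous_process_def by (intro riemann_sum_tendsto) auto

lemma unit_grid_in: "j < Suc m \<Longrightarrow> real j / real (Suc m) \<in> {0..1}"
  by (auto simp: divide_le_eq)

lemma path_integral_measurable: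
  assumes Y: "continuous_process M Y"
  shows "path_integral Y \<in> borel_measurable M"
proof (rule borel_measurable_LIMSEQ_real)
  show "(\<lambda>m. (\<Sum>j<Suc m. Y (real j / real (Suc m)) w) / real (Suc m)) \<longlonglongrightarrow> path_integral Y w" if "w \<in> space M" for w
    using path_integral_riemann[OF Y that] .
  have "Y (real j / real (Suc m)) \<in> borel_measurable M" if "j < Suc m" for j m
    using Y unit_grid_in[OF that] unfolding continuous_process_def by blast
  then show "(\<lambda>w. (\<Sum>j<Suc m. Y (real j / real (Suc m)) w) / real (Suc m)) \<in> borel_measurable M" for m
    by (intro borel_measurable_divide borel_measurable_sum) auto
qed

lemma continuous_process_abs:
  "continuous_process M Y \<Longrightarrow> continuous_process M (\<lambda>t w. \<bar>Y t w\<bar>)"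
  unfolding continuous_process_def by (auto intro!: continuous_intros)

lemma path_integral_nonneg:
  assumes "\<And>t. t \<in> {0..1} \<Longrightarrow> 0 \<le> Y t w"
  shows "0 \<le> path_integral Y w"
  unfolding path_integral_def set_lebesgue_integral_def
  using assms by (intro integral_nonneg_AE AE_I2) (auto simp: indicator_def)

lemma path_integral_mono:
  assumes "continuous_on {0..1} (\<lambda>t. Y t w)" "continuous_on {0..1} (\<lambda>t. Z t w)"
    and "\<And>t. t \<in> {0..1} \<Longrightarrow> Y t w \<le> Z t w"
  shows "path_integral Y w \<le> path_integral Z w"
  unfolding path_integral_def using assms
  by (intro set_integral_mono set_integrable_unit_interval) auto

text \<open>Convexity of the odd power on nonnegative numbers bounds the moment of each Riemann sum by the average of
the moments at the grid points, and Fatou's lemma passes to the integral.\<close>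

lemma path_integral_odd_moment:
  assumes Y: "continuous_process M Y" and S[measurable]: "S \<in> sets M"
    and Y0: "\<And>t w. t \<in> {0..1} \<Longrightarrow> w \<in> space M \<Longrightarrow> 0 \<le> Y t w"
    and C: "\<And>t. t \<in> {0..1} \<Longrightarrow> (\<integral>\<^sup>+w. indicator S w * ennreal (Y t w ^ (2 * r + 1)) \<partial>M) \<le> C"
  shows "(\<integral>\<^sup>+w. indicator S w * ennreal (path_integral Y w ^ (2 * r + 1)) \<partial>M) \<le> C"
proof -
  define u where "u m j = real j / real (Suc m)" for m j
  have u: "u m j \<in> {0..1}" if "j < Suc m" for m j unfolding u_def using unit_grid_in[OF that] .
  have Ym[measurable]: "Y (u m j) \<in> borel_measurable M" if "j < Suc m" for m j
    using Y u[OF that] unfolding continuous_process_def by blast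
  let ?A = "\<lambda>m w. (\<Sum>j<Suc m. Y (u m j) w ^ (2 * r + 1)) / real (Suc m)"
  have "(\<integral>\<^sup>+w. indicator S w * ennreal (path_integral Y w ^ (2 * r + 1)) \<partial>M)
     \<le> (\<integral>\<^sup>+w. liminf (\<lambda>m. indicator S w * ennreal (?A m w)) \<partial>M)"
  proof (rule nn_integral_mono)
    fix w assume w: "w \<in> space M"
    have "(\<lambda>m. ((\<Sum>j<Suc m. Y (u m j) w) / real (Suc m)) ^ (2 * r + 1)) \<longlonglongrightarrow> path_integral Y w ^ (2 * r + 1)"
      unfolding u_def by (intro tendsto_power path_integral_riemann[OF Y w])
    then have "ennreal (path_integral Y w ^ (2 * r + 1)) = liminf (\<lambda>m. ennreal (((\<Sum>j<Suc m. Y (u m j) w) / real (Suc m)) ^ (2 * r + 1)))"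
      by (intro lim_imp_Liminf[symmetric] tendsto_ennrealI) auto
    also have "\<dots> \<le> liminf (\<lambda>m. ennreal (?A m w))"
      using Y0[OF u w] by (intro Liminf_mono always_eventually allI ennreal_leI average_power_le) auto
    finally show "indicator S w * ennreal (path_integral Y w ^ (2 * r + 1)) \<le> liminf (\<lambda>m. indicator S w * ennreal (?A m w))"
      by (cases "w \<in> S") simp_all
  qed
  also have "\<dots> \<le> liminf (\<lambda>m. \<integral>\<^sup>+w. indicator S w * ennreal (?A m w) \<partial>M)"
    by (intro nn_integral_liminf borel_measurable_times_ennreal measurable_compose[OF _ measurable_ennreal] borel_measurable_divide borel_measurable_sum borel_measurable_power Ym) auto
  also have "\<dots> \<le> liminf (\<lambda>m. C)"
  proof (intro Liminf_mono always_eventually allI)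
    fix m
    show "(\<integral>\<^sup>+w. indicator S w * ennreal (?A m w) \<partial>M) \<le> C"
    proof (rule nn_integral_average_le[OF S])
      fix j assume j: "j < Suc m"
      show "(\<lambda>w. Y (u m j) w ^ (2 * r + 1)) \<in> borel_measurable M" using Ym[OF j] by measurable
      show "0 \<le> Y (u m j) w ^ (2 * r + 1)" if "w \<in> space M" for w
        using Y0[OF u[OF j] that] by (rule zero_le_power)
      show "(\<integral>\<^sup>+w. indicator S w * ennreal (Y (u m j) w ^ (2 * r + 1)) \<partial>M) \<le> C"
        by (rule C[OF u[OF j]])
    qed
  qed
  also have "\<dots> = C" by (intro lim_imp_Liminf) auto
  finally show ?thesis .
qed

text \<open>All cases except the meander are instances: the lower bound by an affinely perturbed Brownian path gives
the negative moments, the uniform bound on the marginals the positive ones.\<close>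

lemma path_integral_moments_entire:
  assumes B: "brownian_motion M B" and Y: "continuous_process M Y"
    and low: "\<And>t w. t \<in> {0..1} \<Longrightarrow> w \<in> space M \<Longrightarrow> \<bar>B t w - \<alpha> w - \<beta> w * t\<bar> \<le> Y t w"
    and mom: "\<And>r. \<exists>C::real. \<forall>t\<in>{0..1}. (\<integral>\<^sup>+w. ennreal (Y t w ^ (2 * r + 1)) \<partial>M) \<le> ennreal C"
    and X: "X = path_integral Y"
  shows "entire_moments M X"
proof -
  interpret prob_space M using brownian_motionD(1)[OF B] .
  have Y0: "0 \<le> Y t w" if "t \<in> {0..1}" "w \<in> space M" for t w
    using low[OF that] by (meson abs_ge_zero order_trans)
  have G: "grid_event M B (1/2) 0 1 = space M"
    using brownian_motionD(4)[OF B] by (auto simp: grid_event_def)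
  show ?thesis unfolding X
  proof (rule entire_from_moment_bounds)
    show "prob_space M" by unfold_locales
    show "path_integral Y \<in> borel_measurable M" by (rule path_integral_measurable[OF Y])
    show "AE w in M. 0 \<le> path_integral Y w" using Y0 by (intro AE_I2 path_integral_nonneg)
    show "\<exists>K. \<forall>\<delta>. 0 < \<delta> \<and> \<delta> < 1 \<longrightarrow> (\<integral>\<^sup>+w. ennreal ((1 / (path_integral Y w + \<delta>)) ^ k) \<partial>M) \<le> ennreal K" for k
    proof (intro exI allI impI)
      fix \<delta> :: real assume d: "0 < \<delta> \<and> \<delta> < 1"
      have "(\<integral>\<^sup>+w. ennreal ((1 / (path_integral Y w + \<delta>)) ^ k) \<partial>M)
         \<le> (\<integral>\<^sup>+w. indicator (grid_event M B (1/2) 0 1) w *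
             ennreal ((1 / ((LBINT t:{0..1}. \<bar>B t w - \<alpha> w - \<beta> w * t\<bar>) + \<delta>)) ^ k) \<partial>M)"
      proof (rule nn_integral_mono)
        fix w assume w: "w \<in> space M"
        let ?L = "path_integral (\<lambda>t w. \<bar>B t w - \<alpha> w - \<beta> w * t\<bar>) w"
        have L0: "0 \<le> ?L" by (rule path_integral_nonneg) simp
        have LY: "?L \<le> path_integral Y w"
          using brownian_motionD(3)[OF B w] Y w low unfolding continuous_process_def
          by (intro path_integral_mono) (auto intro!: continuous_intros)
        have "(1 / (path_integral Y w + \<delta>)) ^ k \<le> (1 / (?L + \<delta>)) ^ k"
          using L0 LY d by (intro power_mono divide_left_mono mult_pos_pos) (auto intro: add_nonneg_pos)
        then show "ennreal ((1 / (path_integral Y w + \<delta>)) ^ k) \<le> indicator (grid_event M B (1/2) 0 1) w *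
             ennreal ((1 / ((LBINT t:{0..1}. \<bar>B t w - \<alpha> w - \<beta> w * t\<bar>) + \<delta>)) ^ k)"
          using w by (simp add: G path_integral_def ennreal_leI)
      qed
      also have "\<dots> \<le> emeasure M (grid_event M B (1/2) 0 1) * ennreal (negative_moment_const k)"
        using d by (intro negative_moment_bound[OF B]) auto
      finally show "(\<integral>\<^sup>+w. ennreal ((1 / (path_integral Y w + \<delta>)) ^ k) \<partial>M) \<le> ennreal (negative_moment_const k)"
        by (simp add: G emeasure_space_1)
    qed
    show "(\<integral>\<^sup>+w. ennreal (path_integral Y w ^ (2 * r + 1)) \<partial>M) < \<infinity>" for r
    proof -
      obtain C where C: "\<And>t. t \<in> {0..1} \<Longrightarrow> (\<integral>\<^sup>+w. ennreal (Y t w ^ (2 * r + 1)) \<partial>M) \<le> ennreal C"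
        using mom[of r] by blast
      have "(\<integral>\<^sup>+w. indicator (space M) w * ennreal (path_integral Y w ^ (2 * r + 1)) \<partial>M) \<le> ennreal C"
      proof (rule path_integral_odd_moment[OF Y _ Y0])
        fix t :: real assume "t \<in> {0..1}"
        from C[OF this] show "(\<integral>\<^sup>+w. indicator (space M) w * ennreal (Y t w ^ (2 * r + 1)) \<partial>M) \<le> ennreal C"
          by (subst nn_integral_cong[where v = "\<lambda>w. ennreal (Y t w ^ (2 * r + 1))"]) auto
      qed auto
      then have "(\<integral>\<^sup>+w. ennreal (path_integral Y w ^ (2 * r + 1)) \<partial>M) \<le> ennreal C"
        by (subst (asm) nn_integral_cong[where v = "\<lambda>w. ennreal (path_integral Y w ^ (2 * r + 1))"]) auto
      then show ?thesis by (auto simp: less_top[symmetric] top_unique)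
    qed
  qed
qed

lemma sum_odd_moment_le:
  assumes [measurable]: "Y \<in> borel_measurable M" "Z \<in> borel_measurable M"
    and le: "\<And>w. w \<in> space M \<Longrightarrow> 0 \<le> W w \<and> W w \<le> \<bar>Y w\<bar> + \<bar>Z w\<bar>"
    and Y: "(\<integral>\<^sup>+w. ennreal (\<bar>Y w\<bar> ^ (2 * r + 1)) \<partial>M) \<le> ennreal C"
    and Z: "(\<integral>\<^sup>+w. ennreal (\<bar>Z w\<bar> ^ (2 * r + 1)) \<partial>M) \<le> ennreal D" and CD: "0 \<le> C" "0 \<le> D"
  shows "(\<integral>\<^sup>+w. ennreal (W w ^ (2 * r + 1)) \<partial>M) \<le> ennreal (4 ^ r * (C + D))"
proof -
  have "(\<integral>\<^sup>+w. ennreal (W w ^ (2 * r + 1)) \<partial>M)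
      \<le> (\<integral>\<^sup>+w. ennreal (4 ^ r) * (ennreal (\<bar>Y w\<bar> ^ (2 * r + 1)) + ennreal (\<bar>Z w\<bar> ^ (2 * r + 1))) \<partial>M)"
  proof (rule nn_integral_mono)
    fix w assume w: "w \<in> space M"
    have "W w ^ (2 * r + 1) \<le> (\<bar>Y w\<bar> + \<bar>Z w\<bar>) ^ (2 * r + 1)"
      using le[OF w] by (intro power_mono) auto
    also have "\<dots> \<le> 4 ^ r * (\<bar>Y w\<bar> ^ (2 * r + 1) + \<bar>Z w\<bar> ^ (2 * r + 1))"
      by (rule two_term_power_le) auto
    finally have "ennreal (W w ^ (2 * r + 1)) \<le> ennreal (4 ^ r * (\<bar>Y w\<bar> ^ (2 * r + 1) + \<bar>Z w\<bar> ^ (2 * r + 1)))"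
      by (rule ennreal_leI)
    also have "\<dots> = ennreal (4 ^ r) * (ennreal (\<bar>Y w\<bar> ^ (2 * r + 1)) + ennreal (\<bar>Z w\<bar> ^ (2 * r + 1)))"
      by (subst ennreal_mult) (auto simp del: power_Suc)
    finally show "ennreal (W w ^ (2 * r + 1)) \<le> ennreal (4 ^ r) * (ennreal (\<bar>Y w\<bar> ^ (2 * r + 1)) + ennreal (\<bar>Z w\<bar> ^ (2 * r + 1)))" .
  qed
  also have "\<dots> = ennreal (4 ^ r) * ((\<integral>\<^sup>+w. ennreal (\<bar>Y w\<bar> ^ (2 * r + 1)) \<partial>M) + (\<integral>\<^sup>+w. ennreal (\<bar>Z w\<bar> ^ (2 * r + 1)) \<partial>M))"
    by (subst nn_integral_cmult, simp, subst nn_integral_add) auto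
  also have "\<dots> \<le> ennreal (4 ^ r) * (ennreal C + ennreal D)"
    by (intro mult_left_mono add_mono Y Z) auto
  also have "\<dots> = ennreal (4 ^ r * (C + D))" using CD by (subst ennreal_mult) auto
  finally show ?thesis .
qed

lemma brownian_abs_odd_moment_le:
  assumes B: "brownian_motion M B" and t: "t \<in> {0..1}"
  shows "(\<integral>\<^sup>+w. ennreal (\<bar>B t w\<bar> ^ (2 * r + 1)) \<partial>M) \<le> ennreal (abs_moment r)"
proof -
  have "sqrt t ^ (2 * r + 1) * abs_moment r \<le> 1 * abs_moment r"
    using t by (intro mult_right_mono power_le_one abs_moment_nonneg) auto
  then show ?thesis using brownian_abs_odd_moment[OF B, of t r] t by (auto intro: ennreal_leI)
qed

lemma bridge_odd_moment_le:
  assumes B: "brownian_motion M B" and t: "t \<in> {0..1}"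
  shows "(\<integral>\<^sup>+w. ennreal (\<bar>B t w - t * B 1 w\<bar> ^ (2 * r + 1)) \<partial>M) \<le> ennreal (4 ^ r * (abs_moment r + abs_moment r))"
proof (rule sum_odd_moment_le[where Y = "B t" and Z = "B 1"])
  show "0 \<le> \<bar>B t w - t * B 1 w\<bar> \<and> \<bar>B t w - t * B 1 w\<bar> \<le> \<bar>B t w\<bar> + \<bar>B 1 w\<bar>" for w
  proof -
    have "\<bar>t * B 1 w\<bar> \<le> 1 * \<bar>B 1 w\<bar>" unfolding abs_mult using t by (intro mult_right_mono) auto
    then show ?thesis by linarith
  qed
  show "B t \<in> borel_measurable M" "B 1 \<in> borel_measurable M"
    using t by (auto intro!: brownian_motionD(2)[OF B])
  show "(\<integral>\<^sup>+w. ennreal (\<bar>B t w\<bar> ^ (2 * r + 1)) \<partial>M) \<le> ennreal (abs_moment r)"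
    "(\<integral>\<^sup>+w. ennreal (\<bar>B 1 w\<bar> ^ (2 * r + 1)) \<partial>M) \<le> ennreal (abs_moment r)"
    using t by (intro brownian_abs_odd_moment_le[OF B]; simp)+
qed (rule abs_moment_nonneg)+

lemma brownian_continuous_process: "brownian_motion M B \<Longrightarrow> continuous_process M B"
  by (simp add: brownian_motion_def)

lemma bridge_continuous_process:
  assumes B: "brownian_motion M B"
  shows "continuous_process M (\<lambda>t w. B t w - t * B 1 w)"
proof -
  have [measurable]: "B t \<in> borel_measurable M" if "t \<in> {0..1}" for t using brownian_motionD(2)[OF B that] .
  show ?thesis unfolding continuous_process_def
    using brownian_motionD(1,3)[OF B] by (auto intro!: continuous_intros)
qed

lemma bounded_path:
  assumes "brownian_motion M B" "w \<in> space M"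
  shows "bdd_below ((\<lambda>u. B u w) ` {0..1})"
  using brownian_motionD(3)[OF assms]
  by (intro bounded_imp_bdd_below compact_imp_bounded compact_continuous_image) auto

lemma le_minimum_iff:
  assumes "brownian_motion M B" "w \<in> space M"
  shows "a \<le> (INF u\<in>{0..1}. B u w) \<longleftrightarrow> w \<in> stay_above M B (- a)"
  using assms by (subst le_cINF_iff) (auto simp: bounded_path stay_above_def)

lemma minimum_measurable:
  assumes B: "brownian_motion M B"
  shows "(\<lambda>w. INF u\<in>{0..1}. B u w) \<in> borel_measurable M"
  unfolding borel_measurable_iff_ge
proof
  fix a
  have "{w\<in>space M. a \<le> (INF u\<in>{0..1}. B u w)} = stay_above M B (- a)"
    using le_minimum_iff[OF B] by (auto simp: stay_above_def)
  then show "{w\<in>space M. a \<le> (INF u\<in>{0..1}. B u w)} \<in> sets M"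
    using stay_above_measurable[OF B] by simp
qed

lemma minimum_nonpos:
  assumes B: "brownian_motion M B" and w: "w \<in> space M"
  shows "(INF u\<in>{0..1}. B u w) \<le> 0"
  using cINF_lower[OF bounded_path[OF B w], of 0] brownian_motionD(4)[OF B w] by simp

text \<open>Every power \<open>y ^ k\<close> is at most this sum of indicators of \<open>y > j\<close>, which in turn is at most \<open>(y + 1) ^ k\<close>. So a
comparison of tail probabilities at integers carries over to moments.\<close>

lemma ceiling_power_layers:
  fixes y :: real
  assumes "0 \<le> y" and k: "0 < k"
  shows "(\<Sum>j. ennreal (real (Suc j) ^ k - real j ^ k) * (if real j < y then 1 else 0)) = ennreal (of_int \<lceil>y\<rceil> ^ k)"
proof -
  define N where "N = nat \<lceil>y\<rceil>"
  have N: "real N = of_int \<lceil>y\<rceil>" using assms by (simp add: N_def)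
  have lt: "real j < y \<longleftrightarrow> j < N" for j
    using assms unfolding N_def by (metis less_ceiling_iff nat_less_iff of_int_of_nat_eq zless_nat_eq_int_zless)
  have "(\<Sum>j. ennreal (real (Suc j) ^ k - real j ^ k) * (if real j < y then 1 else 0))
      = (\<Sum>j<N. ennreal (real (Suc j) ^ k - real j ^ k) * (if real j < y then 1 else 0))"
    by (intro suminf_finite) (auto simp: lt)
  also have "\<dots> = (\<Sum>j<N. ennreal (real (Suc j) ^ k - real j ^ k))"
    by (intro sum.cong) (auto simp: lt)
  also have "\<dots> = ennreal (\<Sum>j<N. real (Suc j) ^ k - real j ^ k)"
    by (intro sum_ennreal) (auto intro!: power_mono)
  also have "(\<Sum>j<N. real (Suc j) ^ k - real j ^ k) = real N ^ k"
    using telescope[of "\<lambda>x. real x ^ k" "\<lambda>j. j" N] k by (simp add: zero_power)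
  finally show ?thesis by (simp add: N)
qed

text \<open>By Levy's inequality the tail of \<open>- min B\<close> is at most twice the tail of \<open>\<bar>B 1\<bar>\<close>.\<close>

lemma minimum_odd_moment_finite:
  assumes B: "brownian_motion M B"
  shows "\<exists>C\<ge>0. (\<integral>\<^sup>+w. ennreal (\<bar>INF u\<in>{0..1}. B u w\<bar> ^ (2 * r + 1)) \<partial>M) \<le> ennreal C"
proof -
  interpret prob_space M using brownian_motionD(1)[OF B] .
  define m where "m w = - (INF u\<in>{0..1}. B u w)" for w
  define k where "k = 2 * r + 1"
  define c where "c j = ennreal (real (Suc j) ^ k - real j ^ k)" for j
  have k: "0 < k" by (simp add: k_def)
  have [measurable]: "m \<in> borel_measurable M" "B 1 \<in> borel_measurable M"
    using minimum_measurable[OF B] brownian_motionD(2)[OF B] by (auto simp: m_def[abs_def])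
  have m0: "0 \<le> m w" if "w \<in> space M" for w using minimum_nonpos[OF B that] by (simp add: m_def)
  have tail: "(\<integral>\<^sup>+w. (if real j < m w then 1 else 0) \<partial>M) \<le> 2 * (\<integral>\<^sup>+w. (if real j < \<bar>B 1 w\<bar> then 1 else 0) \<partial>M)" for j
  proof -
    have "real j < m w \<longleftrightarrow> \<not> - real j \<le> (INF u\<in>{0..1}. B u w)" for w
      unfolding m_def by linarith
    then have "{w\<in>space M. real j < m w} = space M - stay_above M B (real j)"
      using le_minimum_iff[OF B, of _ "- real j"] by auto
    then have "prob {w\<in>space M. real j < m w} \<le> 2 * prob {w\<in>space M. B 1 w < - real j}"
      using levy_inequality[OF B] by simp
    also have "\<dots> \<le> 2 * prob {w\<in>space M. real j < \<bar>B 1 w\<bar>}"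
      by (intro mult_left_mono finite_measure_mono) auto
    finally have *: "ennreal (prob {w\<in>space M. real j < m w}) \<le> ennreal (2 * prob {w\<in>space M. real j < \<bar>B 1 w\<bar>})"
      by (rule ennreal_leI)
    have ind: "(\<integral>\<^sup>+w. (if P w then 1 else 0) \<partial>M) = ennreal (prob {w\<in>space M. P w})"
      if "{w\<in>space M. P w} \<in> sets M" for P
    proof -
      have "(\<integral>\<^sup>+w. (if P w then 1 else 0) \<partial>M) = (\<integral>\<^sup>+w. indicator {w\<in>space M. P w} w \<partial>M)"
        by (intro nn_integral_cong) (auto simp: indicator_def)
      then show ?thesis using that by (simp add: emeasure_eq_measure)
    qed
    show ?thesis using * by (simp add: ind ennreal_mult)
  qed
  have "(\<integral>\<^sup>+w. ennreal (m w ^ k) \<partial>M) \<le> (\<integral>\<^sup>+w. (\<Sum>j. c j * (if real j < m w then 1 else 0)) \<partial>M)"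
  proof (rule nn_integral_mono)
    fix w assume "w \<in> space M"
    then show "ennreal (m w ^ k) \<le> (\<Sum>j. c j * (if real j < m w then 1 else 0))"
      unfolding c_def by (subst ceiling_power_layers) (auto intro!: ennreal_leI power_mono m0 k)
  qed
  also have "\<dots> = (\<Sum>j. c j * (\<integral>\<^sup>+w. (if real j < m w then 1 else 0) \<partial>M))"
    by (subst nn_integral_suminf) (auto simp: nn_integral_cmult)
  also have "\<dots> \<le> (\<Sum>j. 2 * (c j * (\<integral>\<^sup>+w. (if real j < \<bar>B 1 w\<bar> then 1 else 0) \<partial>M)))"
    using mult_left_mono[OF tail] by (intro suminf_le) (auto simp: mult.left_commute)
  also have "\<dots> = 2 * (\<integral>\<^sup>+w. (\<Sum>j. c j * (if real j < \<bar>B 1 w\<bar> then 1 else 0)) \<partial>M)"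
    by (subst nn_integral_suminf) (auto simp: nn_integral_cmult)
  also have "\<dots> \<le> 2 * (\<integral>\<^sup>+w. ennreal ((\<bar>B 1 w\<bar> + 1) ^ k) \<partial>M)"
  proof (intro mult_left_mono nn_integral_mono)
    fix w
    have "real_of_int \<lceil>\<bar>B 1 w\<bar>\<rceil> \<le> \<bar>B 1 w\<bar> + 1" by linarith
    then show "(\<Sum>j. c j * (if real j < \<bar>B 1 w\<bar> then 1 else 0)) \<le> ennreal ((\<bar>B 1 w\<bar> + 1) ^ k)"
      unfolding c_def by (subst ceiling_power_layers) (auto intro!: ennreal_leI power_mono k)
  qed simp
  also have "(\<integral>\<^sup>+w. ennreal ((\<bar>B 1 w\<bar> + 1) ^ k) \<partial>M) \<le> ennreal (4 ^ r * (abs_moment r + 1))"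
    unfolding k_def
    by (rule sum_odd_moment_le[where Y = "B 1" and Z = "\<lambda>_. 1"])
      (use brownian_abs_odd_moment_le[OF B, of 1 r] in \<open>auto simp: emeasure_space_1 abs_moment_nonneg simp del: power_Suc\<close>)
  finally have "(\<integral>\<^sup>+w. ennreal (m w ^ k) \<partial>M) \<le> 2 * ennreal (4 ^ r * (abs_moment r + 1))"
    by (simp add: mult_left_mono)
  also have "\<dots> = ennreal (2 * (4 ^ r * (abs_moment r + 1)))"
    by (simp add: ennreal_mult' abs_moment_nonneg)
  finally have "(\<integral>\<^sup>+w. ennreal (m w ^ k) \<partial>M) \<le> ennreal (2 * (4 ^ r * (abs_moment r + 1)))" .
  moreover have "(\<integral>\<^sup>+w. ennreal (\<bar>INF u\<in>{0..1}. B u w\<bar> ^ (2 * r + 1)) \<partial>M) = (\<integral>\<^sup>+w. ennreal (m w ^ k) \<partial>M)"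
    using m0 unfolding k_def m_def by (intro nn_integral_cong) (simp del: power_Suc)
  ultimately show ?thesis
    by (intro exI[of _ "2 * (4 ^ r * (abs_moment r + 1))"]) (simp add: abs_moment_nonneg)
qed

section \<open>Excursion and double meander\<close>

lemma excursion_area_moments:
  assumes E: "brownian_excursion M E" and X: "X = path_integral E"
  shows "entire_moments M X"
proof -
  obtain b where b: "brownian_bridge_3d M b" and Eb: "E = (\<lambda>t w. norm (b t w))"
    using E by (auto simp: brownian_excursion_def)
  have "\<forall>i. \<exists>B. brownian_motion M B \<and> (\<lambda>t w. b t w $ i) = (\<lambda>t w. B t w - t * B 1 w)"
    using b by (auto simp: brownian_bridge_3d_def brownian_bridge_def)
  then obtain B where B: "\<And>i. brownian_motion M (B i)" and bB': "\<And>i. (\<lambda>t w. b t w $ i) = (\<lambda>t w. B i t w - t * B i 1 w)"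
    by metis
  have bB: "b t w $ i = B i t w - t * B i 1 w" for t w i using fun_cong[OF fun_cong[OF bB'[of i], of t], of w] .
  have comp: "continuous_process M (\<lambda>t w. b t w $ i)" for i
    unfolding bB by (rule bridge_continuous_process[OF B])
  have cm: "(\<lambda>w. b t w $ i) \<in> borel_measurable M" if "t \<in> {0..1}" for t i
    using comp[of i] that unfolding continuous_process_def by blast
  have nrm: "norm (b t w) = sqrt (\<Sum>i\<in>UNIV. (b t w $ i)\<^sup>2)" for t w
    by (simp add: norm_vec_def L2_set_def)
  have cont: "continuous_process M E"
    unfolding continuous_process_def Eb nrm
  proof (intro conjI ballI)
    show "prob_space M" using brownian_motionD(1)[OF B] .
    show "(\<lambda>w. sqrt (\<Sum>i\<in>UNIV. (b t w $ i)\<^sup>2)) \<in> borel_measurable M" if "t \<in> {0..1}" for t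
      using cm[OF that] by (intro borel_measurable_sqrt[THEN measurable_compose[rotated]] borel_measurable_sum borel_measurable_power) 
    show "continuous_on {0..1} (\<lambda>t. sqrt (\<Sum>i\<in>UNIV. (b t w $ i)\<^sup>2))" if "w \<in> space M" for w
    proof -
      have "continuous_on {0..1} (\<lambda>t. b t w $ i)" for i
        using comp that unfolding continuous_process_def by blast
      then show ?thesis
        by (intro continuous_on_real_sqrt continuous_on_sum continuous_on_power)
    qed
  qed
  show ?thesis
  proof (rule path_integral_moments_entire[OF B cont _ _ X])
    show "\<bar>B 1 t w - 0 - B 1 1 w * t\<bar> \<le> E t w" for t w
      using component_le_norm_cart[of "b t w" 1] by (simp add: Eb bB mult.commute)
    show "\<exists>C. \<forall>t\<in>{0..1}. (\<integral>\<^sup>+w. ennreal (E t w ^ (2 * r + 1)) \<partial>M) \<le> ennreal C" for r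
    proof (intro exI ballI)
      fix t :: real assume t: "t \<in> {0..1}"
      let ?c = "4 ^ r * (abs_moment r + abs_moment r)"
      have c0: "0 \<le> ?c" using abs_moment_nonneg[of r] by simp
      have m: "(\<integral>\<^sup>+w. ennreal (\<bar>b t w $ i\<bar> ^ (2 * r + 1)) \<partial>M) \<le> ennreal ?c" for i
        unfolding bB by (rule bridge_odd_moment_le[OF B t])
      have m12: "(\<integral>\<^sup>+w. ennreal ((\<bar>b t w $ 1\<bar> + \<bar>b t w $ 2\<bar>) ^ (2 * r + 1)) \<partial>M) \<le> ennreal (4 ^ r * (?c + ?c))"
        by (rule sum_odd_moment_le[OF cm[OF t] cm[OF t] _ m m c0 c0]) auto
      show "(\<integral>\<^sup>+w. ennreal (E t w ^ (2 * r + 1)) \<partial>M) \<le> ennreal (4 ^ r * (4 ^ r * (?c + ?c) + ?c))"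
      proof (rule sum_odd_moment_le[where Y = "\<lambda>w. \<bar>b t w $ 1\<bar> + \<bar>b t w $ 2\<bar>" and Z = "\<lambda>w. b t w $ 3"])
        show "0 \<le> E t w \<and> E t w \<le> \<bar>\<bar>b t w $ 1\<bar> + \<bar>b t w $ 2\<bar>\<bar> + \<bar>b t w $ 3\<bar>" for w
          using norm_le_l1_cart[of "b t w"] by (simp add: Eb sum_3)
        show "(\<integral>\<^sup>+w. ennreal (\<bar>\<bar>b t w $ 1\<bar> + \<bar>b t w $ 2\<bar>\<bar> ^ (2 * r + 1)) \<partial>M) \<le> ennreal (4 ^ r * (?c + ?c))"
          using m12 by (simp del: power_Suc)
      qed (use cm[OF t] c0 m in auto)
    qed
  qed
qed

lemma double_meander_area_moments:
  assumes D: "brownian_double_meander M D" and X: "X = path_integral D"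
  shows "entire_moments M X"
proof -
  obtain B where B: "brownian_motion M B" and DB: "D = (\<lambda>t w. B t w - (INF u\<in>{0..1}. B u w))"
    using D by (auto simp: brownian_double_meander_def)
  have D0: "0 \<le> D t w" if "t \<in> {0..1}" "w \<in> space M" for t w
    using cINF_lower[OF bounded_path[OF B that(2)] that(1)] by (simp add: DB)
  have cont: "continuous_process M D"
    unfolding continuous_process_def DB
    using brownian_motionD(1-3)[OF B] minimum_measurable[OF B] by (auto intro!: continuous_intros borel_measurable_diff)
  show ?thesis
  proof (rule path_integral_moments_entire[OF B cont _ _ X])
    show "\<bar>B t w - (INF u\<in>{0..1}. B u w) - 0 * t\<bar> \<le> D t w" if "t \<in> {0..1}" "w \<in> space M" for t w
      using D0[OF that] by (simp add: DB)
    show "\<exists>C. \<forall>t\<in>{0..1}. (\<integral>\<^sup>+w. ennreal (D t w ^ (2 * r + 1)) \<partial>M) \<le> ennreal C" for r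
    proof -
      obtain C where C: "0 \<le> C" "(\<integral>\<^sup>+w. ennreal (\<bar>INF u\<in>{0..1}. B u w\<bar> ^ (2 * r + 1)) \<partial>M) \<le> ennreal C"
        using minimum_odd_moment_finite[OF B] by blast
      have "(\<integral>\<^sup>+w. ennreal (D t w ^ (2 * r + 1)) \<partial>M) \<le> ennreal (4 ^ r * (abs_moment r + C))" if t: "t \<in> {0..1}" for t
      proof (rule sum_odd_moment_le[where Y = "B t"])
        show "0 \<le> D t w \<and> D t w \<le> \<bar>B t w\<bar> + \<bar>INF u\<in>{0..1}. B u w\<bar>" if "w \<in> space M" for w
          using D0[OF t that] by (simp add: DB)
      qed (rule brownian_motionD(2)[OF B t] minimum_measurable[OF B] brownian_abs_odd_moment_le[OF B t] C abs_moment_nonneg)+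
      then show ?thesis by blast
    qed
  qed
qed

section \<open>The meander\<close>

text \<open>The integral is a Lipschitz function of the path with respect to the supremum metric. Therefore bounded
continuous functions of the area are among the test functions of the weak limit.\<close>

lemma path_functional_continuous:
  assumes \<phi>: "continuous_on UNIV (\<phi> :: real \<Rightarrow> real)"
  shows "continuous_map (mtopology_of C01) euclideanreal (\<lambda>f. \<phi> (LBINT t:{0..1}. f t))"
proof -
  have sp: "continuous_on {0..1} f" if "f \<in> mspace C01" for f
    using that unfolding C01_def by simp
  have "Lipschitz_continuous_map C01 euclidean_metric (\<lambda>f. LBINT t:{0..1}. f t)"
    unfolding Lipschitz_continuous_map_def
  proof (intro conjI exI ballI)
    fix f g assume fg: "f \<in> mspace C01" "g \<in> mspace C01"
    have pw: "\<bar>f t - g t\<bar> \<le> mdist C01 f g" if "t \<in> {0..1}" for t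
    proof -
      have "mdist euclidean_metric (f t) (g t) \<le> mdist C01 f g"
        unfolding C01_def
        using mdist_cfunspace_imp_mdist_le[OF fg[unfolded C01_def] order_refl, of t] that by (simp only: topspace_euclidean_subtopology)
      then show ?thesis by (simp add: dist_real_def)
    qed
    have i: "set_integrable lborel {0..1::real} f" "set_integrable lborel {0..1::real} g"
      using sp fg by (auto intro: set_integrable_unit_interval)
    have ic: "set_integrable lborel {0..1::real} (\<lambda>_. c :: real)" for c
      by (intro set_integrable_unit_interval continuous_intros)
    have const: "(LBINT t:{0..1::real}. c) = c" for c :: real
      by (simp add: set_lebesgue_integral_def)
    have "(LBINT t:{0..1}. f t) \<le> (LBINT t:{0..1}. g t + mdist C01 f g)"
    proof (rule set_integral_mono[OF i(1) set_integral_add(1)[OF i(2) ic]])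
      show "f t \<le> g t + mdist C01 f g" if "t \<in> {0..1}" for t using pw[OF that] by linarith
    qed
    moreover have "(LBINT t:{0..1}. g t) \<le> (LBINT t:{0..1}. f t + mdist C01 f g)"
    proof (rule set_integral_mono[OF i(2) set_integral_add(1)[OF i(1) ic]])
      show "g t \<le> f t + mdist C01 f g" if "t \<in> {0..1}" for t using pw[OF that] by linarith
    qed
    ultimately have "\<bar>(LBINT t:{0..1}. f t) - (LBINT t:{0..1}. g t)\<bar> \<le> mdist C01 f g"
      using i ic by (simp add: set_integral_add(2) const abs_le_iff)
    then show "mdist euclidean_metric (LBINT t:{0..1}. f t) (LBINT t:{0..1}. g t) \<le> 1 * mdist C01 f g"
      by (simp add: dist_real_def)
  qed simp
  then have "continuous_map (mtopology_of C01) euclideanreal (\<lambda>f. LBINT t:{0..1}. f t)"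
    using Lipschitz_continuous_imp_continuous_map by fastforce
  moreover have "continuous_map euclideanreal euclideanreal \<phi>" using \<phi> by simp
  ultimately have "continuous_map (mtopology_of C01) euclideanreal (\<phi> \<circ> (\<lambda>f. LBINT t:{0..1}. f t))"
    by (rule continuous_map_compose)
  then show ?thesis by (simp only: comp_def)
qed

lemma path_integral_sample_path: "(LBINT t:{0..1}. sample_path Y w t) = path_integral Y w"
  unfolding path_integral_def sample_path_def by (intro set_lebesgue_integral_cong) auto

lemma conditioned_limit:
  assumes lim: "conditioned_nonneg N B M Y"
    and \<phi>: "continuous_on UNIV (\<phi> :: real \<Rightarrow> real)" "\<And>x. \<bar>\<phi> x\<bar> \<le> L"
  shows "((\<lambda>\<epsilon>. LINT w|uniform_measure N (stay_above N B \<epsilon>). \<phi> (path_integral B w))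
      \<longlongrightarrow> (LINT w|M. \<phi> (path_integral Y w))) (at_right 0)"
proof -
  have bdd: "bounded ((\<lambda>f. \<phi> (LBINT t:{0..1}. f t)) ` mspace C01)"
    using \<phi>(2) by (auto simp: bounded_iff)
  from lim[unfolded conditioned_nonneg_def, rule_format, OF conjI[OF path_functional_continuous[OF \<phi>(1)] bdd]]
  show ?thesis unfolding stay_above_def path_integral_sample_path .
qed

text \<open>The conditional expectations in the weak limit are integrals over \<open>stay_above N B \<epsilon>\<close> divided by its
probability, so an estimate in terms of this probability bounds the limit.\<close>

lemma meander_functional_le:
  assumes B: "brownian_motion N B" and Y: "continuous_process M Y" and lim: "conditioned_nonneg N B M Y"
    and \<phi>: "continuous_on UNIV (\<phi> :: real \<Rightarrow> real)" "\<And>x. 0 \<le> \<phi> x" "\<And>x. \<phi> x \<le> L"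
    and C: "0 \<le> C" and e0: "0 < \<epsilon>\<^sub>0" "\<epsilon>\<^sub>0 \<le> 1"
    and le: "\<And>\<epsilon>. 0 < \<epsilon> \<Longrightarrow> \<epsilon> < \<epsilon>\<^sub>0 \<Longrightarrow>
      (\<integral>\<^sup>+w. indicator (stay_above N B \<epsilon>) w * ennreal (\<phi> (path_integral B w)) \<partial>N) \<le> ennreal C * emeasure N (stay_above N B \<epsilon>)"
  shows "(\<integral>\<^sup>+w. ennreal (\<phi> (path_integral Y w)) \<partial>M) \<le> ennreal C"
proof -
  interpret N: prob_space N using brownian_motionD(1)[OF B] .
  interpret prob_space M using Y by (simp add: continuous_process_def)
  have [measurable]: "\<phi> \<in> borel_measurable borel" using \<phi>(1) by (rule borel_measurable_continuous_onI)
  have [measurable]: "path_integral B \<in> borel_measurable N"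
    by (rule path_integral_measurable[OF brownian_continuous_process[OF B]])
  have [measurable]: "path_integral Y \<in> borel_measurable M" by (rule path_integral_measurable[OF Y])
  have [measurable]: "stay_above N B \<epsilon> \<in> sets N" for \<epsilon> by (rule stay_above_measurable[OF B])
  have bd: "\<bar>\<phi> x\<bar> \<le> L" for x using \<phi>(2,3)[of x] by simp
  have "(LINT w|M. \<phi> (path_integral Y w)) \<le> C"
  proof (rule tendsto_upperbound[OF conditioned_limit[OF lim \<phi>(1) bd]])
    have "LINT w|uniform_measure N (stay_above N B \<epsilon>). \<phi> (path_integral B w) \<le> C" if e: "0 < \<epsilon>" "\<epsilon> < \<epsilon>\<^sub>0" for \<epsilon>
    proof -
      have "0 < exp (-1) / 3 * \<epsilon>" using e by simp
      also have "\<dots> \<le> N.prob (stay_above N B \<epsilon>)" using e e0 by (intro stay_above_prob_ge[OF B]) auto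
      finally have pos: "0 < N.prob (stay_above N B \<epsilon>)" .
      have "(\<integral>\<^sup>+w. ennreal (\<phi> (path_integral B w)) \<partial>uniform_measure N (stay_above N B \<epsilon>))
          = (\<integral>\<^sup>+w. ennreal (\<phi> (path_integral B w)) * indicator (stay_above N B \<epsilon>) w \<partial>N) / emeasure N (stay_above N B \<epsilon>)"
        by (intro nn_integral_uniform_measure) auto
      also have "\<dots> \<le> (ennreal C * emeasure N (stay_above N B \<epsilon>)) / emeasure N (stay_above N B \<epsilon>)"
        using le[OF e] by (intro divide_right_mono_ennreal) (simp add: mult.commute)
      also have "\<dots> = ennreal C"
        using pos C by (simp add: N.emeasure_eq_measure divide_ennreal flip: ennreal_mult)
      finally have *: "(\<integral>\<^sup>+w. ennreal (\<phi> (path_integral B w)) \<partial>uniform_measure N (stay_above N B \<epsilon>)) \<le> ennreal C" .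
      have "LINT w|uniform_measure N (stay_above N B \<epsilon>). \<phi> (path_integral B w)
          = enn2real (\<integral>\<^sup>+w. ennreal (\<phi> (path_integral B w)) \<partial>uniform_measure N (stay_above N B \<epsilon>))"
        using \<phi>(2) by (intro integral_eq_nn_integral) auto
      also have "\<dots> \<le> C" using * C by (simp add: enn2real_leI)
      finally show ?thesis .
    qed
    then show "\<forall>\<^sub>F \<epsilon> in at_right 0. LINT w|uniform_measure N (stay_above N B \<epsilon>). \<phi> (path_integral B w) \<le> C"
      using e0 by (auto simp: eventually_at_right_field intro!: exI[of _ "\<epsilon>\<^sub>0"])
  qed simp
  moreover have "integrable M (\<lambda>w. \<phi> (path_integral Y w))"
    using bd by (intro integrable_const_bound[where B = L]) auto
  ultimately show ?thesis
    using \<phi>(2) by (subst nn_integral_eq_integral) (auto intro: ennreal_leI)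
qed

text \<open>Three families of test functions are used: \<open>min 1 (max 0 (- x))\<close> shows that the area is nonnegative,
\<open>(max 0 x + \<delta>)^(-k)\<close> bounds the negative moments, and \<open>\<bar>x\<bar> ^ (2 * r + 1)\<close> cut off at \<open>n\<close> bounds the positive
moments. On the event that the path stays above \<open>- \<epsilon>\<close>, the area plus \<open>\<epsilon>\<close> is the integral of
\<open>\<bar>B t - (- \<epsilon>)\<bar>\<close>, to which \<open>negative_moment_bound\<close> applies.\<close>

lemma meander_area_moments:
  assumes Y: "brownian_meander M Y" and X: "X = path_integral Y"
  shows "entire_moments M X"
proof -
  obtain N :: "(real \<Rightarrow> real) measure" and B where cY: "continuous_process M Y"
    and B: "brownian_motion N B" and lim: "conditioned_nonneg N B M Y"
    using Y by (auto simp: brownian_meander_def)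
  interpret N: prob_space N using brownian_motionD(1)[OF B] .
  interpret prob_space M using cY by (simp add: continuous_process_def)
  note func = meander_functional_le[OF B cY lim]
  let ?S = "stay_above N B"
  have [measurable]: "path_integral Y \<in> borel_measurable M" by (rule path_integral_measurable[OF cY])
  have [measurable]: "path_integral B \<in> borel_measurable N"
    by (rule path_integral_measurable[OF brownian_continuous_process[OF B]])
  have [measurable]: "?S \<epsilon> \<in> sets N" for \<epsilon> by (rule stay_above_measurable[OF B])
  have S_le: "ennreal \<epsilon> \<le> ennreal (3 * exp 1) * emeasure N (?S \<epsilon>)" if "0 < \<epsilon>" "\<epsilon> < 1" for \<epsilon>
  proof -
    have "\<epsilon> = (3 * exp 1) * (exp (-1) / 3 * \<epsilon>)" by (simp add: exp_minus)
    also have "\<dots> \<le> (3 * exp 1) * N.prob (?S \<epsilon>)"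
      using that by (intro mult_left_mono stay_above_prob_ge[OF B]) auto
    finally have "ennreal \<epsilon> \<le> ennreal (3 * exp 1 * N.prob (?S \<epsilon>))" by (rule ennreal_leI)
    then show ?thesis by (simp add: N.emeasure_eq_measure ennreal_mult)
  qed
  have ge: "- \<epsilon> \<le> path_integral B w" if "w \<in> ?S \<epsilon>" for \<epsilon> w
  proof -
    have "path_integral (\<lambda>_ _. - \<epsilon>) w \<le> path_integral B w"
      using that brownian_motionD(3)[OF B] by (intro path_integral_mono) (auto simp: stay_above_def)
    then show ?thesis by (simp add: path_integral_def set_lebesgue_integral_def)
  qed
  have nonneg: "AE w in M. 0 \<le> path_integral Y w"
  proof -
    define \<phi> where "\<phi> x = min 1 (max 0 (- x))" for x :: real
    have "(\<integral>\<^sup>+w. ennreal (\<phi> (path_integral Y w)) \<partial>M) \<le> ennreal \<eta>" if "0 < \<eta>" "\<eta> < 1" for \<eta>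
    proof (rule func[where L = 1 and \<epsilon>\<^sub>0 = \<eta>])
      show "continuous_on UNIV \<phi>" unfolding \<phi>_def by (intro continuous_intros)
      fix \<epsilon> assume e: "0 < \<epsilon>" "\<epsilon> < \<eta>"
      have "(\<integral>\<^sup>+w. indicator (?S \<epsilon>) w * ennreal (\<phi> (path_integral B w)) \<partial>N) \<le> (\<integral>\<^sup>+w. ennreal \<eta> * indicator (?S \<epsilon>) w \<partial>N)"
      proof (rule nn_integral_mono)
        fix w
        show "indicator (?S \<epsilon>) w * ennreal (\<phi> (path_integral B w)) \<le> ennreal \<eta> * indicator (?S \<epsilon>) w"
          using ge[of w \<epsilon>] e by (cases "w \<in> ?S \<epsilon>") (auto simp: \<phi>_def intro!: ennreal_leI)
      qed
      also have "\<dots> = ennreal \<eta> * emeasure N (?S \<epsilon>)" by (rule nn_integral_cmult_indicator) simp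
      finally show "(\<integral>\<^sup>+w. indicator (?S \<epsilon>) w * ennreal (\<phi> (path_integral B w)) \<partial>N) \<le> ennreal \<eta> * emeasure N (?S \<epsilon>)" .
    qed (use that in \<open>auto simp: \<phi>_def\<close>)
    then have "(\<integral>\<^sup>+w. ennreal (\<phi> (path_integral Y w)) \<partial>M) \<le> 0 + ennreal (1 / (real n + 2))" for n
      by simp
    then have "(\<integral>\<^sup>+w. ennreal (\<phi> (path_integral Y w)) \<partial>M) \<le> 0"
    proof -
      assume *: "\<And>n. (\<integral>\<^sup>+w. ennreal (\<phi> (path_integral Y w)) \<partial>M) \<le> 0 + ennreal (1 / (real n + 2))"
      have "(\<lambda>n. 1 / (real n + 2)) \<longlonglongrightarrow> 0" by real_asymp
      then have "(\<lambda>n. ennreal (1 / (real n + 2))) \<longlonglongrightarrow> ennreal 0" by (intro tendsto_ennrealI)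
      then show ?thesis using * by (intro LIMSEQ_le_const[where X = "\<lambda>n. ennreal (1 / (real n + 2))"]) auto
    qed
    then have "AE w in M. ennreal (\<phi> (path_integral Y w)) = 0"
      by (subst (asm) le_zero_eq, subst (asm) nn_integral_0_iff_AE) (auto simp: \<phi>_def)
    then show ?thesis by eventually_elim (auto simp: \<phi>_def min_def max_def split: if_splits)
  qed
  show ?thesis unfolding X
  proof (rule entire_from_moment_bounds[OF prob_space_axioms _ nonneg])
    show "\<exists>K. \<forall>\<delta>. 0 < \<delta> \<and> \<delta> < 1 \<longrightarrow> (\<integral>\<^sup>+w. ennreal ((1 / (path_integral Y w + \<delta>)) ^ k) \<partial>M) \<le> ennreal K" for k
    proof (intro exI allI impI)
      fix \<delta> :: real assume d: "0 < \<delta> \<and> \<delta> < 1"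
      define \<phi> where "\<phi> x = (1 / (max 0 x + \<delta>)) ^ k" for x
      define C where "C = 3 * exp 1 * (6 * exp 2 / sqrt (1/2)) * negative_moment_const k"
      have nc: "0 \<le> negative_moment_const k" using mesh_pos[of k] by (simp add: negative_moment_const_def)
      have "(\<integral>\<^sup>+w. ennreal (\<phi> (path_integral Y w)) \<partial>M) \<le> ennreal C"
      \<comment> \<open>for \<open>\<epsilon> < \<delta> / 2\<close>, half of \<open>\<delta>\<close> pays for the difference \<open>\<epsilon>\<close> between the area and the integral of \<open>B t + \<epsilon>\<close>\<close>
      proof (rule func[where L = "(1 / \<delta>) ^ k" and \<epsilon>\<^sub>0 = "\<delta> / 2"])
        show "continuous_on UNIV \<phi>"
          unfolding \<phi>_def using d by (intro continuous_intros) (auto simp: max_def)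
        show "\<phi> x \<le> (1 / \<delta>) ^ k" for x
          unfolding \<phi>_def using d by (intro power_mono divide_left_mono mult_pos_pos) (auto simp: max_def)
        fix \<epsilon> assume e: "0 < \<epsilon>" "\<epsilon> < \<delta> / 2"
        obtain q where q: "N.prob (grid_event N B (1/2) q \<epsilon>) \<le> 6 * exp 2 * \<epsilon> / sqrt (1/2)"
          using persistence_prob_le[OF B, of "1/2" \<epsilon>] e by auto
        let ?G = "grid_event N B (1/2) q \<epsilon>"
        have SG: "?S \<epsilon> \<subseteq> ?G" by (intro stay_above_subset_grid_event) auto
        have "(\<integral>\<^sup>+w. indicator (?S \<epsilon>) w * ennreal (\<phi> (path_integral B w)) \<partial>N)
          \<le> (\<integral>\<^sup>+w. indicator ?G w * ennreal ((1 / ((LBINT t:{0..1}. \<bar>B t w - (- \<epsilon>) - 0 * t\<bar>) + \<delta> / 2)) ^ k) \<partial>N)"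
        proof (rule nn_integral_mono)
          fix w assume w: "w \<in> space N"
          show "indicator (?S \<epsilon>) w * ennreal (\<phi> (path_integral B w))
            \<le> indicator ?G w * ennreal ((1 / ((LBINT t:{0..1}. \<bar>B t w - (- \<epsilon>) - 0 * t\<bar>) + \<delta> / 2)) ^ k)"
          proof (cases "w \<in> ?S \<epsilon>")
            case True
            have "(LBINT t:{0..1}. \<bar>B t w - (- \<epsilon>) - 0 * t\<bar>) = (LBINT t:{0..1}. B t w + \<epsilon>)"
            proof (intro set_lebesgue_integral_cong allI impI)
              fix t :: real assume "t \<in> {0..1}"
              then have "- \<epsilon> \<le> B t w" using True by (simp add: stay_above_def)
              then show "\<bar>B t w - (- \<epsilon>) - 0 * t\<bar> = B t w + \<epsilon>" by simp
            qed simp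
            also have "\<dots> = path_integral B w + \<epsilon>"
              using set_integrable_unit_interval[OF brownian_motionD(3)[OF B w]] set_integrable_unit_interval[of "\<lambda>_. \<epsilon>"]
              by (subst set_integral_add(2)) (auto simp: path_integral_def set_lebesgue_integral_def)
            finally have L: "(LBINT t:{0..1}. \<bar>B t w - (- \<epsilon>) - 0 * t\<bar>) = path_integral B w + \<epsilon>" .
            have "\<phi> (path_integral B w) \<le> (1 / ((path_integral B w + \<epsilon>) + \<delta> / 2)) ^ k"
              unfolding \<phi>_def using ge[OF True] d e
              by (intro power_mono divide_left_mono mult_pos_pos) (auto simp: max_def)
            then show ?thesis using True SG unfolding L by (auto intro!: ennreal_leI)
          qed simp
        qed
        also have "\<dots> \<le> emeasure N ?G * ennreal (negative_moment_const k)"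
          using d by (intro negative_moment_bound[OF B]) auto
        also have "\<dots> \<le> ennreal (6 * exp 2 * \<epsilon> / sqrt (1/2)) * ennreal (negative_moment_const k)"
          unfolding N.emeasure_eq_measure using q by (intro mult_right_mono ennreal_leI) auto
        also have "\<dots> = ennreal (6 * exp 2 / sqrt (1/2) * negative_moment_const k) * ennreal \<epsilon>"
          using nc e by (simp add: ennreal_mult[symmetric] mult_ac)
        also have "\<dots> \<le> ennreal (6 * exp 2 / sqrt (1/2) * negative_moment_const k) * (ennreal (3 * exp 1) * emeasure N (?S \<epsilon>))"
          using e d by (intro mult_left_mono S_le) auto
        also have "\<dots> = ennreal C * emeasure N (?S \<epsilon>)"
          using nc unfolding C_def mult.assoc[symmetric] by (subst ennreal_mult[symmetric]) (auto simp: mult_ac)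
        finally show "(\<integral>\<^sup>+w. indicator (?S \<epsilon>) w * ennreal (\<phi> (path_integral B w)) \<partial>N) \<le> ennreal C * emeasure N (?S \<epsilon>)" .
      qed (use d nc in \<open>auto simp: \<phi>_def C_def max_def\<close>)
      moreover have "(\<integral>\<^sup>+w. ennreal ((1 / (path_integral Y w + \<delta>)) ^ k) \<partial>M) = (\<integral>\<^sup>+w. ennreal (\<phi> (path_integral Y w)) \<partial>M)"
        using nonneg by (intro nn_integral_cong_AE) (auto elim!: eventually_mono simp: \<phi>_def)
      ultimately show "(\<integral>\<^sup>+w. ennreal ((1 / (path_integral Y w + \<delta>)) ^ k) \<partial>M)
          \<le> ennreal (3 * exp 1 * (6 * exp 2 / sqrt (1/2)) * negative_moment_const k)" by (simp add: C_def)
    qed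
    show "(\<integral>\<^sup>+w. ennreal (path_integral Y w ^ (2 * r + 1)) \<partial>M) < \<infinity>" if r: "1 \<le> r" for r
    proof -
      define C where "C = 3 * exp 1 * meander_const r"
      have mc: "0 \<le> meander_const r" by (simp add: meander_const_def abs_moment_nonneg)
      have *: "(\<integral>\<^sup>+w. ennreal (min (\<bar>path_integral Y w\<bar> ^ (2 * r + 1)) (real n)) \<partial>M) \<le> ennreal C" for n
      proof (rule func[where L = "real n" and \<epsilon>\<^sub>0 = 1])
        show "continuous_on UNIV (\<lambda>x::real. min (\<bar>x\<bar> ^ (2 * r + 1)) (real n))" by (intro continuous_intros)
        fix \<epsilon> :: real assume e: "0 < \<epsilon>" "\<epsilon> < 1"
        let ?A = "path_integral (\<lambda>t w. \<bar>B t w\<bar>)"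
        have "(\<integral>\<^sup>+w. indicator (?S \<epsilon>) w * ennreal (min (\<bar>path_integral B w\<bar> ^ (2 * r + 1)) (real n)) \<partial>N)
            \<le> (\<integral>\<^sup>+w. indicator (?S \<epsilon>) w * ennreal (?A w ^ (2 * r + 1)) \<partial>N)"
        proof (intro nn_integral_mono mult_left_mono ennreal_leI min.coboundedI1 power_mono)
          fix w assume w: "w \<in> space N"
          have "path_integral B w \<le> ?A w" "path_integral (\<lambda>t w. - \<bar>B t w\<bar>) w \<le> path_integral B w"
            using brownian_motionD(3)[OF B w] by (auto intro!: path_integral_mono continuous_intros)
          then show "\<bar>path_integral B w\<bar> \<le> ?A w"
            by (simp add: path_integral_def set_lebesgue_integral_def abs_le_iff)
        qed auto
        also have "\<dots> \<le> ennreal (meander_const r * \<epsilon>)"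
        proof (rule path_integral_odd_moment[OF continuous_process_abs[OF brownian_continuous_process[OF B]]])
          fix t :: real assume t: "t \<in> {0..1}"
          have "meander_const r * \<epsilon> * t ^ r \<le> meander_const r * \<epsilon> * 1"
            using t mc e by (intro mult_left_mono power_le_one) auto
          then show "(\<integral>\<^sup>+w. indicator (?S \<epsilon>) w * ennreal (\<bar>B t w\<bar> ^ (2 * r + 1)) \<partial>N) \<le> ennreal (meander_const r * \<epsilon>)"
            using moment_on_stay_above[OF B e(1) r, of t] t by (auto intro: order_trans[OF _ ennreal_leI])
        qed auto
        also have "\<dots> = ennreal (meander_const r) * ennreal \<epsilon>" using mc e by (simp add: ennreal_mult)
        also have "\<dots> \<le> ennreal (meander_const r) * (ennreal (3 * exp 1) * emeasure N (?S \<epsilon>))"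
          using e by (intro mult_left_mono S_le) auto
        also have "\<dots> = ennreal C * emeasure N (?S \<epsilon>)"
          using mc unfolding C_def mult.assoc[symmetric] by (subst ennreal_mult[symmetric]) (auto simp: mult_ac)
        finally show "(\<integral>\<^sup>+w. indicator (?S \<epsilon>) w * ennreal (min (\<bar>path_integral B w\<bar> ^ (2 * r + 1)) (real n)) \<partial>N)
            \<le> ennreal C * emeasure N (?S \<epsilon>)" .
      qed (use mc in \<open>auto simp: C_def\<close>)
      have "(\<integral>\<^sup>+w. ennreal (path_integral Y w ^ (2 * r + 1)) \<partial>M)
          \<le> (\<integral>\<^sup>+w. liminf (\<lambda>n. ennreal (min (\<bar>path_integral Y w\<bar> ^ (2 * r + 1)) (real n))) \<partial>M)"
      proof (rule nn_integral_mono)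
        fix w
        let ?v = "\<bar>path_integral Y w\<bar> ^ (2 * r + 1)"
        have "\<forall>\<^sub>F n in sequentially. min ?v (real n) = ?v"
          using eventually_ge_at_top[of "nat \<lceil>?v\<rceil>"] by eventually_elim linarith
        then have "(\<lambda>n. ennreal (min ?v (real n))) \<longlonglongrightarrow> ennreal ?v"
          by (intro tendsto_ennrealI tendsto_eventually)
        then have "liminf (\<lambda>n. ennreal (min ?v (real n))) = ennreal ?v" by (intro lim_imp_Liminf) auto
        moreover have "path_integral Y w ^ (2 * r + 1) \<le> ?v"
          using abs_ge_self[of "path_integral Y w ^ (2 * r + 1)"] by (simp only: power_abs)
        ultimately show "ennreal (path_integral Y w ^ (2 * r + 1)) \<le> liminf (\<lambda>n. ennreal (min ?v (real n)))"
          by (simp only: ennreal_leI)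
      qed
      also have "\<dots> \<le> liminf (\<lambda>n. \<integral>\<^sup>+w. ennreal (min (\<bar>path_integral Y w\<bar> ^ (2 * r + 1)) (real n)) \<partial>M)"
        by (intro nn_integral_liminf) auto
      also have "\<dots> \<le> liminf (\<lambda>n. ennreal C)" by (intro Liminf_mono always_eventually allI *)
      also have "\<dots> = ennreal C" by (intro lim_imp_Liminf) auto
      finally show ?thesis by (auto simp: less_top[symmetric] top_unique)
    qed
  qed auto
qed

section \<open>Bridge, Brownian motion and the theorem\<close>

lemma bridge_area_moments:
  assumes b: "brownian_bridge M b" and X: "X = path_integral (\<lambda>t w. \<bar>b t w\<bar>)"
  shows "entire_moments M X"
proof -
  obtain B where B: "brownian_motion M B" and bB: "b = (\<lambda>t w. B t w - t * B 1 w)"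
    using b by (auto simp: brownian_bridge_def)
  have "continuous_process M (\<lambda>t w. \<bar>b t w\<bar>)"
    unfolding bB by (intro continuous_process_abs bridge_continuous_process B)
  then show ?thesis
  proof (rule path_integral_moments_entire[OF B _ _ _ X])
    show "\<bar>B t w - 0 - B 1 w * t\<bar> \<le> \<bar>b t w\<bar>" for t w by (simp add: bB mult.commute)
    show "\<exists>C. \<forall>t\<in>{0..1}. (\<integral>\<^sup>+w. ennreal (\<bar>b t w\<bar> ^ (2 * r + 1)) \<partial>M) \<le> ennreal C" for r
      unfolding bB using bridge_odd_moment_le[OF B] by blast
  qed
qed

lemma brownian_motion_area_moments:
  assumes B: "brownian_motion M B" and X: "X = path_integral (\<lambda>t w. \<bar>B t w\<bar>)"
  shows "entire_moments M X"
proof (rule path_integral_moments_entire[OF B _ _ _ X])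
  show "continuous_process M (\<lambda>t w. \<bar>B t w\<bar>)"
    by (intro continuous_process_abs brownian_continuous_process B)
  show "\<bar>B t w - 0 - 0 * t\<bar> \<le> \<bar>B t w\<bar>" for t w by simp
  show "\<exists>C. \<forall>t\<in>{0..1}. (\<integral>\<^sup>+w. ennreal (\<bar>B t w\<bar> ^ (2 * r + 1)) \<partial>M) \<le> ennreal C" for r
    using brownian_abs_odd_moment_le[OF B] by blast
qed

theorem mainTheorem1:
  fixes M :: "'a measure" and X :: "'a \<Rightarrow> real"
  assumes "prob_space M"
    and "(\<exists>E. brownian_excursion M E \<and> X = path_integral E) \<or>
         (\<exists>b. brownian_bridge M b \<and> X = path_integral (\<lambda>t \<omega>. \<bar>b t \<omega>\<bar>)) \<or>
         (\<exists>B. brownian_motion M B \<and> X = path_integral (\<lambda>t \<omega>. \<bar>B t \<omega>\<bar>)) \<or>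
         (\<exists>Y. brownian_meander M Y \<and> X = path_integral Y) \<or>
         (\<exists>D. brownian_double_meander M D \<and> X = path_integral D)"
  shows "(AE \<omega> in M. 0 < X \<omega>) \<and>
         (\<forall>s::real. s > 0 \<longrightarrow> integrable M (\<lambda>\<omega>. X \<omega> powr (- s))) \<and>
         (\<forall>s::complex. integrable M (\<lambda>\<omega>. complex_of_real (X \<omega>) powr s)) \<and>
         (\<lambda>s::complex. LINT \<omega>|M. complex_of_real (X \<omega>) powr s) holomorphic_on UNIV"
proof -
  have "entire_moments M X"
    using assms(2)
  proof (elim disjE exE conjE)
    show "entire_moments M X" if "brownian_excursion M E" "X = path_integral E" for E
      using that by (rule excursion_area_moments)
    show "entire_moments M X" if "brownian_bridge M b" "X = path_integral (\<lambda>t \<omega>. \<bar>b t \<omega>\<bar>)" for b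
      using that by (rule bridge_area_moments)
    show "entire_moments M X" if "brownian_motion M B" "X = path_integral (\<lambda>t \<omega>. \<bar>B t \<omega>\<bar>)" for B
      using that by (rule brownian_motion_area_moments)
    show "entire_moments M X" if "brownian_meander M Y" "X = path_integral Y" for Y
      using that by (rule meander_area_moments)
    show "entire_moments M X" if "brownian_double_meander M D" "X = path_integral D" for D
      using that by (rule double_meander_area_moments)
  qed
  then show ?thesis unfolding entire_moments_def .
qed

end
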